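(* Let $G$ be a hyperbolic group. Then there is a constant $\alpha>0$ such that for every finite subset $U\subset G$ that is not contained in a virtually cyclic subgroup of $G$ we have $|U^3|\geqslant (\alpha |U|)^2$, and more generally, for all natural numbers $n\geqslant 1$, $$|U^n|\geqslant (\alpha |U|)^{[(n+1)/2]}.$$
   Context: A group $G$ is hyperbolic if it admits a proper and cocompact action by isometries on a proper geodesic $\delta$--hyperbolic metric space for some $\delta\geqslant 0$. For a subset $U$ of a group, $U^n$ denotes the set of all products $u_1u_2\cdots u_n$ with $u_i\in U$, and $|U|$ denotes the cardinality of $U$. $[x]$ denotes the integral part of $x$. *)

theory Defs
  imports "HOL-Analysis.Analysis" "HOL-Algebra.Coset"
begin

definition proper_space :: "'b::metric_space itself \<Rightarrow> bool" where
  "proper_space _ \<longleftrightarrow> (\<forall>(x::'b) r. compact (cball x r))"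

definition geodesic_space :: "'b::metric_space itself \<Rightarrow> bool" where
  "geodesic_space _ \<longleftrightarrow> (\<forall>(x::'b) y. \<exists>\<gamma>::real \<Rightarrow> 'b.
      \<gamma> 0 = x \<and> \<gamma> (dist x y) = y \<and>
      (\<forall>s\<in>{0..dist x y}. \<forall>t\<in>{0..dist x y}. dist (\<gamma> s) (\<gamma> t) = \<bar>s - t\<bar>))"

definition gromov_product :: "'b::metric_space \<Rightarrow> 'b \<Rightarrow> 'b \<Rightarrow> real" where
  "gromov_product w x y = (dist w x + dist w y - dist x y) / 2"

definition delta_hyperbolic :: "'b::metric_space itself \<Rightarrow> real \<Rightarrow> bool" where
  "delta_hyperbolic _ \<delta> \<longleftrightarrow> (\<forall>(w::'b) x y z.
      gromov_product w x y \<ge> min (gromov_product w x z) (gromov_product w y z) - \<delta>)"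

definition isometric_action :: "('a, 'c) monoid_scheme \<Rightarrow> ('a \<Rightarrow> 'b::metric_space \<Rightarrow> 'b) \<Rightarrow> bool" where
  "isometric_action G \<phi> \<longleftrightarrow>
     (\<forall>x. \<phi> \<one>\<^bsub>G\<^esub> x = x) \<and>
     (\<forall>g\<in>carrier G. \<forall>h\<in>carrier G. \<forall>x. \<phi> (g \<otimes>\<^bsub>G\<^esub> h) x = \<phi> g (\<phi> h x)) \<and>
     (\<forall>g\<in>carrier G. \<forall>x y. dist (\<phi> g x) (\<phi> g y) = dist x y)"

definition proper_action :: "('a, 'c) monoid_scheme \<Rightarrow> ('a \<Rightarrow> 'b::metric_space \<Rightarrow> 'b) \<Rightarrow> bool" where
  "proper_action G \<phi> \<longleftrightarrow>
     (\<forall>K. compact K \<longrightarrow> finite {g \<in> carrier G. \<phi> g ` K \<inter> K \<noteq> {}})"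

definition cocompact_action :: "('a, 'c) monoid_scheme \<Rightarrow> ('a \<Rightarrow> 'b::metric_space \<Rightarrow> 'b) \<Rightarrow> bool" where
  "cocompact_action G \<phi> \<longleftrightarrow> (\<exists>K. compact K \<and> (\<Union>g\<in>carrier G. \<phi> g ` K) = UNIV)"

definition virtually_cyclic_subgroup :: "('a, 'c) monoid_scheme \<Rightarrow> 'a set \<Rightarrow> bool" where
  "virtually_cyclic_subgroup G H \<longleftrightarrow> subgroup H G \<and>
     (\<exists>c\<in>H. \<exists>F. finite F \<and> F \<subseteq> H \<and>
        H = (\<Union>f\<in>F. f <#\<^bsub>G\<^esub> {c [^]\<^bsub>G\<^esub> (k::int) | k. True}))"

fun set_power :: "('a, 'c) monoid_scheme \<Rightarrow> 'a set \<Rightarrow> nat \<Rightarrow> 'a set" where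
  "set_power G U 0 = {\<one>\<^bsub>G\<^esub>}"
| "set_power G U (Suc n) = U <#>\<^bsub>G\<^esub> set_power G U n"

end

theory Submission
  imports Defs
begin

text \<open>
  Fix an orbit map and write \<open>len g\<close> for the displacement of the base point. After conjugating \<open>U\<close>, the total
  length of its elements is almost minimal among its conjugates. Minimality forbids that most elements start
  and end in the same direction, which yields \<open>W, V \<subseteq> U\<close> of positive proportion such that all products
  \<open>w1 v w2 v \<dots> wk\<close> with \<open>wi \<in> W\<close>, \<open>v \<in> V\<close> are reduced and \<open>len w \<le> len v\<close>. For a fixed \<open>v\<close>, two
  ways of reading off \<open>w1\<close> from such a product show that \<open>v\<close> is periodic, and they differ by an element of
  the maximal virtually cyclic subgroup \<open>E\<close> of the period. So either a proportion of \<open>W\<close> can be read off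
  with bounded ambiguity, which gives about \<open>card U ^ k\<close> products of length \<open>2 * k - 1\<close>, or \<open>W\<close> is covered by
  few cosets of \<open>E\<close>. In the latter case, for all \<open>v\<close> and also for the inverses, \<open>E\<close> does not depend on \<open>v\<close>
  and \<open>V\<close> lies in a single coset of \<open>E\<close>. Then an element of \<open>U\<close> outside \<open>E\<close>, or the coset representative
  itself, serves as separator: its translates of the axis of \<open>E\<close> overlap the axis only boundedly.
\<close>

section \<open>Finite sets\<close>

text \<open>Lengths of elements of \<open>U\<close> must not enter the constant. Ball sizes
  therefore occur in it only at radii independent of \<open>U\<close>; every other comparison is
  relative, to \<open>len v\<close> or to the length of a shortest translation of \<open>E\<close>.
  The latter has to be singled out because a period may be a high power, and then the number of
  elements of \<open>E\<close> shorter than it has no uniform bound.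

  A separator is needed since products inside a cyclic subgroup forget their factors. Spending every
  second factor on it produces the exponent \<open>(n + 1) div 2\<close>, and this cannot be
  improved: for \<open>U = {a, ..., a^N, b}\<close> in a free group, \<open>n\<close> factors leave
  room for at most that many independent powers of \<open>a\<close>.

  A period of \<open>v\<close> describes \<open>v\<close> as seen from its start, a period of
  \<open>inv v\<close> as seen from its end, and conjugation by \<open>v\<close> relates the two.
  This is why inverses are considered: two separators with commensurable data at both ends differ by
  an element that conjugates an infinite-order element of \<open>E\<close> into \<open>E\<close>,
  hence by an element of \<open>E\<close>.\<close>

lemma card_le_fibers:
  assumes "finite F" "finite C" "h ` F \<subseteq> C" "\<And>c. c \<in> C \<Longrightarrow> card {x \<in> F. h x = c} \<le> n"
  shows "card F \<le> n * card C"
proof -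
  have "F = (\<Union>c\<in>C. {x \<in> F. h x = c})" using assms(3) by auto
  then have "card F \<le> (\<Sum>c\<in>C. card {x \<in> F. h x = c})"
    using card_UN_le[OF assms(2), of "\<lambda>c. {x \<in> F. h x = c}"] by simp
  also have "\<dots> \<le> (\<Sum>c\<in>C. n)" by (intro sum_mono assms(4))
  finally show ?thesis by (simp add: mult.commute)
qed

lemma obtains_min:
  fixes f :: "'a \<Rightarrow> real"
  assumes "finite A" "A \<noteq> {}"
  obtains x where "x \<in> A" "\<And>y. y \<in> A \<Longrightarrow> f x \<le> f y"
  using arg_min_if_finite[OF assms, of f] that by (meson not_le_imp_less)

lemma median_exists:
  fixes f :: "'a \<Rightarrow> real"
  assumes A: "finite A" "A \<noteq> {}"
  shows "\<exists>t. card A \<le> 2 * card {a \<in> A. f a \<le> t} \<and> card A \<le> 2 * card {a \<in> A. t \<le> f a}"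
proof -
  let ?S = "{s \<in> A. card A \<le> 2 * card {a \<in> A. f a \<le> f s}}"
  obtain m where m: "m \<in> A" "\<And>y. y \<in> A \<Longrightarrow> f y \<le> f m"
    using obtains_min[OF A, of "\<lambda>a. - f a"] by auto
  then have "{a \<in> A. f a \<le> f m} = A" by auto
  then have "m \<in> ?S" using m by simp
  then have "?S \<noteq> {}" by blast
  moreover have "finite ?S" using A by simp
  ultimately obtain s where s: "s \<in> ?S" "\<And>y. y \<in> ?S \<Longrightarrow> f s \<le> f y"
    using obtains_min[of ?S f] by blast
  let ?L = "{a \<in> A. f a < f s}"
  have "2 * card ?L \<le> card A"
  proof (cases "?L = {}")
    case False
    then obtain l where l: "l \<in> ?L" "\<And>y. y \<in> ?L \<Longrightarrow> f y \<le> f l"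
      using obtains_min[of ?L "\<lambda>a. - f a"] A by auto
    have "{a \<in> A. f a \<le> f l} = ?L" using l by auto
    moreover have "l \<notin> ?S" using s(2)[of l] l(1) by auto
    ultimately show ?thesis using l by auto
  next
    case True
    show ?thesis unfolding True by simp
  qed
  moreover have "card A = card ?L + card {a \<in> A. f s \<le> f a}"
    using A by (subst card_Un_disjoint[symmetric]) (auto intro!: arg_cong[where f = card])
  ultimately show ?thesis using s(1) by (intro exI[of _ "f s"]) auto
qed

text \<open>At least half of \<open>B\<close> lies on one side of a median of \<open>A\<close>; it
  is matched with the half of \<open>A\<close> on the other side. Which set supplies the smaller
  values cannot be prescribed, hence the disjunction.\<close>

lemma median_split:
  fixes f :: "'a \<Rightarrow> real"
  assumes A: "finite A" "A \<noteq> {}" and B: "finite B"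
  shows "\<exists>W V. (W \<subseteq> A \<and> V \<subseteq> B \<and> card A \<le> 2 * card W \<and> card B \<le> 2 * card V \<or>
      W \<subseteq> B \<and> V \<subseteq> A \<and> card B \<le> 2 * card W \<and> card A \<le> 2 * card V)
    \<and> (\<forall>w\<in>W. \<forall>v\<in>V. f w \<le> f v)"
proof -
  obtain t where t: "card A \<le> 2 * card {a \<in> A. f a \<le> t}" "card A \<le> 2 * card {a \<in> A. t \<le> f a}"
    using median_exists[OF A] by blast
  have "card B = card ({b \<in> B. f b \<le> t} \<union> {b \<in> B. t \<le> f b})"
    by (rule arg_cong[where f = card]) auto
  also have "\<dots> \<le> card {b \<in> B. f b \<le> t} + card {b \<in> B. t \<le> f b}" by (rule card_Un_le)
  finally consider "card B \<le> 2 * card {b \<in> B. t \<le> f b}" | "card B \<le> 2 * card {b \<in> B. f b \<le> t}" by linarith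
  then show ?thesis
  proof cases
    case 1
    then show ?thesis using t
      by (intro exI[of _ "{a \<in> A. f a \<le> t}"] exI[of _ "{b \<in> B. t \<le> f b}"]) auto
  next
    case 2
    then show ?thesis using t
      by (intro exI[of _ "{b \<in> B. f b \<le> t}"] exI[of _ "{a \<in> A. t \<le> f a}"]) auto
  qed
qed

text \<open>Deleting a whole fiber of at most \<open>K\<close> points removes a value of
  \<open>h1\<close> or \<open>h2\<close>, so both sides of the inequality drop in its favour. It
  survives all deletions and keeps the process from exhausting \<open>X\<close>. For two coset maps,
  every remaining element has many companions with respect to both.\<close>

lemma trim_fibers:
  assumes "finite X" "K * (card (h1 ` X) + card (h2 ` X)) < card X"
  shows "\<exists>Y\<subseteq>X. Y \<noteq> {} \<and> (\<forall>x\<in>Y. K < card {y \<in> Y. h1 y = h1 x} \<and> K < card {y \<in> Y. h2 y = h2 x})"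
  using assms
proof (induction "card X" arbitrary: X rule: less_induct)
  case less
  have step: ?case
    if x: "x \<in> X" and small: "card {y \<in> X. g y = g x} \<le> K" and
      g: "\<And>X'. X' \<subseteq> X \<Longrightarrow> card (g ` X') < card (g ` X) \<Longrightarrow>
        card (h1 ` X') + card (h2 ` X') < card (h1 ` X) + card (h2 ` X)" for x and g :: "'a \<Rightarrow> 'd"
  proof -
    define X' where "X' = X - {y \<in> X. g y = g x}"
    have sub: "X' \<subseteq> X" and lt: "card X' < card X"
      using x less.prems(1) by (auto simp: X'_def intro!: psubset_card_mono)
    have "g x \<in> g ` X" "g x \<notin> g ` X'" using x by (auto simp: X'_def)
    then have "g ` X' \<subset> g ` X" using sub by blast
    then have "card (g ` X') < card (g ` X)" using less.prems(1) by (intro psubset_card_mono) auto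
    then have "card (h1 ` X') + card (h2 ` X') + 1 \<le> card (h1 ` X) + card (h2 ` X)"
      using g[OF sub] by simp
    then have "K * (card (h1 ` X') + card (h2 ` X') + 1) \<le> K * (card (h1 ` X) + card (h2 ` X))"
      by (rule mult_le_mono2)
    moreover have "card X' = card X - card {y \<in> X. g y = g x}"
      unfolding X'_def using less.prems(1) by (intro card_Diff_subset) auto
    ultimately have "K * (card (h1 ` X') + card (h2 ` X')) < card X'"
      using less.prems(2) small by (simp add: algebra_simps)
    then obtain Y where "Y \<subseteq> X'"
      "Y \<noteq> {} \<and> (\<forall>x\<in>Y. K < card {y \<in> Y. h1 y = h1 x} \<and> K < card {y \<in> Y. h2 y = h2 x})"
      using less.hyps[OF lt finite_subset[OF sub less.prems(1)]] by auto
    then show ?thesis using sub by (intro exI[of _ Y] conjI) auto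
  qed
  have "X \<noteq> {}" using less.prems by auto
  show ?case
  proof (cases "\<forall>x\<in>X. K < card {y \<in> X. h1 y = h1 x} \<and> K < card {y \<in> X. h2 y = h2 x}")
    case True
    then show ?thesis using \<open>X \<noteq> {}\<close> by blast
  next
    case False
    then obtain x where x: "x \<in> X" "card {y \<in> X. h1 y = h1 x} \<le> K \<or> card {y \<in> X. h2 y = h2 x} \<le> K"
      by (auto simp: not_less)
    have mono: "card (h1 ` X') \<le> card (h1 ` X)" "card (h2 ` X') \<le> card (h2 ` X)" if "X' \<subseteq> X" for X'
      using that less.prems(1) by (auto intro!: card_mono)
    from x(2) show ?thesis
    proof
      assume "card {y \<in> X. h1 y = h1 x} \<le> K"
      then show ?thesis by (rule step[OF x(1)]) (use mono in \<open>simp add: add_less_le_mono\<close>)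
    next
      assume "card {y \<in> X. h2 y = h2 x} \<le> K"
      then show ?thesis by (rule step[OF x(1)]) (use mono in \<open>simp add: add_le_less_mono\<close>)
    qed
  qed
qed

section \<open>Groups\<close>

context group begin

section \<open>Cancellation and conjugation\<close>

lemma inv_mult_cancel: "\<lbrakk>a \<in> carrier G; b \<in> carrier G\<rbrakk> \<Longrightarrow> inv a \<otimes> (a \<otimes> b) = b"
  by (simp add: m_assoc[symmetric])

lemma mult_inv_cancel: "\<lbrakk>a \<in> carrier G; b \<in> carrier G\<rbrakk> \<Longrightarrow> a \<otimes> (inv a \<otimes> b) = b"
  by (simp add: m_assoc[symmetric])

lemma conj_mult:
  assumes "g \<in> carrier G" "x \<in> carrier G" "y \<in> carrier G"
  shows "(g \<otimes> x \<otimes> inv g) \<otimes> (g \<otimes> y \<otimes> inv g) = g \<otimes> (x \<otimes> y) \<otimes> inv g"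
proof -
  have "inv g \<otimes> (g \<otimes> (y \<otimes> inv g)) = y \<otimes> inv g" using assms by (simp add: m_assoc[symmetric])
  then show ?thesis using assms by (simp add: m_assoc)
qed

lemma conj_inv:
  assumes "g \<in> carrier G" "x \<in> carrier G"
  shows "inv (g \<otimes> x \<otimes> inv g) = g \<otimes> inv x \<otimes> inv g"
  using assms by (simp add: inv_mult_group m_assoc)

lemma conj_int_pow:
  assumes g: "g \<in> carrier G" and q: "q \<in> carrier G"
  shows "(g \<otimes> q \<otimes> inv g) [^] (k::int) = g \<otimes> q [^] k \<otimes> inv g"
proof -
  have nat: "(g \<otimes> q \<otimes> inv g) [^] n = g \<otimes> q [^] n \<otimes> inv g" for n :: nat
    by (induction n) (use g q in \<open>simp_all add: conj_mult\<close>)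
  show ?thesis
    by (cases k rule: int_cases2) (use g q nat in \<open>simp_all add: int_pow_int int_pow_neg conj_inv\<close>)
qed

lemma inj_on_conj:
  assumes "g \<in> carrier G"
  shows "inj_on (\<lambda>x. g \<otimes> x \<otimes> inv g) (carrier G)"
  using assms by (auto intro!: inj_onI)

lemma inj_on_mult_left: "a \<in> carrier G \<Longrightarrow> inj_on (\<lambda>x. a \<otimes> x) (carrier G)"
  by (auto intro!: inj_onI)

lemma inj_on_mult_right: "a \<in> carrier G \<Longrightarrow> inj_on (\<lambda>x. x \<otimes> a) (carrier G)"
  by (auto intro!: inj_onI)

lemma inj_on_inv_mult:
  assumes "x \<in> carrier G" "X \<subseteq> carrier G"
  shows "inj_on (\<lambda>y. inv x \<otimes> y) X"
  using assms by (intro inj_on_subset[OF inj_on_mult_left]) auto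

text \<open>Growth is proved for a conjugate of \<open>U\<close>; this carries a virtually cyclic
  subgroup containing the conjugate back to one containing \<open>U\<close>.\<close>

lemma conj_virtually_cyclic:
  assumes H: "virtually_cyclic_subgroup G H" and g: "g \<in> carrier G"
  shows "virtually_cyclic_subgroup G ((\<lambda>x. g \<otimes> x \<otimes> inv g) ` H)"
proof -
  let ?c = "\<lambda>x. g \<otimes> x \<otimes> inv g"
  obtain c F where sub: "subgroup H G" and c: "c \<in> H" and F: "finite F" "F \<subseteq> H"
    and e: "H = (\<Union>f\<in>F. f <# {c [^] (k::int) | k. True})"
    using H by (auto simp: virtually_cyclic_subgroup_def)
  have Hc: "H \<subseteq> carrier G" by (rule subgroup.subset[OF sub])
  have cc: "c \<in> carrier G" using c Hc by auto
  have "subgroup (?c ` H) G"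
  proof (rule subgroupI)
    show "?c ` H \<subseteq> carrier G" "?c ` H \<noteq> {}" using Hc g c by auto
    fix a b assume "a \<in> ?c ` H" "b \<in> ?c ` H"
    then obtain x y where x: "x \<in> H" "a = ?c x" and y: "y \<in> H" "b = ?c y" by auto
    have xy: "x \<in> carrier G" "y \<in> carrier G" using x y Hc by auto
    have "inv a = ?c (inv x)" using x xy g by (simp add: conj_inv)
    then show "inv a \<in> ?c ` H" using subgroup.m_inv_closed[OF sub x(1)] by auto
    have "a \<otimes> b = ?c (x \<otimes> y)" using x y xy g by (simp add: conj_mult)
    then show "a \<otimes> b \<in> ?c ` H" using subgroup.m_closed[OF sub x(1) y(1)] by auto
  qed
  moreover have "?c ` (f <# {c [^] (k::int) | k. True}) = ?c f <# {?c c [^] (k::int) | k. True}"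
    if "f \<in> F" for f
  proof -
    have f: "f \<in> carrier G" using that F Hc by auto
    have 1: "f <# {c [^] (k::int) | k. True} = range (\<lambda>k::int. f \<otimes> c [^] k)"
      and 2: "?c f <# {?c c [^] (k::int) | k. True} = range (\<lambda>k::int. ?c f \<otimes> ?c c [^] k)"
      by (auto simp: l_coset_def)
    show ?thesis unfolding 1 2 image_image
      by (rule image_cong) (use f cc g in \<open>simp_all add: conj_int_pow conj_mult\<close>)
  qed
  then have "?c ` H = (\<Union>f\<in>?c ` F. f <# {?c c [^] (k::int) | k. True})"
    unfolding image_UN by (subst e) (simp add: image_UN)
  moreover have "?c c \<in> ?c ` H" "finite (?c ` F)" "?c ` F \<subseteq> ?c ` H" using c F by auto
  ultimately show ?thesis
    unfolding virtually_cyclic_subgroup_def by blast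
qed

section \<open>Product sets and their cardinalities\<close>

lemma set_power_carrier: "U \<subseteq> carrier G \<Longrightarrow> set_power G U n \<subseteq> carrier G"
  by (induction n) (auto simp: set_mult_def)

lemma set_power_finite: "finite U \<Longrightarrow> finite (set_power G U n)"
  by (induction n) (auto simp: set_mult_def)

lemma set_power_SucI: "\<lbrakk>u \<in> U; x \<in> set_power G U n\<rbrakk> \<Longrightarrow> u \<otimes> x \<in> set_power G U (Suc n)"
  by (auto simp: set_mult_def)

lemma card_set_power_Suc:
  assumes "finite U" "U \<subseteq> carrier G" "U \<noteq> {}"
  shows "card (set_power G U n) \<le> card (set_power G U (Suc n))"
proof -
  obtain u where u: "u \<in> U" using assms by blast
  show ?thesis
  proof (rule card_inj_on_le)
    have "u \<in> carrier G" using u assms by auto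
    then show "inj_on (\<lambda>x. u \<otimes> x) (set_power G U n)"
      by (intro inj_on_subset[OF inj_on_mult_left set_power_carrier[OF assms(2)]])
    show "(\<lambda>x. u \<otimes> x) ` set_power G U n \<subseteq> set_power G U (Suc n)"
      using set_power_SucI[OF u] by auto
  qed (rule set_power_finite[OF assms(1)])
qed

lemma card_set_power_mono:
  assumes "finite U" "U \<subseteq> carrier G" "U \<noteq> {}" "m \<le> n"
  shows "card (set_power G U m) \<le> card (set_power G U n)"
  using lift_Suc_mono_le[of "\<lambda>n. card (set_power G U n)" m n] card_set_power_Suc[OF assms(1-3)] assms(4) by blast

text \<open>\<open>set_power\<close> adds factors on the left, whereas inversion reverses their
  order; this moves the new factor to the other side.\<close>

lemma set_power_commute:
  assumes "U \<subseteq> carrier G"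
  shows "set_power G U n <#> U = U <#> set_power G U n"
proof (induction n)
  case 0
  have "\<forall>u\<in>U. u \<in> carrier G" using assms by blast
  then show ?case by (auto simp: set_mult_def)
next
  case (Suc n)
  have "set_power G U (Suc n) <#> U = U <#> (set_power G U n <#> U)"
    using assms set_power_carrier[OF assms, of n] by (simp add: set_mult_assoc)
  then show ?case unfolding Suc by simp
qed

lemma inv_set_power:
  assumes "U \<subseteq> carrier G"
  shows "(\<lambda>x. inv x) ` set_power G U n = set_power G ((\<lambda>x. inv x) ` U) n"
proof (induction n)
  case (Suc n)
  have "(\<lambda>x. inv x) ` (U <#> set_power G U n) = ((\<lambda>x. inv x) ` set_power G U n) <#> ((\<lambda>x. inv x) ` U)"
    using assms set_power_carrier[OF assms, of n]
    by (force simp: set_mult_def inv_mult_group subset_eq image_iff)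
  also have "\<dots> = ((\<lambda>x. inv x) ` U) <#> set_power G ((\<lambda>x. inv x) ` U) n"
    unfolding Suc by (rule set_power_commute) (use assms in auto)
  finally show ?case by simp
qed simp

lemma card_inv_set_power:
  assumes "U \<subseteq> carrier G"
  shows "card (set_power G ((\<lambda>x. inv x) ` U) n) = card (set_power G U n)"
  unfolding inv_set_power[OF assms, symmetric]
  by (rule card_image, rule inj_on_subset[OF inv_inj set_power_carrier[OF assms]])

lemma conj_set_power:
  assumes U: "U \<subseteq> carrier G" and g: "g \<in> carrier G"
  shows "(\<lambda>x. g \<otimes> x \<otimes> inv g) ` set_power G U n = set_power G ((\<lambda>x. g \<otimes> x \<otimes> inv g) ` U) n"
proof (induction n)
  case 0
  then show ?case using g by simp
next
  case (Suc n)
  let ?c = "\<lambda>x. g \<otimes> x \<otimes> inv g"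
  have "?c ` (U <#> set_power G U n) = (\<lambda>(u, x). ?c (u \<otimes> x)) ` (U \<times> set_power G U n)"
    by (force simp: set_mult_def)
  also have "\<dots> = (\<lambda>(u, x). ?c u \<otimes> ?c x) ` (U \<times> set_power G U n)"
    by (rule image_cong) (use U g set_power_carrier[OF U, of n] in \<open>auto simp: conj_mult subset_eq\<close>)
  also have "\<dots> = (?c ` U) <#> (?c ` set_power G U n)"
    by (force simp: set_mult_def)
  finally show ?case unfolding Suc by simp
qed

text \<open>The left coset of \<open>x\<close>. The cardinality of its image on \<open>W\<close> is
  the number of cosets that cover \<open>W\<close>.\<close>

definition lclass :: "'a set \<Rightarrow> 'a \<Rightarrow> 'a set" where
  "lclass H x = {y \<in> carrier G. inv x \<otimes> y \<in> H}"

lemma lclass_eq_iff: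
  assumes H: "subgroup H G" and [simp]: "x \<in> carrier G" "y \<in> carrier G"
  shows "lclass H x = lclass H y \<longleftrightarrow> inv x \<otimes> y \<in> H"
proof
  assume "lclass H x = lclass H y"
  moreover have "y \<in> lclass H y" using subgroup.one_closed[OF H] by (simp add: lclass_def)
  ultimately have "y \<in> lclass H x" by simp
  then show "inv x \<otimes> y \<in> H" by (simp add: lclass_def)
next
  assume xy: "inv x \<otimes> y \<in> H"
  have yx: "inv y \<otimes> x \<in> H"
    using subgroup.m_inv_closed[OF H xy] by (simp add: inv_mult_group)
  have "inv x \<otimes> z \<in> H \<longleftrightarrow> inv y \<otimes> z \<in> H" if [simp]: "z \<in> carrier G" for z
    using subgroup.m_closed[OF H xy, of "inv y \<otimes> z"] subgroup.m_closed[OF H yx, of "inv x \<otimes> z"]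
    by (auto simp: m_assoc mult_inv_cancel)
  then show "lclass H x = lclass H y" by (auto simp: lclass_def)
qed

lemma transversal_exists:
  assumes H: "subgroup H G" and W: "W \<subseteq> carrier G"
  shows "\<exists>W'\<subseteq>W. card W' = card (lclass H ` W) \<and> (\<forall>w\<in>W'. \<forall>w'\<in>W'. inv w \<otimes> w' \<in> H \<longrightarrow> w = w')"
proof -
  obtain W' where W': "W' \<subseteq> W" "inj_on (lclass H) W'" "lclass H ` W' = lclass H ` W"
    by (metis subset_image_inj order_refl)
  have "w = w'" if "w \<in> W'" "w' \<in> W'" "inv w \<otimes> w' \<in> H" for w w'
    using that W' W lclass_eq_iff[OF H, of w w'] by (auto simp: inj_on_def subset_eq)
  then show ?thesis using W' card_image[OF W'(2)] by (intro exI[of _ W']) auto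
qed

text \<open>The products \<open>w0 \<otimes> t \<otimes> w1 \<otimes> t \<otimes> \<dots> \<otimes> t \<otimes> wk\<close> with all \<open>wi\<close> in \<open>W\<close>.\<close>

primrec code :: "'a \<Rightarrow> 'a set \<Rightarrow> nat \<Rightarrow> 'a set" where
  "code t W 0 = W"
| "code t W (Suc k) = (\<lambda>(w, y). w \<otimes> (t \<otimes> y)) ` (W \<times> code t W k)"

lemma code_finite: "finite W \<Longrightarrow> finite (code t W k)"
  by (induction k) auto

lemma code_carrier: "\<lbrakk>W \<subseteq> carrier G; t \<in> carrier G\<rbrakk> \<Longrightarrow> code t W k \<subseteq> carrier G"
  by (induction k) auto

text \<open>The first factor and the product determine the rest by cancellation, so only the
  ambiguity of the first factor has to be bounded, and each further letter costs one factor
  \<open>m\<close>.\<close>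

lemma code_card:
  assumes W: "finite W" "W \<subseteq> carrier G" and t: "t \<in> carrier G"
    and m: "\<And>k x. card {w \<in> W. \<exists>y\<in>code t W k. x = w \<otimes> (t \<otimes> y)} \<le> m"
  shows "card W ^ Suc k \<le> m ^ k * card (code t W k)"
proof (induction k)
  case (Suc k)
  let ?Q = "code t W k" and ?f = "\<lambda>(w, y). w \<otimes> (t \<otimes> y)"
  have Q: "finite ?Q" "?Q \<subseteq> carrier G" using code_finite[OF W(1)] code_carrier[OF W(2) t] by auto
  have "card (W \<times> ?Q) \<le> m * card (?f ` (W \<times> ?Q))"
  proof (rule card_le_fibers[where h = ?f])
    fix x assume "x \<in> ?f ` (W \<times> ?Q)"
    let ?A = "{z \<in> W \<times> ?Q. ?f z = x}"
    have "inj_on fst ?A"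
    proof (rule inj_onI)
      fix z z' assume z: "z \<in> ?A" "z' \<in> ?A" "fst z = fst z'"
      obtain w y y' where e: "z = (w, y)" "z' = (w, y')" using z(3) by (cases z, cases z') auto
      then have "w \<otimes> (t \<otimes> y) = w \<otimes> (t \<otimes> y')" "w \<in> carrier G" "y \<in> carrier G" "y' \<in> carrier G"
        using z W Q by auto
      then show "z = z'" using e t by simp
    qed
    moreover have "fst ` ?A \<subseteq> {w \<in> W. \<exists>y\<in>?Q. x = w \<otimes> (t \<otimes> y)}" by auto
    moreover have "finite {w \<in> W. \<exists>y\<in>?Q. x = w \<otimes> (t \<otimes> y)}" using W by auto
    ultimately have "card ?A \<le> card {w \<in> W. \<exists>y\<in>?Q. x = w \<otimes> (t \<otimes> y)}"
      by (rule card_inj_on_le)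
    then show "card ?A \<le> m" using m by (rule order_trans)
  qed (use W Q in auto)
  then have step: "card W * card ?Q \<le> m * card (code t W (Suc k))"
    by (simp add: card_cartesian_product)
  have "card W ^ Suc (Suc k) \<le> card W * (m ^ k * card ?Q)"
    using mult_le_mono2[OF Suc, of "card W"] by simp
  also have "\<dots> \<le> m ^ k * (m * card (code t W (Suc k)))"
    using mult_le_mono2[OF step, of "m ^ k"] by (simp add: mult.left_commute)
  finally show ?case by (simp add: mult.assoc mult.left_commute del: code.simps)
qed simp

text \<open>In \<open>e0 (a w b) e1 (a w b) ...\<close> the neighbouring letters absorb
  \<open>a\<close> and \<open>b\<close>. A separator may thus be exchanged for another element of
  its double coset, for instance a shortest one.\<close>

lemma code_conj:
  assumes [simp]: "a \<in> carrier G" "b \<in> carrier G" "w \<in> carrier G" and F: "F \<subseteq> carrier G"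
  shows "(\<lambda>x. b \<otimes> x \<otimes> a) ` code (a \<otimes> w \<otimes> b) F k = code w ((\<lambda>x. b \<otimes> x \<otimes> a) ` F) k"
proof (induction k)
  case (Suc k)
  let ?g = "\<lambda>x. b \<otimes> x \<otimes> a"
  have Q: "code (a \<otimes> w \<otimes> b) F k \<subseteq> carrier G" using F by (intro code_carrier) auto
  have e: "?g (e \<otimes> ((a \<otimes> w \<otimes> b) \<otimes> y)) = ?g e \<otimes> (w \<otimes> ?g y)" if "e \<in> F" "y \<in> code (a \<otimes> w \<otimes> b) F k" for e y
    using that F Q by (auto simp: m_assoc subset_eq)
  have "?g ` code (a \<otimes> w \<otimes> b) F (Suc k) = (\<lambda>(e, y). ?g (e \<otimes> ((a \<otimes> w \<otimes> b) \<otimes> y))) ` (F \<times> code (a \<otimes> w \<otimes> b) F k)"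
    by (simp add: image_image split_def)
  also have "\<dots> = (\<lambda>(e, y). ?g e \<otimes> (w \<otimes> ?g y)) ` (F \<times> code (a \<otimes> w \<otimes> b) F k)"
    by (rule image_cong) (auto simp: e)
  also have "\<dots> = (\<lambda>(e, y). e \<otimes> (w \<otimes> y)) ` (?g ` F \<times> ?g ` code (a \<otimes> w \<otimes> b) F k)"
    by (auto simp: image_iff split_def) blast+
  finally show ?case unfolding Suc by simp
qed simp

lemma code_mono: "W \<subseteq> W' \<Longrightarrow> code t W k \<subseteq> code t W' k"
  by (induction k) (auto intro!: image_mono)

lemma code_subset_set_power:
  assumes "W \<subseteq> U" "v \<in> U" "U \<subseteq> carrier G"
  shows "code v W k \<subseteq> set_power G U (2 * k + 1)"
proof (induction k)
  case 0
  have "w \<in> set_power G U (Suc 0)" if "w \<in> W" for w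
  proof -
    have "w \<in> U" "w \<in> carrier G" using that assms by auto
    then show ?thesis using set_power_SucI[of w U \<one> 0] by simp
  qed
  then show ?case by (auto simp del: set_power.simps)
next
  case (Suc k)
  have "w \<otimes> (v \<otimes> y) \<in> set_power G U (Suc (Suc (2 * k + 1)))" if "w \<in> W" "y \<in> code v W k" for w y
    using that assms Suc by (intro set_power_SucI) auto
  then show ?case by (auto simp del: set_power.simps)
qed

section \<open>Intertwining relations and commensurators\<close>

lemma intertwine_inv:
  assumes [simp]: "g \<in> carrier G" "x \<in> carrier G" "y \<in> carrier G" and e: "g \<otimes> x = y \<otimes> g"
  shows "g \<otimes> inv x = inv y \<otimes> g"
proof -
  have "inv y \<otimes> g = inv y \<otimes> ((g \<otimes> x) \<otimes> inv x)" by (simp add: m_assoc)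
  also have "\<dots> = g \<otimes> inv x" unfolding e by (simp add: m_assoc inv_mult_cancel)
  finally show ?thesis by simp
qed

lemma intertwine_nat_pow:
  assumes [simp]: "g \<in> carrier G" "x \<in> carrier G" "y \<in> carrier G" and e: "g \<otimes> x = y \<otimes> g"
  shows "g \<otimes> x [^] (n::nat) = y [^] n \<otimes> g"
proof (induction n)
  case (Suc n)
  have "g \<otimes> x [^] Suc n = (g \<otimes> x [^] n) \<otimes> x" by (simp add: m_assoc)
  also have "\<dots> = y [^] n \<otimes> (g \<otimes> x)" using Suc by (simp add: m_assoc)
  also have "\<dots> = y [^] Suc n \<otimes> g" unfolding e by (simp add: m_assoc)
  finally show ?case .
qed simp

lemma intertwine_int_pow:
  assumes [simp]: "g \<in> carrier G" "x \<in> carrier G" "y \<in> carrier G" and e: "g \<otimes> x = y \<otimes> g"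
  shows "g \<otimes> x [^] (k::int) = y [^] k \<otimes> g"
proof (cases k rule: int_cases2)
  case (nonneg n)
  then show ?thesis using intertwine_nat_pow[OF assms, of n] by (simp add: int_pow_int)
next
  case (nonpos n)
  have "g \<otimes> inv (x [^] n) = inv (y [^] n) \<otimes> g"
    by (rule intertwine_inv) (use intertwine_nat_pow[OF assms, of n] in auto)
  then show ?thesis using nonpos by (simp add: int_pow_neg int_pow_int)
qed

lemma conj_nat_pow:
  assumes [simp]: "v \<in> carrier G" "p \<in> carrier G"
  shows "inv v \<otimes> p [^] (i::nat) \<otimes> v = (inv v \<otimes> p \<otimes> v) [^] i"
proof -
  have "inv v \<otimes> p [^] i = (inv v \<otimes> p \<otimes> v) [^] i \<otimes> inv v"
    by (rule intertwine_nat_pow) (auto simp: m_assoc)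
  then show ?thesis by (simp add: m_assoc)
qed

lemma int_pow_in_subgroup:
  assumes H: "subgroup H G" and x: "x \<in> H"
  shows "x [^] (k::int) \<in> H"
proof -
  interpret subgroup H G by (rule H)
  have "x [^] n \<in> H" for n :: nat by (induction n) (use x in auto)
  then show ?thesis using x by (cases k rule: int_cases2) (auto simp: int_pow_int int_pow_neg)
qed

definition infinite_order :: "'a \<Rightarrow> bool" where
  "infinite_order p \<longleftrightarrow> p \<in> carrier G \<and> (\<forall>n::int. n \<noteq> 0 \<longrightarrow> p [^] n \<noteq> \<one>)"

lemma infinite_orderI:
  assumes "p \<in> carrier G" "\<And>n::nat. n > 0 \<Longrightarrow> p [^] n \<noteq> \<one>"
  shows "infinite_order p"
  unfolding infinite_order_def
proof (intro conjI allI impI)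
  fix n :: int assume n: "n \<noteq> 0"
  show "p [^] n \<noteq> \<one>"
  proof (cases "n \<ge> 0")
    case True
    then show ?thesis using assms n by (metis int_pow_int nat_0_le nat_0_iff int_nat_eq gr0I of_nat_0)
  next
    case False
    have "p [^] (- n) \<noteq> \<one>"
      using assms(2)[of "nat (-n)"] False by (metis int_pow_int int_nat_eq neg_0_le_iff_le nle_le zero_less_nat_eq neg_0_less_iff_less not_le)
    then show ?thesis using assms(1) by (simp add: int_pow_neg)
  qed
qed (use assms in auto)

lemma conj_infinite_order:
  assumes q: "infinite_order q" and [simp]: "g \<in> carrier G"
  shows "infinite_order (g \<otimes> q \<otimes> inv g)"
proof -
  have [simp]: "q \<in> carrier G" using q by (simp add: infinite_order_def)
  have "q [^] k = \<one>" if "g \<otimes> q [^] k \<otimes> inv g = \<one>" for k :: int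
  proof -
    have "q [^] k = inv g \<otimes> (g \<otimes> q [^] k \<otimes> inv g) \<otimes> g" by (simp add: m_assoc inv_mult_cancel)
    also have "\<dots> = \<one>" unfolding that by simp
    finally show ?thesis .
  qed
  then show ?thesis using q by (auto simp: infinite_order_def conj_int_pow)
qed

text \<open>For an infinite cyclic subgroup of a hyperbolic group this is the maximal virtually cyclic subgroup
  containing it.\<close>

definition commensurator :: "'a \<Rightarrow> 'a set" where
  "commensurator p = {g \<in> carrier G. \<exists>(a::int) (b::int). a \<noteq> 0 \<and> b \<noteq> 0 \<and> g \<otimes> p [^] a = p [^] b \<otimes> g}"

lemma commensuratorI:
  fixes a b :: int
  shows "\<lbrakk>g \<in> carrier G; a \<noteq> 0; b \<noteq> 0; g \<otimes> p [^] a = p [^] b \<otimes> g\<rbrakk> \<Longrightarrow> g \<in> commensurator p"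
  unfolding commensurator_def by blast

lemma commensuratorE:
  assumes "g \<in> commensurator p" "p \<in> carrier G"
  obtains a b :: int where "g \<in> carrier G" "a \<noteq> 0" "b \<noteq> 0"
    "\<And>k::int. g \<otimes> p [^] (a * k) = p [^] (b * k) \<otimes> g"
proof -
  obtain a b :: int where g: "g \<in> carrier G" "a \<noteq> 0" "b \<noteq> 0" and e: "g \<otimes> p [^] a = p [^] b \<otimes> g"
    using assms by (auto simp: commensurator_def)
  have "g \<otimes> p [^] (a * k) = p [^] (b * k) \<otimes> g" for k :: int
    using intertwine_int_pow[OF _ _ _ e, of k] g assms by (simp add: int_pow_pow)
  then show ?thesis using that g by blast
qed

lemma commensurator_carrier: "g \<in> commensurator p \<Longrightarrow> g \<in> carrier G"
  by (simp add: commensurator_def)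

lemma commensurator_subgroup:
  assumes [simp]: "p \<in> carrier G"
  shows "subgroup (commensurator p) G"
proof (rule subgroupI)
  show "commensurator p \<subseteq> carrier G" by (auto simp: commensurator_def)
  have "\<one> \<in> commensurator p" by (auto simp: commensurator_def intro!: exI[of _ 1])
  then show "commensurator p \<noteq> {}" by blast
next
  fix g assume "g \<in> commensurator p"
  then obtain a b :: int where [simp]: "g \<in> carrier G" and ab: "a \<noteq> 0" "b \<noteq> 0"
    and e: "g \<otimes> p [^] a = p [^] b \<otimes> g"
    by (auto simp: commensurator_def)
  have "inv g \<otimes> p [^] b = inv g \<otimes> (p [^] b \<otimes> g) \<otimes> inv g" by (simp add: m_assoc)
  also have "\<dots> = p [^] a \<otimes> inv g" unfolding e[symmetric] by (simp add: m_assoc[symmetric])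
  finally show "inv g \<in> commensurator p" using ab by (auto simp: commensurator_def)
next
  fix g h assume "g \<in> commensurator p" "h \<in> commensurator p"
  then obtain a b a' b' :: int where [simp]: "g \<in> carrier G" "h \<in> carrier G"
    and ab: "a \<noteq> 0" "b \<noteq> 0" "a' \<noteq> 0" "b' \<noteq> 0"
    and e: "\<And>k::int. g \<otimes> p [^] (a * k) = p [^] (b * k) \<otimes> g"
    and e': "\<And>k::int. h \<otimes> p [^] (a' * k) = p [^] (b' * k) \<otimes> h"
    by (auto elim!: commensuratorE)
  have "(g \<otimes> h) \<otimes> p [^] (a' * a) = g \<otimes> (p [^] (b' * a) \<otimes> h)"
    using e'[of a] by (simp add: m_assoc)
  also have "\<dots> = (g \<otimes> p [^] (a * b')) \<otimes> h" by (simp add: m_assoc mult.commute)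
  also have "\<dots> = p [^] (b * b') \<otimes> (g \<otimes> h)" unfolding e by (simp add: m_assoc)
  finally show "g \<otimes> h \<in> commensurator p"
    by (rule commensuratorI[rotated 3]) (use ab in auto)
qed

lemma generator_in_commensurator: "p \<in> carrier G \<Longrightarrow> p \<in> commensurator p"
  unfolding commensurator_def by (auto intro!: exI[of _ 1])

lemma commensurator_mult:
  "\<lbrakk>p \<in> carrier G; x \<in> commensurator p; y \<in> commensurator p\<rbrakk> \<Longrightarrow> x \<otimes> y \<in> commensurator p"
  by (rule subgroup.m_closed[OF commensurator_subgroup])

lemma commensurator_inv: "\<lbrakk>p \<in> carrier G; x \<in> commensurator p\<rbrakk> \<Longrightarrow> inv x \<in> commensurator p"
  by (rule subgroup.m_inv_closed[OF commensurator_subgroup])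

lemma commensurator_one: "p \<in> carrier G \<Longrightarrow> \<one> \<in> commensurator p"
  by (rule subgroup.one_closed[OF commensurator_subgroup])

lemma commensurator_commensurable_sub:
  assumes [simp]: "p \<in> carrier G" "q \<in> carrier G" and ab: "a \<noteq> 0" "b \<noteq> 0" and e: "p [^] (a::int) = q [^] (b::int)"
  shows "commensurator p \<subseteq> commensurator q"
proof
  fix g assume "g \<in> commensurator p"
  then obtain x y :: int where [simp]: "g \<in> carrier G" and xy: "x \<noteq> 0" "y \<noteq> 0"
    and g: "\<And>k::int. g \<otimes> p [^] (x * k) = p [^] (y * k) \<otimes> g"
    by (auto elim!: commensuratorE)
  have pq: "p [^] (k * a) = q [^] (k * b)" for k :: int
    using e int_pow_pow[of p a k] int_pow_pow[of q b k] by (simp add: mult.commute)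
  have "g \<otimes> q [^] (x * b) = q [^] (y * b) \<otimes> g"
    using g[of a] by (simp add: pq)
  then show "g \<in> commensurator q"
    by (rule commensuratorI[rotated 3]) (use ab xy in auto)
qed

lemma commensurator_commensurable:
  assumes "p \<in> carrier G" "q \<in> carrier G" "a \<noteq> 0" "b \<noteq> 0" "p [^] (a::int) = q [^] (b::int)"
  shows "commensurator p = commensurator q"
  using commensurator_commensurable_sub[OF assms] commensurator_commensurable_sub[of q p b a] assms by auto

lemma commensurator_conj:
  assumes [simp]: "p \<in> carrier G" "g \<in> carrier G" "x \<in> carrier G"
  shows "g \<otimes> x \<otimes> inv g \<in> commensurator (g \<otimes> p \<otimes> inv g) \<longleftrightarrow> x \<in> commensurator p"
proof -
  have "(g \<otimes> x \<otimes> inv g) \<otimes> (g \<otimes> u \<otimes> inv g) = (g \<otimes> w \<otimes> inv g) \<otimes> (g \<otimes> x \<otimes> inv g)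
      \<longleftrightarrow> x \<otimes> u = w \<otimes> x" if "u \<in> carrier G" "w \<in> carrier G" for u w
    using that by (simp add: conj_mult)
  then show ?thesis unfolding commensurator_def by (simp add: conj_int_pow)
qed

end

section \<open>Groups with a hyperbolic length function\<close>

text \<open>All that is retained of the action is the displacement of a base point.
  \<open>four_point\<close> is hyperbolicity of the orbit, doubled to avoid fractions;
  \<open>finite_ball\<close> is properness; \<open>coarse_geodesic\<close> says that geodesics
  between orbit points stay near the orbit. With \<open>\<delta> \<ge> 1\<close> additive constants
  are absorbed by multiples of \<delta>.\<close>

locale hyperbolic_length = group G for G (structure) +
  fixes len :: "'a \<Rightarrow> real" and \<delta> :: real
  assumes len_one: "len \<one> = 0"
    and len_inv [simp]: "g \<in> carrier G \<Longrightarrow> len (inv g) = len g"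
    and len_mult: "\<lbrakk>g \<in> carrier G; h \<in> carrier G\<rbrakk> \<Longrightarrow> len (g \<otimes> h) \<le> len g + len h"
    and finite_ball: "finite {g \<in> carrier G. len g \<le> r}"
    and four_point: "\<lbrakk>a \<in> carrier G; b \<in> carrier G; c \<in> carrier G\<rbrakk> \<Longrightarrow>
      min (len a + len c - len (inv a \<otimes> c)) (len c + len b - len (inv c \<otimes> b)) - 2 * \<delta>
        \<le> len a + len b - len (inv a \<otimes> b)"
    and delta_ge_1: "\<delta> \<ge> 1"
    and coarse_geodesic: "\<lbrakk>g \<in> carrier G; 0 \<le> t; t \<le> len g\<rbrakk> \<Longrightarrow>
      \<exists>y\<in>carrier G. \<bar>len y - t\<bar> \<le> \<delta> \<and> len y + len (inv y \<otimes> g) \<le> len g + 2 * \<delta>"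
begin

text \<open>The Gromov product based at the identity.\<close>

definition gp :: "'a \<Rightarrow> 'a \<Rightarrow> real" where
  "gp a b = (len a + len b - len (inv a \<otimes> b)) / 2"

definition ball_size :: "real \<Rightarrow> nat" where
  "ball_size r = card {g \<in> carrier G. len g \<le> r}"

section \<open>Calculus of lengths and Gromov products\<close>

lemma len_nonneg [simp]: "g \<in> carrier G \<Longrightarrow> 0 \<le> len g"
  using len_mult[of g "inv g"] len_one by simp

lemma len_inv_mult_commute:
  "\<lbrakk>a \<in> carrier G; b \<in> carrier G\<rbrakk> \<Longrightarrow> len (inv a \<otimes> b) = len (inv b \<otimes> a)"
  using len_inv[of "inv a \<otimes> b"] by (simp add: inv_mult_group del: len_inv)

lemma gp_commute: "\<lbrakk>a \<in> carrier G; b \<in> carrier G\<rbrakk> \<Longrightarrow> gp a b = gp b a"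
  unfolding gp_def using len_inv_mult_commute by simp

lemma len_triangle:
  "\<lbrakk>a \<in> carrier G; b \<in> carrier G; c \<in> carrier G\<rbrakk> \<Longrightarrow>
    len (inv a \<otimes> c) \<le> len (inv a \<otimes> b) + len (inv b \<otimes> c)"
  using len_mult[of "inv a \<otimes> b" "inv b \<otimes> c"] by (simp add: m_assoc mult_inv_cancel)

lemma len_mult_lower:
  assumes "a \<in> carrier G" "b \<in> carrier G"
  shows "len (a \<otimes> b) \<ge> len a - len b" "len (a \<otimes> b) \<ge> len b - len a"
  using len_mult[of "a \<otimes> b" "inv b"] len_mult[of "inv a" "a \<otimes> b"] assms
  by (simp_all add: m_assoc inv_mult_cancel)

lemma gp_nonneg: "\<lbrakk>a \<in> carrier G; b \<in> carrier G\<rbrakk> \<Longrightarrow> 0 \<le> gp a b"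
  unfolding gp_def using len_mult[of "inv a" b] by simp

lemma gp_le1: "\<lbrakk>a \<in> carrier G; b \<in> carrier G\<rbrakk> \<Longrightarrow> gp a b \<le> len a"
  unfolding gp_def using len_mult_lower(2)[of "inv a" b] by simp

lemma gp_le2: "\<lbrakk>a \<in> carrier G; b \<in> carrier G\<rbrakk> \<Longrightarrow> gp a b \<le> len b"
  unfolding gp_def using len_mult_lower(1)[of "inv a" b] by simp

lemma gp_hyp:
  "\<lbrakk>a \<in> carrier G; c \<in> carrier G; b \<in> carrier G; m \<le> gp a c; m \<le> gp c b\<rbrakk> \<Longrightarrow> m - \<delta> \<le> gp a b"
  using four_point[of a b c] unfolding gp_def by simp

text \<open>Branching is inherited: if \<open>a\<close> leaves \<open>b\<close> early but follows
  \<open>c\<close> further, then \<open>c\<close> leaves \<open>b\<close> at the same place. Each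
  application costs one \<delta>; sequences of constants such as 902, 903, 904 below count these
  applications.\<close>

lemma gp_hyp_small:
  "\<lbrakk>a \<in> carrier G; c \<in> carrier G; b \<in> carrier G; gp a b \<le> m; m + \<delta> < gp a c\<rbrakk> \<Longrightarrow> gp c b \<le> m + \<delta>"
  using four_point[of a b c] unfolding gp_def by simp

lemma len_mult_gp:
  "\<lbrakk>a \<in> carrier G; b \<in> carrier G\<rbrakk> \<Longrightarrow> len (a \<otimes> b) = len a + len b - 2 * gp (inv a) b"
  unfolding gp_def by (simp add: field_simps)

text \<open>\<open>gp (inv a) b\<close> is the cancellation in \<open>a \<otimes> b\<close>, and
  what remains of \<open>a\<close> is followed by the product. This translates between absence of
  cancellation and fellow travelling.\<close>

lemma gp_mult_right:
  "\<lbrakk>a \<in> carrier G; b \<in> carrier G\<rbrakk> \<Longrightarrow> gp a (a \<otimes> b) = len a - gp (inv a) b"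
  unfolding gp_def by (simp add: inv_mult_cancel field_simps)

lemma gp_translate:
  "\<lbrakk>a \<in> carrier G; b \<in> carrier G; c \<in> carrier G\<rbrakk> \<Longrightarrow>
    gp (c \<otimes> a) (c \<otimes> b) = len c + gp a b - gp (inv c) a - gp (inv c) b"
  unfolding gp_def by (simp add: inv_mult_group m_assoc inv_mult_cancel field_simps)

lemma gp_translate_lower:
  "\<lbrakk>a \<in> carrier G; b \<in> carrier G; c \<in> carrier G\<rbrakk> \<Longrightarrow> gp a b - len c \<le> gp (c \<otimes> a) (c \<otimes> b)"
  using gp_translate[of a b c] gp_le1[of "inv c" a] gp_le1[of "inv c" b] by simp

lemma gp_lipschitz:
  "\<lbrakk>a \<in> carrier G; a' \<in> carrier G; b \<in> carrier G\<rbrakk> \<Longrightarrow> gp a b - len (inv a \<otimes> a') \<le> gp a' b"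
  unfolding gp_def
  using len_triangle[of \<one> a' a] len_triangle[of a' a b] len_inv_mult_commute[of a a']
  by (simp add: field_simps)

lemma len_inv_mult_gp:
  "\<lbrakk>a \<in> carrier G; b \<in> carrier G\<rbrakk> \<Longrightarrow> len (inv a \<otimes> b) = len a + len b - 2 * gp a b"
  unfolding gp_def by (simp add: field_simps)

lemma finite_translated_ball:
  assumes "a \<in> carrier G"
  shows "finite {g \<in> carrier G. len (inv a \<otimes> g) \<le> r}"
    and "card {g \<in> carrier G. len (inv a \<otimes> g) \<le> r} \<le> ball_size r"
proof -
  have inj: "inj_on (\<lambda>g. inv a \<otimes> g) {g \<in> carrier G. len (inv a \<otimes> g) \<le> r}"
    using assms by (auto intro!: inj_onI)
  have sub: "(\<lambda>g. inv a \<otimes> g) ` {g \<in> carrier G. len (inv a \<otimes> g) \<le> r} \<subseteq> {g \<in> carrier G. len g \<le> r}"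
    using assms by auto
  show "finite {g \<in> carrier G. len (inv a \<otimes> g) \<le> r}"
    using inj_on_finite[OF inj sub finite_ball] .
  show "card {g \<in> carrier G. len (inv a \<otimes> g) \<le> r} \<le> ball_size r"
    unfolding ball_size_def using card_inj_on_le[OF inj sub finite_ball] .
qed

lemma ball_size_pos: "0 \<le> r \<Longrightarrow> 0 < ball_size r"
  unfolding ball_size_def using finite_ball[of r] len_one by (auto simp: card_gt_0_iff)

subsection \<open>Axial elements\<close>

text \<open>A long element \<open>p\<close> such that \<open>inv p\<close> and \<open>p\<close> leave the identity in different directions: its powers
  form a uniform quasi-geodesic. The bound \<open>c \<le> 2100 * \<delta>\<close> makes the length threshold dominate every error
  term. Two values of \<open>c\<close> occur: \<open>1000 * \<delta>\<close> for the elements that are found, and \<open>2100 * \<delta>\<close> for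
  the shorter elements of their commensurators, whose geometry is controlled with some loss.\<close>

definition axial :: "real \<Rightarrow> 'a \<Rightarrow> bool" where
  "axial c p \<longleftrightarrow> p \<in> carrier G \<and> 100000 * \<delta> \<le> len p \<and> gp (inv p) p \<le> c \<and> c \<le> 2100 * \<delta>"

lemma axial_carrier: "axial c p \<Longrightarrow> p \<in> carrier G"
  by (simp add: axial_def)

lemma axial_len: "axial c p \<Longrightarrow> 100000 * \<delta> \<le> len p"
  by (simp add: axial_def)

lemma axial_bound: "axial c p \<Longrightarrow> c \<le> 2100 * \<delta>"
  by (simp add: axial_def)

lemma axial_bound_nonneg: "axial c p \<Longrightarrow> 0 \<le> c"
  using gp_nonneg[of "inv p" p] by (auto simp: axial_def)

lemma axial_inv: "axial c p \<Longrightarrow> axial c (inv p)"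
  by (auto simp: axial_def gp_commute)

lemma axial_mono: "\<lbrakk>axial c p; c \<le> c'; c' \<le> 2100 * \<delta>\<rbrakk> \<Longrightarrow> axial c' p"
  by (auto simp: axial_def)

text \<open>The two halves feed each other: a power that diverges from \<open>inv p\<close> can be
  multiplied by \<open>p\<close> with little cancellation, so the next power starts along
  \<open>p\<close>; since \<open>p\<close> diverges from \<open>inv p\<close>, so does that power.
  The error does not grow with \<open>n\<close> because \<open>p\<close> is much longer than
  it.\<close>

lemma gp_pow_aux:
  assumes p: "axial c p"
  shows "gp (inv p) (p [^] Suc n) \<le> c + \<delta> \<and> len p - c - \<delta> \<le> gp p (p [^] Suc n)"
proof (induction n)
  case 0
  have "gp p (p \<otimes> \<one>) = len p - gp (inv p) \<one>"
    by (rule gp_mult_right) (use p axial_carrier in auto)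
  then show ?case
    using p axial_bound_nonneg[OF p] gp_le2[of "inv p" \<one>] len_one delta_ge_1 by (simp add: axial_def)
next
  case (Suc n)
  note pc [simp] = axial_carrier[OF p]
  let ?q = "p [^] Suc n"
  have e: "p [^] Suc (Suc n) = p \<otimes> ?q" by (rule nat_pow_Suc2) simp
  have 1: "gp p (p \<otimes> ?q) = len p - gp (inv p) ?q"
    by (rule gp_mult_right) (auto simp del: nat_pow_Suc)
  have 2: "len p - c - \<delta> \<le> gp p (p \<otimes> ?q)"
    using Suc 1 by simp
  have "gp (p \<otimes> ?q) (inv p) \<le> c + \<delta>"
    by (rule gp_hyp_small[of p])
      (use 2 p axial_len[OF p] axial_bound[OF p] delta_ge_1 in \<open>auto simp: axial_def gp_commute simp del: nat_pow_Suc\<close>)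
  then show ?case
    using 2 unfolding e by (simp add: gp_commute)
qed

lemma gp_inv_pow: "axial c p \<Longrightarrow> gp (inv p) (p [^] (n::nat)) \<le> c + \<delta>"
  using gp_pow_aux[of c p "n - 1"] gp_le2[of "inv p" \<one>] axial_bound_nonneg[of c p] len_one delta_ge_1
    axial_carrier[of c p]
  by (cases n) auto

lemma gp_base_pow: "\<lbrakk>axial c p; n > 0\<rbrakk> \<Longrightarrow> len p - c - \<delta> \<le> gp p (p [^] (n::nat))"
  using gp_pow_aux[of c p "n - 1"] by auto

lemma gp_inv_pow_pow:
  assumes p: "axial c p"
  shows "gp (inv p [^] (m::nat)) (p [^] (n::nat)) \<le> c + 2 * \<delta>"
proof (cases "m = 0")
  case True
  then show ?thesis
    using gp_le1[of \<one> "p [^] n"] axial_bound_nonneg[OF p] len_one delta_ge_1 axial_carrier[OF p] by auto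
next
  case False
  note [simp] = axial_carrier[OF p]
  have "len (inv p) - c - \<delta> \<le> gp (inv p) (inv p [^] m)"
    by (rule gp_base_pow) (use axial_inv[OF p] False in auto)
  then have "c + \<delta> + \<delta> < gp (inv p) (inv p [^] m)"
    using axial_len[OF p] axial_bound[OF p] delta_ge_1 by simp
  then have "gp (inv p [^] m) (p [^] n) \<le> (c + \<delta>) + \<delta>"
    using gp_inv_pow[OF p, of n] gp_hyp_small[of "inv p" "inv p [^] m" "p [^] n" "c + \<delta>"] by simp
  then show ?thesis by simp
qed

lemma len_pow_add:
  assumes p: "axial c p"
  shows "len (p [^] (m::nat)) + len (p [^] (n::nat)) - 2 * c - 4 * \<delta> \<le> len (p [^] (m + n))"
proof -
  note [simp] = axial_carrier[OF p]
  have "len (p [^] m \<otimes> p [^] n) = len (p [^] m) + len (p [^] n) - 2 * gp (inv (p [^] m)) (p [^] n)"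
    by (rule len_mult_gp) auto
  then show ?thesis
    using gp_inv_pow_pow[OF p, of m n] by (simp add: nat_pow_mult nat_pow_inv)
qed

lemma len_pow_lower: "axial c p \<Longrightarrow> real n * (len p / 2) \<le> len (p [^] (n::nat))"
proof (induction n)
  case 0
  then show ?case using len_one by simp
next
  case (Suc n)
  then show ?case
    using len_pow_add[of c p n 1] axial_len[of c p] axial_bound[of c p] axial_carrier[of c p] delta_ge_1
    by (simp add: algebra_simps)
qed

lemma len_pow_upper: "p \<in> carrier G \<Longrightarrow> len (p [^] (n::nat)) \<le> real n * len p"
proof (induction n)
  case (Suc n)
  then show ?case using len_mult[of "p [^] n" p] by (simp add: algebra_simps)
qed (simp add: len_one)

lemma len_pow_step:
  assumes p: "axial c p" and mn: "m < n"
  shows "len (p [^] (m::nat)) + len p / 4 \<le> len (p [^] (n::nat))"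
proof -
  have "1 * (len p / 2) \<le> real (n - m) * (len p / 2)"
    by (rule mult_right_mono) (use mn axial_len[OF p] delta_ge_1 in auto)
  also have "\<dots> \<le> len (p [^] (n - m))"
    by (rule len_pow_lower[OF p])
  finally show ?thesis
    using len_pow_add[OF p, of m "n - m"] mn axial_len[OF p] axial_bound[OF p] delta_ge_1 by simp
qed

lemma len_pow_mono: "axial c p \<Longrightarrow> m \<le> n \<Longrightarrow> len (p [^] (m::nat)) \<le> len (p [^] (n::nat))"
  using len_pow_step[of c p m n] axial_len[of c p] delta_ge_1 by (cases "m = n") auto

lemma len_pow_unbounded: assumes "axial c p" shows "\<exists>N. \<forall>n\<ge>N. x \<le> len (p [^] (n::nat))"
proof -
  obtain N :: nat where N: "x < real N * (len p / 2)"
    using reals_Archimedean3[of "len p / 2"] axial_len[OF assms] delta_ge_1 by auto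
  have "x \<le> len (p [^] n)" if "n \<ge> N" for n
    using N len_pow_lower[OF assms, of N] len_pow_mono[OF assms that] by linarith
  then show ?thesis by blast
qed

lemma gp_pow_pow:
  assumes p: "axial c p" and "m \<le> n"
  shows "len (p [^] (m::nat)) - c - 2 * \<delta> \<le> gp (p [^] m) (p [^] (n::nat))"
proof -
  note [simp] = axial_carrier[OF p]
  have "gp (p [^] m) (p [^] m \<otimes> p [^] (n - m)) = len (p [^] m) - gp (inv (p [^] m)) (p [^] (n - m))"
    by (rule gp_mult_right) auto
  then show ?thesis
    using gp_inv_pow_pow[OF p, of m "n - m"] assms(2) by (simp add: nat_pow_mult nat_pow_inv)
qed

lemma len_inv_pow: "p \<in> carrier G \<Longrightarrow> len (inv p [^] (n::nat)) = len (p [^] n)"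
  by (simp add: nat_pow_inv)

lemma axial_infinite_order: assumes p: "axial c p" shows "infinite_order p"
proof (rule infinite_orderI)
  fix n :: nat assume "n > 0"
  then show "p [^] n \<noteq> \<one>"
    using len_pow_step[OF p, of 0 n] axial_len[OF p] len_one delta_ge_1 by auto
qed (use p axial_carrier in auto)

subsection \<open>The commensurator of an axial element\<close>

lemma gp_int_pow_neg:
  assumes p: "axial c p"
  shows "gp (p [^] (x::int)) (p [^] (- x)) \<le> c + 2 * \<delta>"
proof (cases x rule: int_cases2)
  case (nonneg n)
  then show ?thesis using gp_inv_pow_pow[OF p, of n n] axial_carrier[OF p]
    by (simp add: int_pow_neg int_pow_int nat_pow_inv gp_commute)
next
  case (nonpos n)
  then show ?thesis using gp_inv_pow_pow[OF p, of n n] axial_carrier[OF p]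
    by (simp add: int_pow_neg int_pow_int nat_pow_inv gp_commute)
qed

lemma len_int_pow: "p \<in> carrier G \<Longrightarrow> len (p [^] (x::int)) = len (p [^] nat \<bar>x\<bar>)"
  by (cases x rule: int_cases2) (auto simp: int_pow_neg int_pow_int)

text \<open>For large exponents, right multiplication by \<open>inv e\<close> hardly changes the
  directions of \<open>p [^] (a * k)\<close> and \<open>p [^] (- (a * k))\<close>, so the two
  products point in opposite directions. By the commutation relation they are \<open>inv e\<close>
  times powers of \<open>p\<close>. As \<open>inv e\<close> cannot follow both of them, it cancels
  little of one, which means that \<open>e\<close> runs along that power.\<close>

lemma commensurator_axis_far:
  assumes p: "axial c p" and e: "e \<in> commensurator p"
  shows "\<exists>n\<ge>N. len e - c - 5 * \<delta> \<le> gp e (p [^] (n::nat)) \<or> len e - c - 5 * \<delta> \<le> gp e (inv p [^] (n::nat))"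
proof -
  note [simp] = axial_carrier[OF p]
  obtain a b :: int where [simp]: "e \<in> carrier G" and ab: "a \<noteq> 0" "b \<noteq> 0"
    and tw: "\<And>k::int. e \<otimes> p [^] (a * k) = p [^] (b * k) \<otimes> e"
    using commensuratorE[OF e] by auto
  obtain N0 where N0: "\<And>n. n \<ge> N0 \<Longrightarrow> len e + c + 5 * \<delta> \<le> len (p [^] (n::nat))"
    using len_pow_unbounded[OF p] by blast
  \<comment> \<open>Both \<open>a * k\<close> and \<open>b * k\<close> must be large: the former
    makes \<open>inv e\<close> a negligible perturbation, the latter yields the required
    \<open>n \<ge> N\<close>.\<close>
  define k :: int where "k = int (max N N0)"
  have k: "nat \<bar>a * k\<bar> \<ge> N0" "nat \<bar>b * k\<bar> \<ge> N"
  proof -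
    have "1 * \<bar>k\<bar> \<le> \<bar>a\<bar> * \<bar>k\<bar>" "1 * \<bar>k\<bar> \<le> \<bar>b\<bar> * \<bar>k\<bar>" using ab by (intro mult_right_mono; linarith)+
    then show "nat \<bar>a * k\<bar> \<ge> N0" "nat \<bar>b * k\<bar> \<ge> N" unfolding k_def abs_mult by auto
  qed
  have tw': "inv e \<otimes> p [^] (b * j) = p [^] (a * j) \<otimes> inv e" for j :: int
  proof -
    have "inv e \<otimes> p [^] (b * j) = inv e \<otimes> (p [^] (b * j) \<otimes> e) \<otimes> inv e" by (simp add: m_assoc)
    also have "\<dots> = p [^] (a * j) \<otimes> inv e" unfolding tw[symmetric] by (simp add: m_assoc[symmetric])
    finally show ?thesis .
  qed
  define P where "P x = p [^] (x::int)" for x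
  have [simp]: "P x \<in> carrier G" for x by (simp add: P_def)
  let ?u = "P (a * k) \<otimes> inv e" and ?w = "P (- (a * k)) \<otimes> inv e"
  have near: "c + 4 * \<delta> < gp (P x) (P x \<otimes> inv e)" if "\<bar>x\<bar> = \<bar>a * k\<bar>" for x
  proof -
    have "gp (P x) (P x \<otimes> inv e) = len (P x) - gp (inv (P x)) (inv e)"
      by (rule gp_mult_right) auto
    moreover have "gp (inv (P x)) (inv e) \<le> len (inv e)" by (rule gp_le2) auto
    moreover have "len e + c + 5 * \<delta> \<le> len (P x)"
      unfolding P_def len_int_pow[OF axial_carrier[OF p]] that by (rule N0[OF k(1)])
    ultimately show ?thesis using delta_ge_1 by simp
  qed
  have "gp ?u (P (- (a * k))) \<le> (c + 2 * \<delta>) + \<delta>"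
    by (rule gp_hyp_small[of "P (a * k)"])
      (use near[of "a * k"] gp_int_pow_neg[OF p, of "a * k"] delta_ge_1 in \<open>auto simp: P_def\<close>)
  then have "gp (P (- (a * k))) ?u \<le> c + 2 * \<delta> + \<delta>" by (simp add: gp_commute)
  then have "gp ?w ?u \<le> (c + 2 * \<delta> + \<delta>) + \<delta>"
    by (rule gp_hyp_small[of "P (- (a * k))", rotated 3])
      (use near[of "- (a * k)"] in auto)
  then have uw: "gp ?u ?w \<le> c + 4 * \<delta>" by (simp add: gp_commute)
  have u: "?u = inv e \<otimes> P (b * k)" and w: "?w = inv e \<otimes> P (b * - k)"
    using tw'[of k] tw'[of "- k"] by (simp_all add: P_def)
  have g: "gp (inv e) (inv e \<otimes> P x) = len e - gp e (P x)" for x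
    using gp_mult_right[of "inv e" "P x"] by simp
  have "len e - c - 5 * \<delta> \<le> gp e (P (b * k)) \<or> len e - c - 5 * \<delta> \<le> gp e (P (b * - k))"
  proof (rule ccontr)
    assume "\<not> ?thesis"
    then have "c + 5 * \<delta> < gp (inv e) ?u" "c + 5 * \<delta> < gp (inv e) ?w"
      unfolding u w g by auto
    moreover from this have "min (gp ?u (inv e)) (gp (inv e) ?w) - \<delta> \<le> gp ?u ?w"
      by (intro gp_hyp[of _ "inv e"]) auto
    ultimately show False using uw by (simp add: gp_commute)
  qed
  moreover have "P x = p [^] nat \<bar>x\<bar> \<or> P x = inv p [^] nat \<bar>x\<bar>" for x
    unfolding P_def by (cases x rule: int_cases2) (auto simp: int_pow_int int_pow_neg nat_pow_inv)
  ultimately show ?thesis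
    using k(2) by (metis abs_minus_cancel mult_minus_right)
qed

text \<open>Powers of \<open>p\<close> follow one quasi-geodesic, so the remote power may be
  exchanged for any power at least as long as \<open>e\<close>, at the cost of one \<delta>.\<close>

lemma commensurator_axis:
  assumes p: "axial c p" and e: "e \<in> commensurator p" and N: "len e \<le> len (p [^] (N::nat))"
  shows "len e - c - 6 * \<delta> \<le> gp e (p [^] N) \<or> len e - c - 6 * \<delta> \<le> gp e (inv p [^] N)"
proof -
  note [simp] = axial_carrier[OF p] commensurator_carrier[OF e]
  obtain n where n: "n \<ge> N"
    "len e - c - 5 * \<delta> \<le> gp e (p [^] n) \<or> len e - c - 5 * \<delta> \<le> gp e (inv p [^] n)"
    using commensurator_axis_far[OF p e] by blast
  have *: "len e - c - 6 * \<delta> \<le> gp e (q [^] N)"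
    if q: "axial c q" "len e \<le> len (q [^] N)" "len e - c - 5 * \<delta> \<le> gp e (q [^] n)" for q
  proof -
    have "(len e - c - 5 * \<delta>) - \<delta> \<le> gp e (q [^] N)"
      by (rule gp_hyp[of _ "q [^] n"])
        (use q gp_pow_pow[OF q(1) n(1)] delta_ge_1 axial_carrier[OF q(1)] in \<open>auto simp: gp_commute\<close>)
    then show ?thesis by simp
  qed
  show ?thesis
    using n(2) *[of p] *[of "inv p"] p axial_inv[OF p] N len_inv_pow[of p N] by auto
qed

text \<open>The first power of \<open>p\<close> longer than \<open>e\<close> exceeds it by at most
  \<open>len p\<close>. One of this power and its inverse lies in the direction of \<open>e\<close>
  and has nearly the same length, hence is close to \<open>e\<close>.\<close>

lemma commensurator_near_power:
  assumes p: "axial c p" and e: "e \<in> commensurator p"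
  shows "\<exists>k::nat. len (inv (p [^] k) \<otimes> e) \<le> 2 * len p \<or> len (inv (inv p [^] k) \<otimes> e) \<le> 2 * len p"
proof -
  note [simp] = axial_carrier[OF p] commensurator_carrier[OF e]
  obtain N where "\<And>n. n \<ge> N \<Longrightarrow> len e + \<delta> \<le> len (p [^] (n::nat))"
    using len_pow_unbounded[OF p] by blast
  then have ex: "len e < len (p [^] Suc N)" using delta_ge_1 by (smt (verit) le_add2 plus_1_eq_Suc)
  define k where "k = (LEAST k. len e < len (p [^] Suc k))"
  have k1: "len e < len (p [^] Suc k)" unfolding k_def by (rule LeastI[of _ N]) (rule ex)
  have k2: "len (p [^] k) \<le> len e"
  proof (cases k)
    case 0
    then show ?thesis using len_one by simp
  next
    case (Suc j)
    then have "\<not> len e < len (p [^] Suc j)" unfolding k_def by (intro not_less_Least) simp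
    then show ?thesis using Suc by simp
  qed
  have k3: "len (p [^] Suc k) \<le> len e + len p"
    using len_mult[of "p [^] k" p] k2 by simp
  have bound: "2 * c + 12 * \<delta> \<le> len p"
    using axial_len[OF p] axial_bound[OF p] delta_ge_1 by simp
  have *: "len (inv (q [^] Suc k) \<otimes> e) \<le> 2 * len p"
    if "q \<in> carrier G" "len (q [^] Suc k) = len (p [^] Suc k)" "len e - c - 6 * \<delta> \<le> gp e (q [^] Suc k)" for q
    using that k3 bound len_inv_mult_gp[of "q [^] Suc k" e] by (simp add: gp_commute del: nat_pow_Suc)
  have "len (inv (p [^] Suc k) \<otimes> e) \<le> 2 * len p \<or> len (inv (inv p [^] Suc k) \<otimes> e) \<le> 2 * len p"
    using commensurator_axis[OF p e less_imp_le[OF k1]] *[of p] *[of "inv p"] len_inv_pow[of p "Suc k"]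
    by (auto simp del: nat_pow_Suc)
  then show ?thesis by blast
qed

lemma commensurator_near_int_power:
  assumes p: "axial c p" and e: "e \<in> commensurator p"
  shows "\<exists>k::int. len (inv (p [^] k) \<otimes> e) \<le> 2 * len p"
proof -
  obtain k :: nat where "len (inv (p [^] k) \<otimes> e) \<le> 2 * len p \<or> len (inv (inv p [^] k) \<otimes> e) \<le> 2 * len p"
    using commensurator_near_power[OF assms] by blast
  then have "len (inv (p [^] int k) \<otimes> e) \<le> 2 * len p \<or> len (inv (p [^] (- int k)) \<otimes> e) \<le> 2 * len p"
    using axial_carrier[OF p] by (simp add: int_pow_int int_pow_neg nat_pow_inv)
  then show ?thesis by blast
qed

lemma commensurator_virtually_cyclic:
  assumes p: "axial c p"
  shows "virtually_cyclic_subgroup G (commensurator p)"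
  unfolding virtually_cyclic_subgroup_def
proof (intro conjI bexI exI)
  note [simp] = axial_carrier[OF p]
  let ?F = "{z \<in> commensurator p. len z \<le> 2 * len p}"
  let ?C = "{p [^] (k::int) |k. True}"
  show "subgroup (commensurator p) G" "p \<in> commensurator p"
    by (simp_all add: commensurator_subgroup generator_in_commensurator)
  show "?F \<subseteq> commensurator p" by auto
  show "finite ?F"
    by (rule finite_subset[OF _ finite_ball[of "2 * len p"]]) (auto simp: commensurator_carrier)
  show "commensurator p = (\<Union>f\<in>?F. f <# ?C)"
  proof
    show "(\<Union>f\<in>?F. f <# ?C) \<subseteq> commensurator p"
      using int_pow_in_subgroup[OF commensurator_subgroup generator_in_commensurator, of p]
      by (auto simp: l_coset_def intro!: commensurator_mult)
    show "commensurator p \<subseteq> (\<Union>f\<in>?F. f <# ?C)"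
    proof
      fix g assume g: "g \<in> commensurator p"
      note [simp] = commensurator_carrier[OF g]
      \<comment> \<open>The short factor must stand to the left of the power of \<open>p\<close>, as
        in \<open>f <# ?C\<close>; therefore the approximation is applied to
        \<open>inv g\<close>.\<close>
      obtain k :: int where k: "len (inv (p [^] k) \<otimes> inv g) \<le> 2 * len p"
        using commensurator_near_int_power[OF p commensurator_inv[OF _ g]] by auto
      have "g \<otimes> p [^] k \<in> commensurator p"
        using g int_pow_in_subgroup[OF commensurator_subgroup generator_in_commensurator, of p] by (auto intro!: commensurator_mult)
      moreover have "len (g \<otimes> p [^] k) \<le> 2 * len p"
        using k len_inv[of "g \<otimes> p [^] k"] by (simp add: inv_mult_group del: len_inv)
      moreover have "g = (g \<otimes> p [^] k) \<otimes> p [^] (- k)" by (simp add: int_pow_neg m_assoc)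
      ultimately show "g \<in> (\<Union>f\<in>?F. f <# ?C)" by (auto simp: l_coset_def)
    qed
  qed
qed

text \<open>The powers of \<open>q\<close> differ from powers of \<open>p\<close> by elements of a
  finite ball. Two of them have the same remainder, and their quotient is a power of
  \<open>p\<close>.\<close>

lemma infinite_order_in_commensurator:
  assumes p: "axial c p" and q: "q \<in> commensurator p" "infinite_order q"
  shows "\<exists>(a::int) (b::int). a \<noteq> 0 \<and> b \<noteq> 0 \<and> q [^] a = p [^] b"
proof -
  note [simp] = axial_carrier[OF p] commensurator_carrier[OF q(1)]
  have "\<exists>k::int. len (inv (p [^] k) \<otimes> q [^] i) \<le> 2 * len p" for i :: int
    by (rule commensurator_near_int_power[OF p])
      (use q int_pow_in_subgroup[OF commensurator_subgroup, of p q] in auto)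
  then obtain k :: "int \<Rightarrow> int" where k: "\<And>i. len (inv (p [^] k i) \<otimes> q [^] i) \<le> 2 * len p" by metis
  define z where "z i = inv (p [^] k i) \<otimes> q [^] i" for i
  have [simp]: "z i \<in> carrier G" for i by (simp add: z_def)
  have "range z \<subseteq> {g \<in> carrier G. len g \<le> 2 * len p}" using k by (auto simp: z_def)
  then have "finite (range z)" using finite_ball finite_subset by blast
  then have "\<not> inj z" using finite_imageD infinite_UNIV_int by blast
  then obtain i j where ij: "i \<noteq> j" "z i = z j" by (auto simp: inj_def)
  have qz: "q [^] i = p [^] k i \<otimes> z i" for i by (simp add: z_def mult_inv_cancel)
  have "q [^] (i - j) = q [^] i \<otimes> inv (q [^] j)" by (simp add: int_pow_diff)
  also have "\<dots> = p [^] k i \<otimes> inv (p [^] k j)"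
    unfolding qz ij(2) by (simp add: inv_mult_group m_assoc mult_inv_cancel)
  also have "\<dots> = p [^] (k i - k j)" by (simp add: int_pow_diff)
  finally have e: "q [^] (i - j) = p [^] (k i - k j)" .
  moreover have "k i - k j \<noteq> 0"
    using e ij q(2) by (auto simp: infinite_order_def)
  ultimately show ?thesis using ij by (meson eq_iff_diff_eq_0)
qed

lemma commensurator_eqI:
  assumes p: "axial c p" and q: "q \<in> commensurator p" "infinite_order q"
  shows "commensurator q = commensurator p"
  using infinite_order_in_commensurator[OF assms] commensurator_commensurable[of q p]
    axial_carrier[OF p] commensurator_carrier[OF q(1)] by blast

subsection \<open>Overlapping axes\<close>

text \<open>The ball contains the differences in the pigeonhole of \<open>power_overlap\<close>:
  their length is at most \<open>6 * A + 10 * \<delta>\<close> with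
  \<open>A \<le> 2102 * \<delta>\<close>. The other 10 periods are room at the ends of the
  overlap.\<close>

definition overlap_const :: real where
  "overlap_const = real (ball_size (13000 * \<delta>)) + 10"

text \<open>Each \<open>f \<otimes> p [^] (i0 + j)\<close> stays at bounded distance from \<open>q [^] j \<otimes> (f \<otimes> p [^] i0)\<close>, since both lie at
  the same height on one geodesic. As balls are finite, two of the differences coincide, and this is
  the desired commutation relation.\<close>

lemma power_overlap:
  assumes p: "axial c p" and qp: "q = p \<or> q = inv p" and [simp]: "f \<in> carrier G"
    and R: "2 * len f + (overlap_const - 4) * len p \<le> gp (f \<otimes> p [^] (k::nat)) (q [^] (l::nat))"
  shows "\<exists>d>0. q [^] (d::nat) \<otimes> f = f \<otimes> p [^] d"
proof -
  have q: "axial c q" "len q = len p"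
    using p qp axial_inv[OF p] axial_carrier[OF p] by auto
  note [simp] = axial_carrier[OF p] axial_carrier[OF q(1)]
  have lenq: "len (q [^] j) = len (p [^] j)" for j :: nat
    using qp len_inv_pow[of p j] by auto
  define n where "n = ball_size (13000 * \<delta>)"
  have R': "2 * len f + (real n + 6) * len p \<le> gp (f \<otimes> p [^] k) (q [^] l)"
    using R by (simp add: overlap_const_def n_def add.commute)
  have lenp: "100000 * \<delta> \<le> len p" by (rule axial_len[OF p])
  define A where "A = c + 2 * \<delta>"
  have A: "0 \<le> A" "40 * A + 100 * \<delta> \<le> len p" "6 * A + 10 * \<delta> \<le> 13000 * \<delta>"
    using lenp axial_bound[OF p] axial_bound_nonneg[OF p] delta_ge_1 by (auto simp: A_def)
  \<comment> \<open>From this exponent on, \<open>f\<close> cannot cancel the power of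
    \<open>p\<close>, so \<open>f \<otimes> p [^] i\<close> moves forward along the translated
    axis.\<close>
  define i0 where "i0 = (LEAST i. len f + 2 * A + 20 * \<delta> \<le> len (p [^] (i::nat)))"
  obtain N where "len f + 2 * A + 20 * \<delta> \<le> len (p [^] (N::nat))"
    using len_pow_unbounded[OF p] by blast
  then have i0: "len f + 2 * A + 20 * \<delta> \<le> len (p [^] i0)"
    unfolding i0_def by (rule LeastI)
  have i0': "len (p [^] i0) \<le> len f + 2 * len p"
  proof (cases i0)
    case 0
    then show ?thesis using len_one by simp
  next
    case (Suc i)
    then have "\<not> len f + 2 * A + 20 * \<delta> \<le> len (p [^] i)" unfolding i0_def by (intro not_less_Least) simp
    then show ?thesis using A len_mult[of "p [^] i" p] delta_ge_1 Suc by simp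
  qed
  have short: "len (p [^] (i0 + j)) \<le> len f + (real n + 2) * len p" if "j \<le> n" for j
  proof -
    have "len (p [^] (i0 + j)) \<le> len (p [^] i0) + real j * len p"
      using len_mult[of "p [^] i0" "p [^] j"] len_pow_upper[of p j] by (simp add: nat_pow_mult)
    also have "real j * len p \<le> real n * len p" using that by (intro mult_right_mono) auto
    finally show ?thesis using i0' by (simp add: algebra_simps)
  qed
  define y where "y j = f \<otimes> p [^] (i0 + j)" for j
  have [simp]: "y j \<in> carrier G" for j by (simp add: y_def)
  have leny: "len (y j) \<le> 2 * len f + (real n + 2) * len p" if "j \<le> n" for j
    using short[OF that] len_mult[of f "p [^] (i0 + j)"] by (simp add: y_def)
  have k: "i0 + n \<le> k"
  proof (rule ccontr)
    assume "\<not> ?thesis"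
    then have "len (p [^] k) \<le> len (p [^] (i0 + n))" by (intro len_pow_mono[OF p]) auto
    then have "len (f \<otimes> p [^] k) < 2 * len f + (real n + 6) * len p"
      using short[of n] len_mult[of f "p [^] k"] lenp delta_ge_1 by (simp add: algebra_simps)
    then show False using R' gp_le1[of "f \<otimes> p [^] k" "q [^] l"] by simp
  qed
  have ql: "2 * len f + (real n + 6) * len p \<le> len (q [^] l)"
    using R' gp_le2[of "f \<otimes> p [^] k" "q [^] l"] by simp
  have nn: "0 \<le> len f" "0 < len p"
    using lenp delta_ge_1 by auto
  have l: "n \<le> l"
  proof (rule ccontr)
    assume "\<not> ?thesis"
    then have "real l * len p \<le> real n * len p" by (intro mult_right_mono) auto
    then have "len (q [^] l) \<le> real n * len p"
      using len_pow_upper[of q l] q by simp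
    then show False using ql nn by (simp add: algebra_simps)
  qed
  have behind: "gp (inv (y j)) (p [^] (m::nat)) \<le> A + \<delta>" for j m
  proof -
    let ?P = "p [^] (i0 + j)"
    have "gp (inv ?P) (inv ?P \<otimes> inv f) = len (inv ?P) - gp (inv (inv ?P)) (inv f)"
      by (rule gp_mult_right) auto
    moreover have "gp (inv (inv ?P)) (inv f) \<le> len (inv f)" by (rule gp_le2) auto
    moreover have "len (p [^] i0) \<le> len ?P" by (rule len_pow_mono[OF p]) simp
    ultimately have "A + \<delta> < gp (inv ?P) (inv (y j))"
      using i0 A delta_ge_1 by (simp add: y_def inv_mult_group)
    moreover have "gp (inv ?P) (p [^] m) \<le> A"
      using gp_inv_pow_pow[OF p, of "i0 + j" m] by (simp add: A_def nat_pow_inv)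
    ultimately show ?thesis
      using gp_hyp_small[of "inv ?P" "inv (y j)" "p [^] m" A] by simp
  qed
  have onray: "len (y j) - A - 2 * \<delta> \<le> gp (y j) (q [^] l)" if j: "j \<le> n" for j
  proof -
    have e: "f \<otimes> p [^] k = y j \<otimes> p [^] (k - (i0 + j))"
      using k j by (simp add: y_def m_assoc nat_pow_mult)
    have "gp (y j) (f \<otimes> p [^] k) = len (y j) - gp (inv (y j)) (p [^] (k - (i0 + j)))"
      unfolding e by (rule gp_mult_right) auto
    then have "len (y j) - A - \<delta> \<le> gp (y j) (f \<otimes> p [^] k)"
      using behind[of j "k - (i0 + j)"] by linarith
    moreover have "len (y j) - A - \<delta> \<le> gp (f \<otimes> p [^] k) (q [^] l)"
      using leny[OF j] R' A nn delta_ge_1 by (simp add: algebra_simps)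
    ultimately show ?thesis
      using gp_hyp[of "y j" "f \<otimes> p [^] k" "q [^] l" "len (y j) - A - \<delta>"] by simp
  qed
  have y0: "2 * A + 20 * \<delta> \<le> len (y 0)"
    using i0 len_mult_lower(2)[of f "p [^] i0"] by (simp add: y_def)
  have y0': "len (y 0) \<le> 2 * len f + 2 * len p"
    using i0' len_mult[of f "p [^] i0"] by (simp add: y_def)
  have ynext: "y j = y 0 \<otimes> p [^] j" for j by (simp add: y_def m_assoc nat_pow_mult)
  define t where "t j = q [^] j \<otimes> y 0" for j :: nat
  have [simp]: "t j \<in> carrier G" for j by (simp add: t_def)
  have close: "len (inv (t j) \<otimes> y j) \<le> 13000 * \<delta>" if j: "j \<le> n" for j
  proof -
    have iq: "inv (q [^] j) = inv q [^] j" by (simp add: nat_pow_inv)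
    have 1: "gp (inv (q [^] j)) (y 0) \<le> A + \<delta>"
    proof -
      have "gp (q [^] l) (inv (q [^] j)) \<le> A"
        using gp_inv_pow_pow[OF q(1), of j l] by (simp add: A_def iq gp_commute)
      moreover have "A + \<delta> < gp (q [^] l) (y 0)"
        using onray[of 0] y0 delta_ge_1 by (simp add: gp_commute)
      ultimately have "gp (y 0) (inv (q [^] j)) \<le> A + \<delta>"
        using gp_hyp_small[of "q [^] l" "y 0" "inv (q [^] j)" A] by simp
      then show ?thesis by (simp add: gp_commute)
    qed
    have 2: "len (y 0) - A - 3 * \<delta> \<le> gp (y 0) (q [^] (l - j))"
    proof -
      have 0: "real j * len p \<le> real n * len p" by (rule mult_right_mono) (use j in auto)
      have 1: "len (q [^] l) \<le> len (q [^] (l - j)) + real j * len p"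
        using len_mult[of "q [^] (l - j)" "q [^] j"] len_pow_upper[of q j] j l q(2) by (simp add: nat_pow_mult)
      have "(real n + 6) * len p = real n * len p + 6 * len p" by (simp add: algebra_simps)
      then have "len (y 0) \<le> len (q [^] (l - j))"
        using 0 1 ql y0' nn by linarith
      then have "len (y 0) - A - 2 * \<delta> \<le> gp (q [^] l) (q [^] (l - j))"
        using gp_pow_pow[OF q(1), of "l - j" l] delta_ge_1 by (simp add: gp_commute A_def)
      then show ?thesis
        using onray[of 0] gp_hyp[of "y 0" "q [^] l" "q [^] (l - j)" "len (y 0) - A - 2 * \<delta>"] by simp
    qed
    have 3: "gp (inv (q [^] j)) (q [^] (l - j)) \<le> A"
      unfolding iq using gp_inv_pow_pow[OF q(1)] by (simp add: A_def)
    have "gp (t j) (q [^] j \<otimes> q [^] (l - j)) = len (q [^] j) + gp (y 0) (q [^] (l - j))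
        - gp (inv (q [^] j)) (y 0) - gp (inv (q [^] j)) (q [^] (l - j))"
      unfolding t_def by (rule gp_translate) auto
    moreover have "q [^] j \<otimes> q [^] (l - j) = q [^] l" using j l by (simp add: nat_pow_mult)
    ultimately have "gp (t j) (q [^] l) = len (q [^] j) + gp (y 0) (q [^] (l - j))
        - gp (inv (q [^] j)) (y 0) - gp (inv (q [^] j)) (q [^] (l - j))" by simp
    then have 4: "len (p [^] j) + len (y 0) - 3 * A - 4 * \<delta> \<le> gp (t j) (q [^] l)"
      using 1 2 3 lenq[of j] by linarith
    have 5: "len (t j) \<le> len (p [^] j) + len (y 0)"
      unfolding t_def lenq[symmetric] by (rule len_mult) auto
    have 6: "len (y j) \<le> len (y 0) + len (p [^] j)" "len (y 0) + len (p [^] j) - 2 * A - 2 * \<delta> \<le> len (y j)"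
      using len_mult_gp[of "y 0" "p [^] j"] behind[of 0 j] gp_nonneg[of "inv (y 0)" "p [^] j"]
      by (simp_all add: ynext[symmetric])
    have "len (p [^] j) + len (y 0) - 3 * A - 4 * \<delta> - \<delta> \<le> gp (t j) (y j)"
      by (rule gp_hyp[of _ "q [^] l"]) (use 4 6 onray[OF j] in \<open>auto simp: gp_commute\<close>)
    then show ?thesis
      using 5 6 A len_inv_mult_gp[of "t j" "y j"] by simp
  qed
  define z where "z j = inv (t j) \<otimes> y j" for j
  have "z ` {0..n} \<subseteq> {g \<in> carrier G. len g \<le> 13000 * \<delta>}"
    using close by (auto simp: z_def)
  then have "card (z ` {0..n}) \<le> n"
    unfolding n_def ball_size_def using card_mono finite_ball by blast
  then have "\<not> inj_on z {0..n}" by (intro pigeonhole) simp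
  then obtain j j' where jj: "j < j'" "z j = z j'"
    unfolding inj_on_def by (metis linorder_neqE_nat)
  define d where "d = j' - j"
  \<comment> \<open>Only the middle factor depends on the index, so a coincidence of two values
    cancels to a relation between \<open>f\<close> and powers of \<open>p\<close> and
    \<open>q\<close>.\<close>
  have zj: "z i = inv (y 0) \<otimes> ((inv (q [^] i) \<otimes> (f \<otimes> p [^] i)) \<otimes> p [^] i0)" for i
    by (simp add: z_def t_def y_def inv_mult_group m_assoc nat_pow_mult add.commute)
  have "inv (q [^] j) \<otimes> (f \<otimes> p [^] j) = inv (q [^] j') \<otimes> (f \<otimes> p [^] j')"
    using jj(2) unfolding zj by simp
  then have "q [^] j' \<otimes> (inv (q [^] j) \<otimes> (f \<otimes> p [^] j)) = f \<otimes> p [^] j'"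
    by (simp add: mult_inv_cancel)
  moreover have "q [^] j' = q [^] d \<otimes> q [^] j" "p [^] j' = p [^] d \<otimes> p [^] j"
    using jj(1) by (simp_all add: d_def nat_pow_mult)
  ultimately have "(q [^] d \<otimes> f) \<otimes> p [^] j = (f \<otimes> p [^] d) \<otimes> p [^] j"
    by (simp add: m_assoc mult_inv_cancel)
  then have "q [^] d \<otimes> f = f \<otimes> p [^] d" by simp
  moreover have "d > 0" using jj by (simp add: d_def)
  ultimately show ?thesis by blast
qed

text \<open>Both elements of the commensurator are replaced by powers at distance at most
  \<open>2 * len p\<close>; this is the \<open>4\<close> set aside in \<open>power_overlap\<close>.
  The result is the basic test for membership in a commensurator.\<close>

lemma overlap_imp_commensurator:
  assumes p: "axial c p" and [simp]: "f \<in> carrier G"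
    and e: "e1 \<in> commensurator p" "e2 \<in> commensurator p"
    and R: "2 * len f + overlap_const * len p \<le> gp (f \<otimes> e1) e2"
  shows "f \<in> commensurator p"
proof -
  note [simp] = axial_carrier[OF p] commensurator_carrier[OF e(1)] commensurator_carrier[OF e(2)]
  have near: "\<exists>q (k::nat). (q = p \<or> q = inv p) \<and> len (inv (q [^] k) \<otimes> e) \<le> 2 * len p"
    if "e \<in> commensurator p" for e
    using commensurator_near_power[OF p that] by blast
  obtain q1 and k :: nat where q1: "q1 = p \<or> q1 = inv p" and k: "len (inv (q1 [^] k) \<otimes> e1) \<le> 2 * len p"
    using near[OF e(1)] by blast
  obtain q2 and l :: nat where q2: "q2 = p \<or> q2 = inv p" and l: "len (inv (q2 [^] l) \<otimes> e2) \<le> 2 * len p"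
    using near[OF e(2)] by blast
  have ax: "axial c q1" and [simp]: "q1 \<in> carrier G" "q2 \<in> carrier G" and len: "len q1 = len p"
    using q1 q2 p axial_inv[OF p] by auto
  have "gp (f \<otimes> e1) e2 - len (inv (f \<otimes> e1) \<otimes> (f \<otimes> q1 [^] k)) \<le> gp (f \<otimes> q1 [^] k) e2"
    by (rule gp_lipschitz) auto
  moreover have "inv (f \<otimes> e1) \<otimes> (f \<otimes> q1 [^] k) = inv e1 \<otimes> q1 [^] k"
    by (simp add: inv_mult_group m_assoc inv_mult_cancel)
  ultimately have "gp (f \<otimes> e1) e2 - 2 * len p \<le> gp e2 (f \<otimes> q1 [^] k)"
    using k len_inv_mult_commute[of e1 "q1 [^] k"] by (simp add: gp_commute)
  moreover have "gp e2 (f \<otimes> q1 [^] k) - len (inv e2 \<otimes> q2 [^] l) \<le> gp (q2 [^] l) (f \<otimes> q1 [^] k)"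
    by (rule gp_lipschitz) auto
  ultimately have "gp (f \<otimes> e1) e2 - 4 * len p \<le> gp (f \<otimes> q1 [^] k) (q2 [^] l)"
    using l len_inv_mult_commute[of e2 "q2 [^] l"] by (simp add: gp_commute)
  then have "2 * len f + (overlap_const - 4) * len q1 \<le> gp (f \<otimes> q1 [^] k) (q2 [^] l)"
    using R len by (simp add: algebra_simps)
  then obtain d :: nat where d: "d > 0" "q2 [^] d \<otimes> f = f \<otimes> q1 [^] d"
    using power_overlap[OF ax, of q2 f k l] q1 q2 by auto
  have "\<exists>a::int. a \<noteq> 0 \<and> q [^] d = p [^] a" if "q = p \<or> q = inv p" for q
  proof -
    have "p [^] d = p [^] int d" "inv p [^] d = p [^] (- int d)"
      by (simp_all add: int_pow_int int_pow_neg nat_pow_inv)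
    then show ?thesis using that d(1) by (metis neg_equal_0_iff_equal of_nat_0_eq_iff not_gr_zero)
  qed
  from this[OF q1] this[OF q2] obtain a b :: int where "a \<noteq> 0" "b \<noteq> 0" "q1 [^] d = p [^] a" "q2 [^] d = p [^] b"
    by blast
  then show ?thesis using d(2) by (intro commensuratorI[of _ a b]) auto
qed

subsection \<open>Counting in commensurators\<close>

text \<open>If \<open>a\<close> and \<open>b\<close> both act like reflections of a line, then \<open>inv a \<otimes> b\<close> acts like a translation.\<close>

lemma collinear_axial:
  assumes [simp]: "a \<in> carrier G" "b \<in> carrier G"
    and len: "100000 * \<delta> \<le> len a" "100000 * \<delta> \<le> len b" "100000 * \<delta> \<le> len (inv a \<otimes> b)"
    and col: "len a - 2014 * \<delta> \<le> gp a b"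
  shows "axial (2100 * \<delta>) a \<or> axial (2100 * \<delta>) b \<or> axial (2100 * \<delta>) (inv a \<otimes> b)"
proof (rule ccontr)
  assume neg: "\<not> ?thesis"
  define h where "h = inv a \<otimes> b"
  have [simp]: "h \<in> carrier G" by (simp add: h_def)
  have ih: "inv h = inv b \<otimes> a" by (simp add: h_def inv_mult_group)
  have na: "2100 * \<delta> \<le> gp (inv a) a" and nb: "2100 * \<delta> \<le> gp b (inv b)" and nh: "2100 * \<delta> < gp (inv h) h"
    using neg len by (auto simp: axial_def h_def gp_commute)
  have 1: "gp (inv a) h \<le> 2014 * \<delta>"
    using gp_mult_right[of "inv a" b] col by (simp add: h_def)
  have 2: "2100 * \<delta> \<le> gp (inv b) (inv h)"
    unfolding ih using gp_mult_right[of "inv b" a] col len len_inv_mult_gp[of a b] delta_ge_1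
    by (simp add: gp_commute)
  \<comment> \<open>The directions of \<open>inv a\<close>, \<open>a\<close>, \<open>b\<close>,
    \<open>inv b\<close>, \<open>inv h\<close> are linked successively, so \<open>inv a\<close> and
    \<open>inv h\<close> agree, whereas \<open>h\<close> leaves \<open>inv a\<close> early by the
    first estimate. Thus \<open>h\<close> would not be a reflection after all.\<close>
  have "2100 * \<delta> - \<delta> \<le> gp (inv a) b"
    by (rule gp_hyp[of _ a]) (use na col len delta_ge_1 in auto)
  then have "2100 * \<delta> - \<delta> - \<delta> \<le> gp (inv a) (inv b)"
    by - (rule gp_hyp[of _ b], use nb delta_ge_1 in auto)
  then have "2100 * \<delta> - \<delta> - \<delta> - \<delta> \<le> gp (inv a) (inv h)"
    by - (rule gp_hyp[of _ "inv b"], use 2 delta_ge_1 in auto)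
  then have "gp (inv h) h \<le> 2014 * \<delta> + \<delta>"
    by - (rule gp_hyp_small[of "inv a"], use 1 delta_ge_1 in auto)
  then show False using nh delta_ge_1 by simp
qed

lemma card_remove_ball:
  assumes "finite F" "F \<subseteq> carrier G" "a \<in> carrier G" "n + ball_size r < card F"
  shows "n < card {f \<in> F. r < len (inv a \<otimes> f)}"
proof -
  have "F \<subseteq> {f \<in> F. r < len (inv a \<otimes> f)} \<union> {g \<in> carrier G. len (inv a \<otimes> g) \<le> r}"
    using assms(2) by auto
  then have "card F \<le> card ({f \<in> F. r < len (inv a \<otimes> f)} \<union> {g \<in> carrier G. len (inv a \<otimes> g) \<le> r})"
    using assms(1) finite_translated_ball[OF assms(3)] by (intro card_mono) auto
  also have "\<dots> \<le> card {f \<in> F. r < len (inv a \<otimes> f)} + ball_size r"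
    using card_Un_le finite_translated_ball(2)[OF assms(3)] by (meson add_left_mono le_trans)
  finally show ?thesis using assms(4) by simp
qed

text \<open>Two balls cannot exhaust \<open>F\<close>, so it contains three pairwise distant
  elements of one ray. Taken in order of length, their successive distances are almost additive, and
  \<open>collinear_axial\<close> applies; its \<open>2014\<close> is twice
  \<open>1006 + 1\<close>.\<close>

lemma ray_axial_quotient:
  assumes F: "finite F" "F \<subseteq> carrier G" "2 * ball_size (100000 * \<delta>) < card F" and [simp]: "y \<in> carrier G"
    and ray: "\<And>f. f \<in> F \<Longrightarrow> len f - 1006 * \<delta> \<le> gp f y"
  shows "\<exists>f\<in>F. \<exists>f'\<in>F. axial (2100 * \<delta>) (inv f \<otimes> f')"
proof -
  let ?S = "100000 * \<delta>"
  have "F \<noteq> {}" using F by auto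
  then obtain f0 where f0: "f0 \<in> F" "\<And>f. f \<in> F \<Longrightarrow> len f0 \<le> len f"
    using obtains_min[OF F(1), of len] by blast
  define F1 where "F1 = {f \<in> F. ?S < len (inv f0 \<otimes> f)}"
  have F1: "finite F1" "F1 \<subseteq> carrier G" "ball_size ?S < card F1"
    using card_remove_ball[OF F(1,2), of f0 "ball_size ?S" ?S] F f0 by (auto simp: F1_def)
  then have "F1 \<noteq> {}" by auto
  then obtain f1 where f1: "f1 \<in> F1" "\<And>f. f \<in> F1 \<Longrightarrow> len f1 \<le> len f"
    using obtains_min[OF F1(1), of len] by blast
  have "0 < card {f \<in> F1. ?S < len (inv f1 \<otimes> f)}"
    using card_remove_ball[OF F1(1,2), of f1 0 ?S] F1 f1 by auto
  then have "{f \<in> F1. ?S < len (inv f1 \<otimes> f)} \<noteq> {}" by fastforce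
  then obtain f2 where f2: "f2 \<in> F1" "?S < len (inv f1 \<otimes> f2)" by blast
  have in_F: "f1 \<in> F" "f2 \<in> F" using f1 f2 by (auto simp: F1_def)
  have [simp]: "f0 \<in> carrier G" "f1 \<in> carrier G" "f2 \<in> carrier G" using f0 in_F F by auto
  have *: "len (inv f \<otimes> g) \<le> len g - len f + 2014 * \<delta>"
    if "f \<in> F" "g \<in> F" "len f \<le> len g" for f g
  proof -
    have [simp]: "f \<in> carrier G" "g \<in> carrier G" using that F by auto
    have "len f - 1006 * \<delta> - \<delta> \<le> gp f g"
      by (rule gp_hyp[of _ y]) (use ray[OF that(1)] ray[OF that(2)] that(3) in \<open>auto simp: gp_commute\<close>)
    then show ?thesis using len_inv_mult_gp[of f g] by simp
  qed
  define a b where "a = inv f0 \<otimes> f1" and "b = inv f0 \<otimes> f2"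
  have ab: "inv a \<otimes> b = inv f1 \<otimes> f2" by (simp add: a_def b_def inv_mult_group m_assoc mult_inv_cancel)
  have len: "?S < len a" "?S < len b" using f1 f2 by (auto simp: F1_def a_def b_def)
  have "len f2 - len f0 \<le> len b" using len_mult_lower(2)[of "inv f0" f2] by (simp add: b_def)
  moreover have "len a \<le> len f1 - len f0 + 2014 * \<delta>" unfolding a_def
    by (rule *) (use f0 in_F in auto)
  moreover have "len (inv a \<otimes> b) \<le> len f2 - len f1 + 2014 * \<delta>" unfolding ab
    by (rule *) (use f1 f2 in_F in auto)
  ultimately have "len a - 2014 * \<delta> \<le> gp a b" unfolding gp_def by simp
  then have "axial (2100 * \<delta>) a \<or> axial (2100 * \<delta>) b \<or> axial (2100 * \<delta>) (inv a \<otimes> b)"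
    using len f2(2) by (intro collinear_axial) (auto simp: ab, auto simp: a_def b_def)
  then show ?thesis unfolding ab using f0(1) in_F by (auto simp: a_def b_def)
qed

text \<open>Each element follows one of the two rays of the axis, so some ray receives half of
  \<open>F\<close>. The bound \<open>1006\<close> is \<open>1000\<close> plus the 6 lost in
  \<open>commensurator_axis\<close>.\<close>

lemma commensurator_axial_quotient:
  assumes p: "axial (1000 * \<delta>) p" and F: "F \<subseteq> commensurator p" "4 * ball_size (100000 * \<delta>) < card F"
  shows "\<exists>f\<in>F. \<exists>f'\<in>F. axial (2100 * \<delta>) (inv f \<otimes> f')"
proof -
  have fin: "finite F" using F card.infinite by fastforce
  note [simp] = axial_carrier[OF p]
  have Fc: "F \<subseteq> carrier G" using F commensurator_carrier by auto
  obtain N :: nat where N: "Max (len ` F) \<le> len (p [^] N)"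
    using len_pow_unbounded[OF p] by blast
  define ray where "ray q = {f \<in> F. len f - 1006 * \<delta> \<le> gp f (q [^] N)}" for q
  have "F \<subseteq> ray p \<union> ray (inv p)"
  proof
    fix f assume f: "f \<in> F"
    have "len f \<le> Max (len ` F)" by (rule Max_ge) (use f fin in auto)
    with N have "len f \<le> len (p [^] N)" by (rule order_trans[rotated])
    then show "f \<in> ray p \<union> ray (inv p)"
      using commensurator_axis[OF p, of f N] F f by (auto simp: ray_def)
  qed
  then have "card F \<le> card (ray p \<union> ray (inv p))" using fin by (intro card_mono) (auto simp: ray_def)
  also have "\<dots> \<le> card (ray p) + card (ray (inv p))" by (rule card_Un_le)
  finally have "2 * ball_size (100000 * \<delta>) < card (ray p) \<or> 2 * ball_size (100000 * \<delta>) < card (ray (inv p))"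
    using F(2) by linarith
  moreover have "\<exists>f\<in>F. \<exists>f'\<in>F. axial (2100 * \<delta>) (inv f \<otimes> f')"
    if "2 * ball_size (100000 * \<delta>) < card (ray q)" "q \<in> carrier G" for q
  proof -
    have "\<exists>f\<in>ray q. \<exists>f'\<in>ray q. axial (2100 * \<delta>) (inv f \<otimes> f')"
    proof (rule ray_axial_quotient)
      show "finite (ray q)" "ray q \<subseteq> carrier G" using fin Fc by (auto simp: ray_def)
      show "len f - 1006 * \<delta> \<le> gp f (q [^] N)" if "f \<in> ray q" for f using that by (simp add: ray_def)
    qed (use that in auto)
    then show ?thesis by (auto simp: ray_def)
  qed
  ultimately show ?thesis by auto
qed

text \<open>The unit of length in a commensurator, in terms of which its elements can be counted
  uniformly. The element \<open>p\<close> in the second clause is kept because quotients of elements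
  of the commensurator are axial only with the worse bound 2100, and only if the bound 1000 is
  available to start with.\<close>

definition shortest_axial :: "'a \<Rightarrow> bool" where
  "shortest_axial r \<longleftrightarrow> axial (2100 * \<delta>) r
    \<and> (\<exists>p. axial (1000 * \<delta>) p \<and> commensurator r = commensurator p)
    \<and> (\<forall>s\<in>commensurator r. axial (2100 * \<delta>) s \<longrightarrow> len r \<le> len s)"

lemma shortest_axial_axial: "shortest_axial r \<Longrightarrow> axial (2100 * \<delta>) r"
  by (simp add: shortest_axial_def)

lemma shortest_axial_exists:
  assumes p: "axial (1000 * \<delta>) p"
  shows "\<exists>r. shortest_axial r \<and> commensurator r = commensurator p"
proof -
  note [simp] = axial_carrier[OF p]
  have p': "axial (2100 * \<delta>) p" using axial_mono[OF p] delta_ge_1 by simp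
  let ?A = "{s \<in> commensurator p. axial (2100 * \<delta>) s \<and> len s \<le> len p}"
  have "finite ?A" by (rule finite_subset[OF _ finite_ball[of "len p"]]) (auto simp: commensurator_carrier)
  moreover have "?A \<noteq> {}" using p' generator_in_commensurator[of p] by auto
  ultimately obtain r where r: "r \<in> ?A" "\<And>s. s \<in> ?A \<Longrightarrow> len r \<le> len s"
    using obtains_min[of ?A len] by blast
  have e: "commensurator r = commensurator p"
    by (rule commensurator_eqI[OF p']) (use r axial_infinite_order in auto)
  have "len r \<le> len s" if "s \<in> commensurator p" "axial (2100 * \<delta>) s" for s
    using r(1) r(2)[of s] that by fastforce
  then show ?thesis using r p e unfolding shortest_axial_def by auto
qed

lemma shortest_axial_quotient:
  assumes r: "shortest_axial r" and F: "F \<subseteq> commensurator r" "4 * ball_size (100000 * \<delta>) < card F"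
  shows "\<exists>f\<in>F. \<exists>f'\<in>F. axial (2100 * \<delta>) (inv f \<otimes> f') \<and> len r \<le> len (inv f \<otimes> f')"
proof -
  obtain p where "axial (1000 * \<delta>) p" "commensurator r = commensurator p"
    using r by (auto simp: shortest_axial_def)
  then obtain f f' where f: "f \<in> F" "f' \<in> F" "axial (2100 * \<delta>) (inv f \<otimes> f')"
    using commensurator_axial_quotient[of p F] F by auto
  have rc: "r \<in> carrier G" using r axial_carrier by (auto simp: shortest_axial_def)
  then have "inv f \<otimes> f' \<in> commensurator r"
    using f F by (intro commensurator_mult commensurator_inv) auto
  then show ?thesis using f r by (auto simp: shortest_axial_def)
qed

definition count_const :: "nat \<Rightarrow> nat" where
  "count_const T = 4 * ball_size (100000 * \<delta>) * (2 * (4 * T + 1))"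

text \<open>Elements are sorted by ray and by length, in windows of width \<open>len r / 4\<close>.
  Two elements of one class have a quotient shorter than \<open>r\<close>; a class that is too large
  would contain an axial quotient at least as long as \<open>r\<close>.\<close>

lemma commensurator_count:
  assumes r: "shortest_axial r" and F: "finite F" "F \<subseteq> commensurator r" "\<And>f. f \<in> F \<Longrightarrow> len f \<le> real T * len r"
  shows "card F \<le> count_const T"
proof -
  note ax = shortest_axial_axial[OF r]
  note [simp] = axial_carrier[OF ax]
  have lenr: "100000 * \<delta> \<le> len r" by (rule axial_len[OF ax])
  obtain N :: nat where N: "real T * len r \<le> len (r [^] N)"
    using len_pow_unbounded[OF ax] by blast
  define side where "side f \<longleftrightarrow> len f - 2106 * \<delta> \<le> gp f (r [^] N)" for f
  define h where "h f = (side f, nat \<lfloor>4 * len f / len r\<rfloor>)" for f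
  have "card F \<le> 4 * ball_size (100000 * \<delta>) * card ((UNIV :: bool set) \<times> {0..4 * T})"
  proof (rule card_le_fibers[OF F(1), where h = h])
    show "h ` F \<subseteq> UNIV \<times> {0..4 * T}"
    proof clarsimp
      fix f s n assume "f \<in> F" "(s, n) = h f"
      then have n: "n = nat \<lfloor>4 * len f / len r\<rfloor>" and "4 * len f / len r \<le> real (4 * T)"
        using F(3)[of f] lenr delta_ge_1 by (auto simp: h_def field_simps)
      then show "n \<le> 4 * T" by linarith
    qed
    show "card {f \<in> F. h f = c} \<le> 4 * ball_size (100000 * \<delta>)" for c
    proof (rule ccontr)
      assume "\<not> ?thesis"
      then obtain f f' where f: "f \<in> F" "f' \<in> F" "h f = h f'" "len r \<le> len (inv f \<otimes> f')"
        using shortest_axial_quotient[OF r, of "{f \<in> F. h f = c}"] F(2) by (force simp: not_le)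
      have [simp]: "f \<in> carrier G" "f' \<in> carrier G" using f F commensurator_carrier by auto
      have ray: "\<exists>y\<in>carrier G. len f - 2106 * \<delta> \<le> gp f y \<and> len f' - 2106 * \<delta> \<le> gp f' y"
      proof (cases "side f")
        case True
        then show ?thesis using f(3) by (intro bexI[of _ "r [^] N"]) (auto simp: h_def side_def)
      next
        case False
        have *: "len x - 2106 * \<delta> \<le> gp x (inv r [^] N)" if "x \<in> F" "\<not> side x" for x
          using commensurator_axis[OF ax, of x N] that F N by (force simp: side_def)
        show ?thesis using f(3) False by (intro bexI[of _ "inv r [^] N"]) (auto intro!: * f simp: h_def)
      qed
      then obtain y where y: "y \<in> carrier G" "len f - 2106 * \<delta> \<le> gp f y" "len f' - 2106 * \<delta> \<le> gp f' y" by blast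
      have "min (len f) (len f') - 2106 * \<delta> - \<delta> \<le> gp f f'"
        by (rule gp_hyp[of _ y]) (use y in \<open>auto simp: gp_commute\<close>)
      moreover have "\<bar>len f - len f'\<bar> \<le> len r / 4"
      proof -
        have "\<lfloor>4 * len f / len r\<rfloor> = \<lfloor>4 * len f' / len r\<rfloor>"
          using f(3) lenr delta_ge_1 by (auto simp: h_def eq_nat_nat_iff)
        then have "\<bar>4 * len f / len r - 4 * len f' / len r\<bar> \<le> 1" by linarith
        then have "\<bar>4 * (len f - len f') / len r\<bar> \<le> 1" by (simp add: diff_divide_distrib right_diff_distrib)
        then show ?thesis using lenr delta_ge_1 by (auto simp: abs_le_iff field_simps abs_if)
      qed
      ultimately show False
        using f(4) len_inv_mult_gp[of f f'] lenr delta_ge_1 by (simp add: min_def abs_if split: if_splits)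
    qed
  qed auto
  then show ?thesis by (simp add: count_const_def card_cartesian_product)
qed

subsection \<open>Sets covered by few cosets of two commensurators\<close>

text \<open>Since \<open>f\<close> is near a power of \<open>r\<close>, which commutes with
  \<open>r\<close>, translation by \<open>r\<close> moves \<open>f\<close> by at most
  \<open>5 * len r\<close>. As \<open>e\<close> follows \<open>f\<close>, the elements
  \<open>r \<otimes> e\<close> and \<open>e\<close> overlap as well, which puts \<open>r\<close>
  into the other commensurator.\<close>

lemma commensurator_eq_of_overlap:
  assumes r: "axial c r" and r': "axial c' r'" and le: "len r \<le> len r'"
    and f: "f \<in> commensurator r" and e: "e \<in> commensurator r'"
    and R: "(overlap_const + 6) * len r' \<le> gp f e"
  shows "commensurator r = commensurator r'"
proof -
  note [simp] = axial_carrier[OF r] axial_carrier[OF r'] commensurator_carrier[OF f] commensurator_carrier[OF e]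
  obtain k :: int where k: "len (inv (r [^] k) \<otimes> f) \<le> 2 * len r"
    using commensurator_near_int_power[OF r f] by blast
  define z where "z = inv (r [^] k) \<otimes> f"
  have [simp]: "z \<in> carrier G" by (simp add: z_def)
  have fz: "f = r [^] k \<otimes> z" by (simp add: z_def mult_inv_cancel)
  have comm: "r \<otimes> r [^] k = r [^] k \<otimes> r"
    using intertwine_int_pow[of r r r k] by simp
  have "inv f \<otimes> (r \<otimes> f) = inv z \<otimes> (inv (r [^] k) \<otimes> ((r \<otimes> r [^] k) \<otimes> z))"
    unfolding fz by (simp add: inv_mult_group m_assoc)
  also have "\<dots> = inv z \<otimes> (r \<otimes> z)" unfolding comm by (simp add: m_assoc inv_mult_cancel)
  finally have "len (inv f \<otimes> (r \<otimes> f)) \<le> 5 * len r"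
    using len_mult[of "inv z" "r \<otimes> z"] len_mult[of r z] k by (simp add: z_def)
  then have 1: "len f - 3 * len r \<le> gp f (r \<otimes> f)"
    using len_mult_lower(2)[of r f] by (simp add: gp_def)
  have 2: "gp e f - len r \<le> gp (r \<otimes> e) (r \<otimes> f)" by (rule gp_translate_lower) auto
  have lenr: "100000 * \<delta> \<le> len r" by (rule axial_len[OF r])
  have fe: "gp f e \<le> len f" by (rule gp_le1) auto
  have "gp f e - 3 * len r - \<delta> \<le> gp (r \<otimes> e) f"
    by (rule gp_hyp[of _ "r \<otimes> f"]) (use 1 2 fe lenr delta_ge_1 in \<open>auto simp: gp_commute\<close>)
  then have "gp f e - 3 * len r - \<delta> - \<delta> \<le> gp (r \<otimes> e) e"
    by - (rule gp_hyp[of _ f], use lenr delta_ge_1 in auto)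
  then have "2 * len r + overlap_const * len r' \<le> gp (r \<otimes> e) e"
    using R le lenr delta_ge_1 by (simp add: algebra_simps)
  then have "r \<in> commensurator r'"
    by (intro overlap_imp_commensurator[OF r' _ e e]) auto
  then show ?thesis by (rule commensurator_eqI[OF r' _ axial_infinite_order[OF r]])
qed

definition mates :: "'a set \<Rightarrow> 'a set \<Rightarrow> 'a \<Rightarrow> 'a set" where
  "mates X H x = {y \<in> X. inv x \<otimes> y \<in> H}"

text \<open>More mates than this force a mate farther than \<open>12 * n + 1000\<close> units, with
  \<open>n\<close> the ball size. The coefficient 12 is such that half of
  \<open>12 * n - 2 * n\<close> still pays for twice \<open>2 * n\<close> plus the \<open>n\<close>
  in \<open>overlap_const\<close>.\<close>

definition mate_const :: nat where
  "mate_const = count_const (12 * ball_size (13000 * \<delta>) + 1000)"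

lemma long_mate:
  assumes r: "shortest_axial r" and X: "finite X" "X \<subseteq> carrier G" "x \<in> X"
    and K: "count_const T < card (mates X (commensurator r) x)"
  shows "\<exists>u\<in>commensurator r. x \<otimes> u \<in> X \<and> real T * len r < len u"
proof -
  let ?F = "(\<lambda>y. inv x \<otimes> y) ` mates X (commensurator r) x"
  have x: "x \<in> carrier G" using X by auto
  have "inj_on (\<lambda>y. inv x \<otimes> y) (mates X (commensurator r) x)"
    by (rule inj_on_inv_mult) (use x X(2) in \<open>auto simp: mates_def\<close>)
  then have "card ?F = card (mates X (commensurator r) x)" by (rule card_image)
  then have "\<not> (\<forall>f\<in>?F. len f \<le> real T * len r)"
    using K commensurator_count[OF r, of ?F T] X by (fastforce simp: mates_def)
  then show ?thesis using x X(2) by (force simp: mates_def mult_inv_cancel not_le)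
qed

text \<open>For \<open>x\<close> of maximal length in \<open>X\<close>, every \<open>u\<close> with \<open>x \<otimes> u \<in> X\<close> runs for half of its length along
  \<open>inv x\<close>. Long mates of \<open>x\<close> and of its mates, for both commensurators, therefore overlap.\<close>

lemma commensurator_eq_of_mates_aux:
  assumes r: "shortest_axial r" and r': "shortest_axial r'" and le: "len r \<le> len r'"
    and X: "finite X" "X \<noteq> {}" "X \<subseteq> carrier G"
    and m: "\<And>x. x \<in> X \<Longrightarrow> mate_const < card (mates X (commensurator r) x)"
    and m': "\<And>x. x \<in> X \<Longrightarrow> mate_const < card (mates X (commensurator r') x)"
  shows "commensurator r = commensurator r'"
proof -
  note ax = shortest_axial_axial[OF r] and ax' = shortest_axial_axial[OF r']
  note [simp] = axial_carrier[OF ax] axial_carrier[OF ax']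
  define L where "L = len r'"
  have L: "100000 * \<delta> \<le> L" unfolding L_def by (rule axial_len[OF ax'])
  define n where "n = ball_size (13000 * \<delta>)"
  define T where "T = 12 * n + 1000"
  define T' where "T' = 2 * n + 50"
  have M: "overlap_const = real n + 10" by (simp add: overlap_const_def n_def)
  obtain x where x: "x \<in> X" and max: "\<And>y. y \<in> X \<Longrightarrow> len y \<le> len x"
    using obtains_min[OF X(1,2), of "\<lambda>y. - len y"] by auto
  have [simp]: "x \<in> carrier G" using x X by auto
  have horo: "len u / 2 \<le> gp (inv x) u" if "u \<in> carrier G" "x \<otimes> u \<in> X" for u
    using max[OF that(2)] len_mult_gp[of x u] that by simp
  have horo2: "m / 2 - \<delta> \<le> gp u w"
    if "u \<in> carrier G" "w \<in> carrier G" "x \<otimes> u \<in> X" "x \<otimes> w \<in> X" "m \<le> len u" "m \<le> len w" for u w m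
    by (rule gp_hyp[of _ "inv x"]) (use that horo[of u] horo[of w] in \<open>auto simp: gp_commute\<close>)
  have long: "\<exists>u\<in>commensurator r'. y \<otimes> u \<in> X \<and> real T * L < len u" if "y \<in> X" for y
    using long_mate[OF r' X(1,3) that, of T] m'[OF that] by (simp add: mate_const_def T_def n_def L_def)
  obtain e where e: "e \<in> commensurator r'" "x \<otimes> e \<in> X" "real T * L < len e" using long[OF x] by blast
  have [simp]: "e \<in> carrier G" using e commensurator_carrier by auto
  let ?F = "(\<lambda>y. inv x \<otimes> y) ` mates X (commensurator r) x"
  have inj: "inj_on (\<lambda>y. inv x \<otimes> y) (mates X (commensurator r) x)"
    by (rule inj_on_inv_mult) (use X(3) in \<open>auto simp: mates_def\<close>)
  have F: "f \<in> commensurator r" "x \<otimes> f \<in> X" "f \<in> carrier G" if "f \<in> ?F" for f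
    using that X(3) by (auto simp: mates_def mult_inv_cancel subset_eq)
  have TT: "real T' * L \<le> real T * L" "(overlap_const + 6) * L \<le> real T' * L / 2 - \<delta>"
    using L delta_ge_1 by (auto simp: T_def T'_def M algebra_simps)
  show ?thesis
  proof (cases "\<exists>f\<in>?F. real T' * L < len f")
    case True
    then obtain f where f: "f \<in> ?F" "real T' * L < len f" by blast
    have "real T' * L / 2 - \<delta> \<le> gp f e"
      by (rule horo2) (use F[OF f(1)] f(2) e TT in auto)
    then show ?thesis
      using TT F[OF f(1)] e by (intro commensurator_eq_of_overlap[OF ax ax' le]) (auto simp: L_def)
  next
    case False
    \<comment> \<open>All mates \<open>f\<close> for \<open>r\<close> are short compared with
      \<open>L\<close>. Continuing from \<open>x \<otimes> f\<close> by a long \<open>g\<close> ends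
      in \<open>X\<close> again, so \<open>f \<otimes> g\<close> and \<open>e\<close> overlap and
      \<open>f\<close> lies in both commensurators. There are enough such \<open>f\<close> for an
      axial quotient, which determines both.\<close>
    have sub: "?F \<subseteq> commensurator r'"
    proof
      fix f assume f: "f \<in> ?F"
      note [simp] = F(3)[OF f]
      have short: "len f \<le> real T' * L" using False f by auto
      obtain g where g: "g \<in> commensurator r'" "(x \<otimes> f) \<otimes> g \<in> X" "real T * L < len g"
        using long[OF F(2)[OF f]] by blast
      have [simp]: "g \<in> carrier G" using g commensurator_carrier by auto
      have "real T * L - real T' * L \<le> len (f \<otimes> g)"
        using len_mult_lower(2)[of f g] g(3) short by simp
      moreover have "real T * L - real T' * L \<le> len e"
        using e(3) L delta_ge_1 mult_nonneg_nonneg[of "real T'" L] by linarith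
      ultimately have "(real T * L - real T' * L) / 2 - \<delta> \<le> gp (f \<otimes> g) e"
        using g(2) e(2) by (intro horo2) (auto simp: m_assoc)
      moreover have "2 * (real T' * L) + overlap_const * L \<le> (real T * L - real T' * L) / 2 - \<delta>"
        using L delta_ge_1 by (simp add: T_def T'_def M algebra_simps)
      ultimately have "2 * len f + overlap_const * len r' \<le> gp (f \<otimes> g) e"
        using short by (simp add: L_def)
      then show "f \<in> commensurator r'"
        by (intro overlap_imp_commensurator[OF ax' _ g(1) e(1)]) auto
    qed
    have "4 * ball_size (100000 * \<delta>) \<le> mate_const"
      by (simp add: mate_const_def count_const_def)
    then have "4 * ball_size (100000 * \<delta>) < card ?F"
      using m[OF x] card_image[OF inj] by simp
    then obtain f f' where f: "f \<in> ?F" "f' \<in> ?F" and axf: "axial (2100 * \<delta>) (inv f \<otimes> f')"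
      using shortest_axial_quotient[OF r, of ?F] F(1) by blast
    have "inv f \<otimes> f' \<in> commensurator r" "inv f \<otimes> f' \<in> commensurator r'"
      using F(1)[OF f(1)] F(1)[OF f(2)] subsetD[OF sub f(1)] subsetD[OF sub f(2)]
      by (simp_all add: commensurator_mult commensurator_inv)
    then have "commensurator (inv f \<otimes> f') = commensurator r" "commensurator (inv f \<otimes> f') = commensurator r'"
      using commensurator_eqI[OF ax _ axial_infinite_order[OF axf]]
        commensurator_eqI[OF ax' _ axial_infinite_order[OF axf]] by auto
    then show ?thesis by simp
  qed
qed

lemma commensurator_eq_of_mates:
  assumes "shortest_axial r" "shortest_axial r'" "finite X" "X \<noteq> {}" "X \<subseteq> carrier G"
    and "\<And>x. x \<in> X \<Longrightarrow> mate_const < card (mates X (commensurator r) x)"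
    and "\<And>x. x \<in> X \<Longrightarrow> mate_const < card (mates X (commensurator r') x)"
  shows "commensurator r = commensurator r'"
  using commensurator_eq_of_mates_aux[of r r' X] commensurator_eq_of_mates_aux[of r' r X] assms
  by (metis linear)

text \<open>Few cosets mean large fibers on average. Trimming turns this into many mates for every
  remaining element and for both subgroups at once.\<close>

lemma commensurator_eq_of_few_classes:
  assumes p: "axial (1000 * \<delta>) p" and p': "axial (1000 * \<delta>) p'" and X: "finite X" "X \<subseteq> carrier G"
    and K: "mate_const * (card (lclass (commensurator p) ` X) + card (lclass (commensurator p') ` X)) < card X"
  shows "commensurator p = commensurator p'"
proof -
  obtain r where r: "shortest_axial r" "commensurator r = commensurator p"
    using shortest_axial_exists[OF p] by blast
  obtain r' where r': "shortest_axial r'" "commensurator r' = commensurator p'"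
    using shortest_axial_exists[OF p'] by blast
  obtain Y where Y: "Y \<subseteq> X" "Y \<noteq> {}"
    and big: "\<And>x. x \<in> Y \<Longrightarrow> mate_const < card {y \<in> Y. lclass (commensurator p) y = lclass (commensurator p) x}"
      "\<And>x. x \<in> Y \<Longrightarrow> mate_const < card {y \<in> Y. lclass (commensurator p') y = lclass (commensurator p') x}"
    using trim_fibers[OF X(1) K] by blast
  have *: "{y \<in> Y. lclass (commensurator q) y = lclass (commensurator q) x} = mates Y (commensurator q) x"
    if "x \<in> Y" "q \<in> carrier G" for x q
    using that lclass_eq_iff[OF commensurator_subgroup, of q x] Y X by (auto simp: mates_def subset_eq)
  have "commensurator r = commensurator r'"
    by (rule commensurator_eq_of_mates[OF r(1) r'(1), of Y])
      (use Y X big finite_subset[OF Y(1) X(1)] * axial_carrier[OF p] axial_carrier[OF p'] r r' in auto)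
  then show ?thesis using r r' by simp
qed

subsection \<open>Periodic elements\<close>

text \<open>The factor 8 answers the loss in \<open>len v / 8\<close> of \<open>shift_power\<close>,
  so that this overlap exceeds \<open>overlap_const\<close> periods; the 200 absorbs displacements
  and multiples of \<delta>.\<close>

definition shift_const :: nat where
  "shift_const = 8 * ball_size (13000 * \<delta>) + 200"

text \<open>Left translation by \<open>p\<close> moves the geodesic from \<open>\<one>\<close> to \<open>v\<close> forward along itself: \<open>v\<close> is periodic with the
  short period \<open>p\<close>.\<close>

definition shift :: "'a \<Rightarrow> 'a \<Rightarrow> bool" where
  "shift p v \<longleftrightarrow> axial (1000 * \<delta>) p \<and> 4 * real shift_const * len p \<le> len v
    \<and> gp (inv p) v \<le> 1000 * \<delta> \<and> len (inv v \<otimes> p \<otimes> v) \<le> 2 * len p"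

text \<open>For \<open>i * len p\<close> close to \<open>len v / 2\<close>, translation by
  \<open>p [^] i\<close> moves \<open>v\<close> by at most about \<open>len v\<close> although it
  cancels nothing at the start. So \<open>v\<close> and \<open>p [^] i \<otimes> v\<close> share
  about half of \<open>v\<close>, and the latter begins with \<open>p [^] i\<close>, whose length is
  about \<open>len v / 4\<close> or more.\<close>

lemma shift_power:
  assumes s: "shift p v" and [simp]: "v \<in> carrier G"
  shows "\<exists>i::nat. len v / 8 \<le> gp (p [^] i) v"
proof -
  have p: "axial (1000 * \<delta>) p" and B: "4 * real shift_const * len p \<le> len v"
    and pv: "gp (inv p) v \<le> 1000 * \<delta>" and d: "len (inv v \<otimes> p \<otimes> v) \<le> 2 * len p"
    using s by (auto simp: shift_def)
  note [simp] = axial_carrier[OF p]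
  have lenp: "100000 * \<delta> \<le> len p" by (rule axial_len[OF p])
  have "100 * len p \<le> 4 * real shift_const * len p"
    by (rule mult_right_mono) (auto simp: shift_const_def)
  then have v: "100 * len p \<le> len v" using B by linarith
  define i where "i = nat \<lfloor>len v / (2 * len p)\<rfloor>"
  have "0 \<le> len v / (2 * len p)" by simp
  then have "real i \<le> len v / (2 * len p)" "len v / (2 * len p) - 1 \<le> real i"
    unfolding i_def by linarith+
  then have i: "real i * len p \<le> len v / 2" "len v / 2 - len p \<le> real i * len p"
    using lenp delta_ge_1 by (auto simp: field_simps)
  have i1: "i > 0"
  proof (rule ccontr)
    assume "\<not> ?thesis"
    then show False using i(2) v lenp delta_ge_1 by simp
  qed
  have leni: "real i * (len p / 2) \<le> len (p [^] i)" by (rule len_pow_lower[OF p])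
  have "len (inv p) - 1000 * \<delta> - \<delta> \<le> gp (inv p) (inv p [^] i)"
    by (rule gp_base_pow[OF axial_inv[OF p] i1])
  then have "gp (inv p [^] i) v \<le> 1000 * \<delta> + \<delta>"
    using lenp delta_ge_1 pv by - (rule gp_hyp_small[of "inv p"], auto)
  then have 1: "gp (inv (p [^] i)) v \<le> 1001 * \<delta>" by (simp add: nat_pow_inv)
  have 2: "len (p [^] i) - 1001 * \<delta> \<le> gp (p [^] i) (p [^] i \<otimes> v)"
    using gp_mult_right[of "p [^] i" v] 1 by simp
  have "len (inv v \<otimes> (p [^] i \<otimes> v)) = len ((inv v \<otimes> p \<otimes> v) [^] i)"
    using conj_nat_pow[of v p i] by (simp add: m_assoc)
  also have "\<dots> \<le> real i * len (inv v \<otimes> p \<otimes> v)" by (rule len_pow_upper) auto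
  also have "\<dots> \<le> real i * (2 * len p)" using d by (intro mult_left_mono) auto
  finally have "len (inv v \<otimes> (p [^] i \<otimes> v)) \<le> 2 * (real i * len p)" by simp
  moreover have "len (p [^] i \<otimes> v) = len (p [^] i) + len v - 2 * gp (inv (p [^] i)) v"
    by (rule len_mult_gp) auto
  moreover have nn: "0 \<le> len (p [^] i)" "0 \<le> len v" by auto
  ultimately have "len v - 2002 * \<delta> \<le> len v + len (p [^] i \<otimes> v) - len (inv v \<otimes> (p [^] i \<otimes> v))"
    using 1 i(1) nn by linarith
  then have 3: "len v / 2 - 1001 * \<delta> \<le> gp v (p [^] i \<otimes> v)" by (simp add: gp_def)
  have "len v / 8 + \<delta> - \<delta> \<le> gp (p [^] i) v"
    by (rule gp_hyp[of _ "p [^] i \<otimes> v"])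
      (use 2 3 i leni v lenp delta_ge_1 in \<open>auto simp: gp_commute\<close>)
  then show ?thesis by auto
qed

text \<open>Here \<open>f\<close> moves both the identity and \<open>v\<close> by a small fraction
  of \<open>len v\<close>, hence the geodesic between them stays nearly in place. Since that
  geodesic begins along the axis of \<open>p\<close>, the axis and its translate by \<open>f\<close>
  overlap.\<close>

lemma shift_absorb:
  assumes s: "shift p v" and [simp]: "v \<in> carrier G" "f \<in> carrier G"
    and f: "real shift_const * len f \<le> len v" "real shift_const * len (inv v \<otimes> f \<otimes> v) \<le> len v"
  shows "f \<in> commensurator p"
proof -
  have p: "axial (1000 * \<delta>) p" and B: "4 * real shift_const * len p \<le> len v"
    using s by (auto simp: shift_def)
  note [simp] = axial_carrier[OF p]
  have lenp: "100000 * \<delta> \<le> len p" by (rule axial_len[OF p])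
  obtain i :: nat where i: "len v / 8 \<le> gp (p [^] i) v" using shift_power[OF s] by auto
  define n where "n = real (ball_size (13000 * \<delta>))"
  have sc: "real shift_const = 8 * n + 200" by (simp add: shift_const_def n_def)
  have n: "0 \<le> n" by (simp add: n_def)
  define d where "d = len (inv v \<otimes> f \<otimes> v)"
  have np: "0 \<le> n * len p" "0 \<le> n * len f" "0 \<le> n * d" using n by (auto simp: d_def)
  have bounds: "32 * (n * len p) + 800 * len p \<le> len v" "200 * len f \<le> len v" "200 * d \<le> len v"
    using f B np by (auto simp: sc d_def algebra_simps)
  have 1: "len v / 8 - len f \<le> gp (f \<otimes> p [^] i) (f \<otimes> v)"
    using gp_translate_lower[of "p [^] i" v f] i by simp
  have 2: "len v - len f / 2 - d / 2 \<le> gp (f \<otimes> v) v"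
    using len_mult_lower(2)[of f v] len_inv_mult_commute[of "f \<otimes> v" v] by (simp add: gp_def d_def m_assoc field_simps)
  have "len v / 8 - len f - d - \<delta> \<le> gp (f \<otimes> p [^] i) v"
    by (rule gp_hyp[of _ "f \<otimes> v"]) (use 1 2 bounds len_nonneg[of f] len_nonneg[of "inv v \<otimes> f \<otimes> v"] in \<open>auto simp: d_def simp del: len_nonneg\<close>)
  then have "len v / 8 - len f - d - \<delta> - \<delta> \<le> gp (f \<otimes> p [^] i) (p [^] i)"
    using i delta_ge_1 by - (rule gp_hyp[of _ v], use len_nonneg[of f] len_nonneg[of "inv v \<otimes> f \<otimes> v"] in \<open>auto simp: gp_commute d_def simp del: len_nonneg\<close>)
  moreover have "overlap_const * len p = n * len p + 10 * len p"
    by (simp add: overlap_const_def n_def algebra_simps)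
  then have "2 * len f + overlap_const * len p \<le> len v / 8 - len f - d - \<delta> - \<delta>"
    using bounds lenp delta_ge_1 np by linarith
  ultimately have "2 * len f + overlap_const * len p \<le> gp (f \<otimes> p [^] i) (p [^] i)" by linarith
  moreover have pi: "p [^] i \<in> commensurator p"
    using int_pow_in_subgroup[OF commensurator_subgroup generator_in_commensurator, of p "int i"] by (simp add: int_pow_int)
  ultimately show ?thesis by (intro overlap_imp_commensurator[OF p _ pi pi]) auto
qed

text \<open>One period of \<open>v\<close> is absorbed by the other, so the commensurator is
  determined by \<open>v\<close> alone.\<close>

lemma shift_unique:
  assumes "shift p v" "shift q v" and [simp]: "v \<in> carrier G"
  shows "commensurator p = commensurator q"
proof -
  have p: "axial (1000 * \<delta>) p" and q: "axial (1000 * \<delta>) q" using assms by (auto simp: shift_def)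
  have B: "4 * (real shift_const * len q) \<le> len v" and d: "len (inv v \<otimes> q \<otimes> v) \<le> 2 * len q"
    using assms by (auto simp: shift_def)
  have nn: "0 \<le> real shift_const * len q" using axial_carrier[OF q] by simp
  have "real shift_const * len (inv v \<otimes> q \<otimes> v) \<le> 2 * (real shift_const * len q)"
    using mult_left_mono[OF d, of "real shift_const"] by simp
  then have "real shift_const * len q \<le> len v" "real shift_const * len (inv v \<otimes> q \<otimes> v) \<le> len v"
    using B nn by linarith+
  then have "q \<in> commensurator p"
    by (intro shift_absorb[OF assms(1)]) (use axial_carrier[OF q] in auto)
  then show ?thesis using commensurator_eqI[OF p _ axial_infinite_order[OF q]] by simp
qed

text \<open>Seen from the other end of \<open>v\<close>, the period \<open>q\<close> becomes
  \<open>v \<otimes> q \<otimes> inv v\<close>. It displaces the identity by at most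
  \<open>2 * len q\<close> and \<open>v\<close> by \<open>len q\<close>, so it is absorbed.\<close>

lemma shift_inv_conj:
  assumes s: "shift p v" and s': "shift q (inv v)" and [simp]: "v \<in> carrier G"
  shows "v \<otimes> q \<otimes> inv v \<in> commensurator p"
proof -
  have q: "axial (1000 * \<delta>) q" and B: "4 * (real shift_const * len q) \<le> len v"
    and d: "len (v \<otimes> q \<otimes> inv v) \<le> 2 * len q"
    using s' by (auto simp: shift_def)
  note [simp] = axial_carrier[OF q]
  have nn: "0 \<le> real shift_const * len q" by simp
  have "real shift_const * len (v \<otimes> q \<otimes> inv v) \<le> 2 * (real shift_const * len q)"
    using mult_left_mono[OF d, of "real shift_const"] by simp
  then have "real shift_const * len (v \<otimes> q \<otimes> inv v) \<le> len v" "real shift_const * len q \<le> len v"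
    using B nn by linarith+
  moreover have "inv v \<otimes> (v \<otimes> q \<otimes> inv v) \<otimes> v = q" by (simp add: m_assoc inv_mult_cancel)
  ultimately show ?thesis
    by (intro shift_absorb[OF s]) auto
qed

text \<open>Both \<open>q\<close> and its conjugate have nonzero powers that are powers of
  \<open>p\<close>, so \<open>g\<close> conjugates a nonzero power of \<open>q\<close> to another
  one.\<close>

lemma commensurator_normalizer:
  assumes p: "axial c p" and q: "q \<in> commensurator p" "infinite_order q" and [simp]: "g \<in> carrier G"
    and gq: "g \<otimes> q \<otimes> inv g \<in> commensurator p"
  shows "g \<in> commensurator p"
proof -
  note [simp] = axial_carrier[OF p] commensurator_carrier[OF q(1)]
  let ?q = "g \<otimes> q \<otimes> inv g"
  obtain a b :: int where ab: "a \<noteq> 0" "b \<noteq> 0" "q [^] a = p [^] b"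
    using infinite_order_in_commensurator[OF p q] by blast
  obtain a' b' :: int where ab': "a' \<noteq> 0" "b' \<noteq> 0" "?q [^] a' = p [^] b'"
    using infinite_order_in_commensurator[OF p gq conj_infinite_order[OF q(2)]] by auto
  have "g \<otimes> q [^] (a' * b) = ?q [^] (a' * b) \<otimes> g"
    by (rule intertwine_int_pow) (auto simp: m_assoc)
  also have "?q [^] (a' * b) = p [^] (b * b')"
    using ab'(3) int_pow_pow[of ?q a' b] by (simp add: int_pow_pow mult.commute)
  also have "\<dots> = q [^] (a * b')"
    using ab(3) int_pow_pow[of q a b'] by (simp add: int_pow_pow)
  finally have "g \<in> commensurator q"
    using ab ab' by (intro commensuratorI[of _ "a' * b" "a * b'"]) auto
  then show ?thesis using commensurator_eqI[OF p q] by simp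
qed

subsection \<open>Products with a fixed separator\<close>

text \<open>All products \<open>w1 \<otimes> v \<otimes> w2 \<otimes> v \<otimes> \<dots>\<close> are reduced. The condition \<open>len w \<le> len v\<close> is what turns an
  ambiguity in reading off \<open>w1\<close> from such a product into a period of \<open>v\<close>.\<close>

definition transverse :: "'a \<Rightarrow> 'a set \<Rightarrow> bool" where
  "transverse v W \<longleftrightarrow> finite W \<and> v \<in> carrier G \<and> W \<subseteq> carrier G \<and>
    (\<forall>w\<in>W. 1000000 * (real shift_const * \<delta>) \<le> len w \<and> len w \<le> len v
      \<and> gp (inv w) v \<le> 902 * \<delta> \<and> gp (inv v) w \<le> 902 * \<delta>)"

lemma shift_const_ge: "200 \<le> real shift_const"
  by (simp add: shift_const_def)

lemma transverseD:
  assumes "transverse v W" "w \<in> W"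
  shows "v \<in> carrier G" "w \<in> carrier G" "len w \<le> len v" "1000000 * \<delta> \<le> len w"
    "1000000 * (real shift_const * \<delta>) \<le> len w" "gp (inv w) v \<le> 902 * \<delta>" "gp (inv v) w \<le> 902 * \<delta>"
proof -
  show "v \<in> carrier G" "w \<in> carrier G" "len w \<le> len v" "gp (inv w) v \<le> 902 * \<delta>" "gp (inv v) w \<le> 902 * \<delta>"
    and *: "1000000 * (real shift_const * \<delta>) \<le> len w"
    using assms by (auto simp: transverse_def)
  have "1 * \<delta> \<le> real shift_const * \<delta>"
    by (rule mult_right_mono) (use shift_const_ge delta_ge_1 in auto)
  then show "1000000 * \<delta> \<le> len w" using * by simp
qed

text \<open>The last conclusion returns the hypothesis on \<open>y\<close> with the same 903: the
  long factor \<open>w\<close> resets the estimate, so errors do not accumulate along the product.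
  The others place \<open>w\<close> and \<open>w \<otimes> v\<close> near the geodesic to the
  product.\<close>

lemma transverse_code:
  assumes T: "transverse v W" and w: "w \<in> W" and y: "y \<in> carrier G" "gp (inv v) y \<le> 903 * \<delta>"
  shows "gp (inv w) (v \<otimes> y) \<le> 903 * \<delta>"
    and "len w - 903 * \<delta> \<le> gp w (w \<otimes> (v \<otimes> y))"
    and "len (w \<otimes> v) - 904 * \<delta> \<le> gp (w \<otimes> v) (w \<otimes> (v \<otimes> y))"
    and "len v - 903 * \<delta> \<le> gp v (v \<otimes> y)"
    and "gp (inv v) (w \<otimes> (v \<otimes> y)) \<le> 903 * \<delta>"
proof -
  note D = transverseD[OF T w]
  note [simp] = D(1,2) and wv = D(3) and g = D(6,7) and big = D(4)
  note [simp] = y(1)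
  show v: "len v - 903 * \<delta> \<le> gp v (v \<otimes> y)"
    using gp_mult_right[of v y] y by simp
  have "gp (v \<otimes> y) (inv w) \<le> 902 * \<delta> + \<delta>"
    by (rule gp_hyp_small[of v]) (use g v big wv delta_ge_1 in \<open>auto simp: gp_commute\<close>)
  then show a: "gp (inv w) (v \<otimes> y) \<le> 903 * \<delta>" by (simp add: gp_commute)
  then show b: "len w - 903 * \<delta> \<le> gp w (w \<otimes> (v \<otimes> y))"
    using gp_mult_right[of w "v \<otimes> y"] by simp
  have "gp (w \<otimes> (v \<otimes> y)) (inv v) \<le> 902 * \<delta> + \<delta>"
    by (rule gp_hyp_small[of w]) (use g b big delta_ge_1 in \<open>auto simp: gp_commute\<close>)
  then show "gp (inv v) (w \<otimes> (v \<otimes> y)) \<le> 903 * \<delta>" by (simp add: gp_commute)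
  have "len v - 902 * \<delta> \<le> gp (inv v) (inv (w \<otimes> v))"
    using gp_mult_right[of "inv v" "inv w"] g by (simp add: inv_mult_group gp_commute)
  then have "gp (inv (w \<otimes> v)) y \<le> 903 * \<delta> + \<delta>"
    using y big wv delta_ge_1 by - (rule gp_hyp_small[of "inv v"], auto)
  then show "len (w \<otimes> v) - 904 * \<delta> \<le> gp (w \<otimes> v) (w \<otimes> (v \<otimes> y))"
    using gp_mult_right[of "w \<otimes> v" y] by (simp add: m_assoc)
qed

lemma transverse_code_start:
  assumes T: "transverse v W"
  shows "y \<in> code v W k \<Longrightarrow> gp (inv v) y \<le> 903 * \<delta>"
proof (induction k arbitrary: y)
  case 0
  then show ?case using transverseD(7)[OF T, of y] delta_ge_1 by simp
next
  case (Suc k)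
  then obtain w y' where "w \<in> W" "y' \<in> code v W k" "y = w \<otimes> (v \<otimes> y')" by auto
  moreover have "y' \<in> carrier G" using code_carrier[of W v k] T calculation by (auto simp: transverse_def)
  ultimately show ?case using transverse_code(5)[OF T, of w y'] Suc.IH by auto
qed

text \<open>The elements \<open>w\<close>, \<open>w'\<close>, \<open>w \<otimes> v\<close>,
  \<open>w' \<otimes> v\<close> all lie near one geodesic, and both pairs are offset by about
  \<open>len w' - len w\<close>. So \<open>inv w \<otimes> w'\<close> pushes both ends of the
  geodesic from the identity to \<open>v\<close> forward; if it is long, this makes it a period of
  \<open>v\<close>.\<close>

lemma transverse_near:
  assumes T: "transverse v W" and w: "w \<in> W" "w' \<in> W" "len w \<le> len w'"
    and y: "y \<in> carrier G" "gp (inv v) y \<le> 903 * \<delta>" and y': "y' \<in> carrier G" "gp (inv v) y' \<le> 903 * \<delta>"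
    and e: "w \<otimes> (v \<otimes> y) = w' \<otimes> (v \<otimes> y')"
    and near: "8 * real shift_const * (len w' - len w) \<le> len v"
    and ns: "\<not> shift (inv w \<otimes> w') v"
  shows "len (inv w \<otimes> w') \<le> 100000 * \<delta>"
proof (rule ccontr)
  assume "\<not> ?thesis"
  then have far: "100000 * \<delta> < len (inv w \<otimes> w')" by simp
  note D = transverseD[OF T w(1)] and D' = transverseD[OF T w(2)]
  note [simp] = D(1,2) D'(2)
  have big: "20000 * (real shift_const * \<delta>) \<le> len v" "1000000 * \<delta> \<le> len w"
    and g: "gp (inv w) v \<le> 902 * \<delta>" "gp (inv w') v \<le> 902 * \<delta>"
    using D D' delta_ge_1 mult_nonneg_nonneg[of "real shift_const" \<delta>] by auto
  note [simp] = y(1) y'(1)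
  note t = transverse_code[OF T w(1) y] and t' = transverse_code[OF T w(2) y', folded e]
  define p where "p = inv w \<otimes> w'"
  have [simp]: "p \<in> carrier G" by (simp add: p_def)
  have ip: "inv p = inv w' \<otimes> w" by (simp add: p_def inv_mult_group)
  have ww: "len w - 903 * \<delta> - \<delta> \<le> gp w w'"
    by (rule gp_hyp[of _ "w \<otimes> (v \<otimes> y)"]) (use t(2) t'(2) w(3) in \<open>auto simp: gp_commute\<close>)
  then have lp: "len p \<le> len w' - len w + 1808 * \<delta>"
    using len_inv_mult_gp[of w w'] by (simp add: p_def)
  have lp': "len w' - len w \<le> len p"
    using len_mult_lower(2)[of "inv w" w'] by (simp add: p_def)
  have far': "98000 * \<delta> \<le> len w' - len w" using far lp delta_ge_1 by (simp add: p_def)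
  have B: "4 * real shift_const * len p \<le> len v"
  proof -
    have "4 * real shift_const * len p \<le> 4 * real shift_const * (len w' - len w + 1808 * \<delta>)"
      using lp by (intro mult_left_mono) auto
    also have "\<dots> = (8 * real shift_const * (len w' - len w)) / 2 + 7232 * (real shift_const * \<delta>)"
      by (simp add: field_simps)
    finally show ?thesis using near big(1) len_nonneg[OF D(1)] by linarith
  qed
  have p1: "98000 * \<delta> \<le> gp (inv w') (inv p)"
  proof -
    have "gp w' w \<le> len w" by (rule gp_le2) auto
    then show ?thesis unfolding ip using gp_mult_right[of "inv w'" w] far' by simp
  qed
  have pv: "gp (inv p) v \<le> 902 * \<delta> + \<delta>"
    by (rule gp_hyp_small[of "inv w'"]) (use p1 g delta_ge_1 in auto)
  have "gp (inv p) (v \<otimes> y') \<le> 903 * \<delta> + \<delta>"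
    by (rule gp_hyp_small[of "inv w'"]) (use p1 t'(1) delta_ge_1 in auto)
  moreover have vy: "v \<otimes> y = p \<otimes> (v \<otimes> y')"
  proof -
    have "v \<otimes> y = inv w \<otimes> (w \<otimes> (v \<otimes> y))" by (simp add: inv_mult_cancel)
    also have "\<dots> = p \<otimes> (v \<otimes> y')" unfolding e by (simp add: p_def m_assoc)
    finally show ?thesis .
  qed
  ultimately have p2: "len p - 904 * \<delta> \<le> gp p (v \<otimes> y)"
    using gp_mult_right[of p "v \<otimes> y'"] by simp
  have lpv: "len p \<le> len v"
  proof -
    have "1 * len p \<le> 4 * real shift_const * len p"
      by (rule mult_right_mono) (use shift_const_ge in auto)
    then show ?thesis using B by simp
  qed
  have p3: "len p - 904 * \<delta> - \<delta> \<le> gp p v"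
    by (rule gp_hyp[of _ "v \<otimes> y"]) (use p2 t(4) lpv delta_ge_1 in \<open>auto simp: gp_commute\<close>)
  have "gp (inv p) p \<le> 903 * \<delta> + \<delta>"
    using gp_hyp_small[of v p "inv p" "903 * \<delta>"] pv p3 far delta_ge_1 by (simp add: gp_commute p_def)
  then have ax: "axial (1000 * \<delta>) p"
    using far delta_ge_1 by (simp add: axial_def p_def)
  have "len (inv v \<otimes> p \<otimes> v) = len (inv (w \<otimes> v) \<otimes> (w' \<otimes> v))"
    by (simp add: p_def inv_mult_group m_assoc)
  also have "\<dots> \<le> 2 * len p"
  proof -
    have "min (len (w \<otimes> v)) (len (w' \<otimes> v)) - 904 * \<delta> - \<delta> \<le> gp (w \<otimes> v) (w' \<otimes> v)"
      by (rule gp_hyp[of _ "w \<otimes> (v \<otimes> y)"]) (use t(3) t'(3) in \<open>auto simp: gp_commute\<close>)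
    moreover have "len (w \<otimes> v) \<le> len w + len v" "len w + len v - 1804 * \<delta> \<le> len (w \<otimes> v)"
      "len (w' \<otimes> v) \<le> len w' + len v" "len w' + len v - 1804 * \<delta> \<le> len (w' \<otimes> v)"
      using g len_mult_gp[of w v] len_mult_gp[of w' v] len_mult[of w v] len_mult[of w' v] by simp_all
    ultimately have "len (inv (w \<otimes> v) \<otimes> (w' \<otimes> v)) \<le> len w' - len w + 5000 * \<delta>"
      using w(3) delta_ge_1 len_inv_mult_gp[of "w \<otimes> v" "w' \<otimes> v"] by (simp add: min_def split: if_splits)
    then show ?thesis using lp' far' delta_ge_1 by linarith
  qed
  finally have "shift p v"
    using ax B pv delta_ge_1 by (simp add: shift_def)
  then show False using ns by (simp add: p_def)
qed

definition window_const :: nat where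
  "window_const = ball_size (100000 * \<delta>) * (8 * shift_const + 1)"

text \<open>The candidates for the first factor are sorted by length into boundedly many windows; two distant
  candidates in one window would differ by a period of \<open>v\<close>.\<close>

lemma transverse_multiplicity:
  assumes T: "transverse v W" and ns: "\<And>w w'. w \<in> W \<Longrightarrow> w' \<in> W \<Longrightarrow> \<not> shift (inv w \<otimes> w') v"
  shows "card {w \<in> W. \<exists>y\<in>code v W k. x = w \<otimes> (v \<otimes> y)} \<le> window_const"
proof -
  let ?A = "{w \<in> W. \<exists>y\<in>code v W k. x = w \<otimes> (v \<otimes> y)}"
  have W: "finite W" "W \<subseteq> carrier G" and [simp]: "v \<in> carrier G"
    using T by (auto simp: transverse_def)
  show ?thesis
  proof (cases "W = {}")
    case False
    then obtain w0 where "w0 \<in> W" by blast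
    then have v: "0 < len v" using transverseD(3,4)[OF T] delta_ge_1 by fastforce
    define h where "h w = nat \<lfloor>8 * real shift_const * len w / len v\<rfloor>" for w
    have "card ?A \<le> ball_size (100000 * \<delta>) * card {0..8 * shift_const}"
    proof (rule card_le_fibers[where h = h])
      show "h ` ?A \<subseteq> {0..8 * shift_const}"
      proof clarsimp
        fix w assume "w \<in> W"
        then have "len w \<le> len v" using T by (auto simp: transverse_def)
        then have "8 * real shift_const * len w / len v \<le> 8 * real shift_const * len v / len v"
          using v by (intro divide_right_mono mult_left_mono) auto
        then have "8 * real shift_const * len w / len v \<le> real (8 * shift_const)" using v by simp
        then show "h w \<le> 8 * shift_const" unfolding h_def by linarith
      qed
      fix c
      let ?C = "{w \<in> ?A. h w = c}"
      show "card ?C \<le> ball_size (100000 * \<delta>)"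
      proof (cases "?C = {}")
        case False
        moreover have finC: "finite ?C" using W by auto
        ultimately obtain w where w: "w \<in> ?C" and min: "\<And>w'. w' \<in> ?C \<Longrightarrow> len w \<le> len w'"
          using obtains_min[of ?C len] by blast
        have wc: "w \<in> carrier G" using w W by auto
        have "?C \<subseteq> {g \<in> carrier G. len (inv w \<otimes> g) \<le> 100000 * \<delta>}"
        proof
          fix w' assume w': "w' \<in> ?C"
          obtain y where y: "y \<in> code v W k" "x = w \<otimes> (v \<otimes> y)" using w by auto
          obtain y' where y': "y' \<in> code v W k" "x = w' \<otimes> (v \<otimes> y')" using w' by auto
          have yc: "y \<in> carrier G" "y' \<in> carrier G" using y y' code_carrier[OF W(2), of v k] by auto
          have "0 \<le> 8 * real shift_const * len w / len v" "0 \<le> 8 * real shift_const * len w' / len v"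
            using w w' W v by auto
          moreover have "h w = h w'" using w w' by simp
          ultimately have "\<lfloor>8 * real shift_const * len w / len v\<rfloor> = \<lfloor>8 * real shift_const * len w' / len v\<rfloor>"
            by (simp add: h_def eq_nat_nat_iff)
          then have "8 * real shift_const * len w' / len v - 8 * real shift_const * len w / len v \<le> 1" by linarith
          then have "8 * real shift_const * (len w' - len w) \<le> len v"
            using v by (simp add: field_simps)
          then have "len (inv w \<otimes> w') \<le> 100000 * \<delta>"
            using w w' min[OF w'] y y' yc transverse_code_start[OF T] ns
            by (intro transverse_near[OF T, of w w' y y']) auto
          then show "w' \<in> {g \<in> carrier G. len (inv w \<otimes> g) \<le> 100000 * \<delta>}" using w' W by auto
        qed
        then have "card ?C \<le> card {g \<in> carrier G. len (inv w \<otimes> g) \<le> 100000 * \<delta>}"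
          using finite_translated_ball(1)[OF wc] by (rule card_mono[rotated])
        then show ?thesis using finite_translated_ball(2)[OF wc] by (rule order_trans)
      next
        case True
        show ?thesis unfolding True by simp
      qed
    qed (use W in auto)
    then show ?thesis by (simp add: window_const_def)
  qed simp
qed

lemma transverse_subset: "\<lbrakk>transverse v W; W' \<subseteq> W\<rbrakk> \<Longrightarrow> transverse v W'"
  unfolding transverse_def using finite_subset by blast

lemma transverse_growth:
  assumes T: "transverse v W" and ns: "\<And>w w'. w \<in> W \<Longrightarrow> w' \<in> W \<Longrightarrow> \<not> shift (inv w \<otimes> w') v"
  shows "card W ^ Suc k \<le> window_const ^ k * card (code v W k)"
  by (rule code_card) (use T transverse_multiplicity[OF T ns] in \<open>auto simp: transverse_def\<close>)

text \<open>The factor 2 pays for comparing two commensurators at a time; the summand 1 makes the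
  constant positive, as needed for a separator without period.\<close>

definition class_const :: nat where
  "class_const = 2 * mate_const + 1"

text \<open>All periods of \<open>v\<close> lie in one commensurator. In a set of coset
  representatives no quotient of two elements is a period, so letters can be read off with bounded
  ambiguity; the only question is whether the representatives make up a positive proportion of
  \<open>W\<close>.\<close>

lemma transverse_dichotomy:
  assumes T: "transverse v W" and W: "W \<noteq> {}"
  shows "(\<exists>W'\<subseteq>W. card W \<le> class_const * card W'
      \<and> (\<forall>k. card W' ^ Suc k \<le> window_const ^ k * card (code v W' k)))
    \<or> (\<exists>p. shift p v \<and> class_const * card (lclass (commensurator p) ` W) < card W)"
proof (cases "\<exists>p. shift p v")
  case False
  then show ?thesis
    using transverse_growth[OF T] by (intro disjI1 exI[of _ W]) (auto simp: class_const_def)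
next
  case True
  then obtain p where p: "shift p v" by blast
  have pc: "p \<in> carrier G" using p axial_carrier by (auto simp: shift_def)
  have Wc: "W \<subseteq> carrier G" and v: "v \<in> carrier G" using T by (auto simp: transverse_def)
  obtain W' where W': "W' \<subseteq> W" "card W' = card (lclass (commensurator p) ` W)"
    "\<And>w w'. w \<in> W' \<Longrightarrow> w' \<in> W' \<Longrightarrow> inv w \<otimes> w' \<in> commensurator p \<Longrightarrow> w = w'"
    using transversal_exists[OF commensurator_subgroup[OF pc] Wc] by blast
  have ns: "\<not> shift (inv w \<otimes> w') v" if w: "w \<in> W'" "w' \<in> W'" for w w'
  proof
    assume s: "shift (inv w \<otimes> w') v"
    have [simp]: "w \<in> carrier G" "w' \<in> carrier G" using w W' Wc by auto
    have "inv w \<otimes> w' \<in> commensurator p"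
      using shift_unique[OF p s v] generator_in_commensurator[of "inv w \<otimes> w'"] by simp
    then have "w = w'" using W'(3) w by blast
    then show False using s len_one delta_ge_1 by (simp add: shift_def axial_def)
  qed
  show ?thesis
  proof (cases "card W \<le> class_const * card W'")
    case True
    then show ?thesis
      using transverse_growth[OF transverse_subset[OF T W'(1)] ns] W'(1) by blast
  next
    case False
    then show ?thesis using p W'(2) by auto
  qed
qed

lemma transverse_inv:
  assumes "transverse v W"
  shows "transverse (inv v) ((\<lambda>w. inv w) ` W)"
  unfolding transverse_def
proof (intro conjI ballI)
  have W: "finite W" "v \<in> carrier G" "W \<subseteq> carrier G" using assms by (auto simp: transverse_def)
  show "finite ((\<lambda>w. inv w) ` W)" "inv v \<in> carrier G" "(\<lambda>w. inv w) ` W \<subseteq> carrier G"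
    using W by auto
  fix u assume "u \<in> (\<lambda>w. inv w) ` W"
  then obtain w where w: "w \<in> W" "u = inv w" by auto
  then have [simp]: "w \<in> carrier G" "v \<in> carrier G" using W by auto
  have "1000000 * (real shift_const * \<delta>) \<le> len w" "len w \<le> len v"
    "gp (inv w) v \<le> 902 * \<delta>" "gp (inv v) w \<le> 902 * \<delta>"
    using assms w(1) by (auto simp: transverse_def)
  then show "1000000 * (real shift_const * \<delta>) \<le> len u" "len u \<le> len (inv v)"
    "gp (inv u) (inv v) \<le> 902 * \<delta>" "gp (inv (inv v)) u \<le> 902 * \<delta>"
    unfolding w(2) by (simp_all add: gp_commute)
qed

text \<open>Few cosets identify the commensurators of \<open>p1\<close>, \<open>p2\<close> and those
  of \<open>q1\<close>, \<open>q2\<close>. Hence conjugation by \<open>v1\<close> and by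
  \<open>v2\<close> both take \<open>q1\<close> into the commensurator of \<open>p1\<close>, and
  \<open>v2 \<otimes> inv v1\<close> conjugates one of the results to the other.\<close>

lemma periodic_coset:
  assumes T1: "transverse v1 W" and T2: "transverse v2 W" and W: "W \<noteq> {}"
    and p1: "shift p1 v1" "class_const * card (lclass (commensurator p1) ` W) < card W"
    and p2: "shift p2 v2" "class_const * card (lclass (commensurator p2) ` W) < card W"
    and q1: "shift q1 (inv v1)" "class_const * card (lclass (commensurator q1) ` (\<lambda>w. inv w) ` W) < card W"
    and q2: "shift q2 (inv v2)" "class_const * card (lclass (commensurator q2) ` (\<lambda>w. inv w) ` W) < card W"
  shows "v2 \<otimes> inv v1 \<in> commensurator p1"
proof -
  have Wc: "finite W" "W \<subseteq> carrier G" and [simp]: "v1 \<in> carrier G" "v2 \<in> carrier G"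
    using T1 T2 by (auto simp: transverse_def)
  have ax: "axial (1000 * \<delta>) p1" "axial (1000 * \<delta>) p2" "axial (1000 * \<delta>) q1" "axial (1000 * \<delta>) q2"
    using p1 p2 q1 q2 by (auto simp: shift_def)
  note [simp] = ax[THEN axial_carrier]
  have few: "mate_const * (a + b) < n" if "class_const * a < n" "class_const * b < n" for a b n :: nat
  proof -
    have "class_const * x = 2 * (mate_const * x) + x" for x
      by (simp add: class_const_def)
    then show ?thesis using that by (simp add: distrib_left)
  qed
  have p12: "commensurator p1 = commensurator p2"
    by (rule commensurator_eq_of_few_classes[OF ax(1,2) Wc]) (rule few[OF p1(2) p2(2)])
  have ci: "card ((\<lambda>w. inv w) ` W) = card W"
    using Wc by (intro card_image inj_on_subset[OF inv_inj]) auto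
  have q12: "commensurator q1 = commensurator q2"
    by (rule commensurator_eq_of_few_classes[OF ax(3,4), of "(\<lambda>w. inv w) ` W"])
      (use Wc few[OF q1(2) q2(2)] ci in auto)
  define q where "q = v1 \<otimes> q1 \<otimes> inv v1"
  have [simp]: "q \<in> carrier G" by (simp add: q_def)
  have q: "q \<in> commensurator p1" unfolding q_def by (rule shift_inv_conj[OF p1(1) q1(1)]) simp
  have qi: "infinite_order q"
    unfolding q_def by (rule conj_infinite_order[OF axial_infinite_order[OF ax(3)]]) simp
  define q' where "q' = v2 \<otimes> q2 \<otimes> inv v2"
  have q': "q' \<in> commensurator p2" unfolding q'_def by (rule shift_inv_conj[OF p2(1) q2(1)]) simp
  have q'i: "infinite_order q'"
    unfolding q'_def by (rule conj_infinite_order[OF axial_infinite_order[OF ax(4)]]) simp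
  have "q1 \<in> commensurator q2" using q12 generator_in_commensurator[of q1] by simp
  then have "v2 \<otimes> q1 \<otimes> inv v2 \<in> commensurator q'"
    unfolding q'_def by (simp add: commensurator_conj)
  also have "commensurator q' = commensurator p1"
    using commensurator_eqI[OF ax(2) q' q'i] p12 by simp
  also have "v2 \<otimes> q1 \<otimes> inv v2 = (v2 \<otimes> inv v1) \<otimes> q \<otimes> inv (v2 \<otimes> inv v1)"
    by (simp add: q_def inv_mult_group m_assoc inv_mult_cancel)
  finally show ?thesis
    using commensurator_normalizer[OF ax(1) q qi, of "v2 \<otimes> inv v1"] by simp
qed

subsection \<open>Products of elements of a commensurator\<close>

text \<open>If \<open>u\<close> followed the axis for more than one period, multiplication by
  \<open>r\<close> or by \<open>inv r\<close> would shorten it.\<close>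

lemma gp_commensurator_minimal:
  assumes r: "axial c r" and [simp]: "u \<in> carrier G"
    and min: "len u \<le> len (r \<otimes> u)" "len u \<le> len (inv r \<otimes> u)"
    and e: "e \<in> commensurator r" "len r \<le> len e"
  shows "gp e u \<le> len r"
proof (rule ccontr)
  assume "\<not> ?thesis"
  then have big: "len r < gp e u" by simp
  note [simp] = axial_carrier[OF r] commensurator_carrier[OF e(1)]
  have lenr: "100000 * \<delta> \<le> len r" and c: "c \<le> 2100 * \<delta>" using axial_len[OF r] axial_bound[OF r] by auto
  have *: False if q: "axial c q" "len q = len r" "len u \<le> len (inv q \<otimes> u)" and n: "n \<ge> 1"
    and ray: "len e - c - 5 * \<delta> \<le> gp e (q [^] (n::nat))" for q n
  proof -
    have [simp]: "q \<in> carrier G" using q axial_carrier by blast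
    have "len q - c - \<delta> \<le> gp q (q [^] n)" using gp_base_pow[OF q(1), of n] n by simp
    then have "len q - c - 5 * \<delta> - \<delta> \<le> gp q e"
      using ray e(2) q(2) delta_ge_1 by - (rule gp_hyp[of _ "q [^] n"], auto simp: gp_commute)
    then have "len q - c - 6 * \<delta> - \<delta> \<le> gp q u"
      using big q(2) delta_ge_1 axial_bound_nonneg[OF r] by - (rule gp_hyp[of _ e], auto)
    then show False
      using q(2,3) len_inv_mult_gp[of q u] lenr c delta_ge_1 by simp
  qed
  obtain n :: nat where "n \<ge> 1" "len e - c - 5 * \<delta> \<le> gp e (r [^] n) \<or> len e - c - 5 * \<delta> \<le> gp e (inv r [^] n)"
    using commensurator_axis_far[OF r e(1), of 1] by blast
  then show False using *[of r n] *[of "inv r" n] r axial_inv[OF r] min by auto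
qed

text \<open>With \<open>n\<close> the ball size, a product follows the axis for at most
  \<open>(n + 17) * len r\<close>. Letters are longer than two such stretches, and ambiguous letters
  differ by at most that much.\<close>

definition coset_length :: nat where
  "coset_length = 2 * ball_size (13000 * \<delta>) + 50"

definition coset_const :: nat where
  "coset_const = count_const coset_length"

text \<open>Since \<open>w\<close> is shortest in its double coset, it leaves the axis of \<open>r\<close> at once, at both ends; since it is
  not in the commensurator, the axis and its translate by \<open>w\<close> have bounded overlap even if \<open>w\<close> is short.\<close>

lemma coset_code_growth:
  assumes r: "shortest_axial r" and F: "finite F" "F \<subseteq> commensurator r"
    "\<And>e. e \<in> F \<Longrightarrow> real coset_length * len r \<le> len e"
    and w: "w \<in> carrier G" "w \<notin> commensurator r"
    and min: "\<And>e e'. e \<in> commensurator r \<Longrightarrow> e' \<in> commensurator r \<Longrightarrow> len w \<le> len (e \<otimes> w \<otimes> e')"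
  shows "card F ^ Suc k \<le> coset_const ^ k * card (code w F k)"
proof -
  note ax = shortest_axial_axial[OF r]
  note [simp] = axial_carrier[OF ax] w(1)
  have lenr: "100000 * \<delta> \<le> len r" by (rule axial_len[OF ax])
  have Fc: "F \<subseteq> carrier G" using F commensurator_carrier by auto
  define n where "n = real (ball_size (13000 * \<delta>))"
  have M: "overlap_const = n + 10" by (simp add: overlap_const_def n_def)
  have T: "real coset_length = 2 * n + 50" by (simp add: coset_length_def n_def)
  have n0: "0 \<le> n * len r" "0 \<le> n" by (auto simp: n_def)
  define E where "E = {e \<in> commensurator r. len r \<le> len e}"
  have Ec: "e \<in> carrier G" "e \<in> commensurator r" "len r \<le> len e" "inv e \<in> E" if "e \<in> E" for e
    using that commensurator_carrier commensurator_inv[of r e] by (auto simp: E_def)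
  have FE: "e \<in> E" "(2 * n + 50) * len r \<le> len e" if "e \<in> F" for e
  proof -
    show *: "(2 * n + 50) * len r \<le> len e" using F(3)[OF that] T by simp
    have "len r \<le> (2 * n + 50) * len r" using n0 lenr delta_ge_1 by (simp add: algebra_simps)
    then show "e \<in> E" using * F(2) that by (auto simp: E_def)
  qed
  note gen = generator_in_commensurator[of r]
  have one: "\<one> \<in> commensurator r" by (rule commensurator_one) simp
  have a1: "gp e w \<le> len r" if "e \<in> E" for e
    using min[OF gen one] min[OF commensurator_inv[OF _ gen] one] Ec[OF that]
    by (intro gp_commensurator_minimal[OF ax]) auto
  have a2: "gp e (inv w) \<le> len r" if "e \<in> E" for e
  proof (rule gp_commensurator_minimal[OF ax])
    have "len (r \<otimes> inv w) = len (w \<otimes> inv r)" "len (inv r \<otimes> inv w) = len (w \<otimes> r)"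
      using len_inv[of "w \<otimes> inv r"] len_inv[of "w \<otimes> r"] by (simp_all add: inv_mult_group del: len_inv)
    then show "len (inv w) \<le> len (r \<otimes> inv w)" "len (inv w) \<le> len (inv r \<otimes> inv w)"
      using min[OF one gen] min[OF one commensurator_inv[OF _ gen]] by simp_all
  qed (use Ec[OF that] in auto)
  have b: "gp (w \<otimes> e') e \<le> (n + 16) * len r" if e: "e \<in> E" "e' \<in> E" for e e'
  proof (cases "3 * len r \<le> len w")
    case True
    note [simp] = Ec(1)[OF e(1)] Ec(1)[OF e(2)]
    have "gp w (w \<otimes> e') = len w - gp (inv w) e'" by (rule gp_mult_right) auto
    then have "2 * len r \<le> gp w (w \<otimes> e')" using a2[OF e(2)] True by (simp add: gp_commute)
    then have "gp (w \<otimes> e') e \<le> len r + \<delta>"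
      using a1[OF e(1)] lenr delta_ge_1 by - (rule gp_hyp_small[of w], auto simp: gp_commute)
    moreover have "(n + 16) * len r = n * len r + 16 * len r" by (simp add: algebra_simps)
    ultimately show ?thesis using n0(1) lenr delta_ge_1 by linarith
  next
    case False
    have "\<not> 2 * len w + overlap_const * len r \<le> gp (w \<otimes> e') e"
      using overlap_imp_commensurator[OF ax w(1) Ec(2)[OF e(2)] Ec(2)[OF e(1)]] w(2) by blast
    then show ?thesis using False by (simp add: M algebra_simps)
  qed
  \<comment> \<open>The invariant allows one unit more than the estimate for single letters. The
    length of the letters keeps further factors from consuming another one.\<close>
  define good where "good y \<longleftrightarrow> y \<in> carrier G \<and> gp (inv w) y \<le> 2 * len r
    \<and> (\<forall>e\<in>E. gp (w \<otimes> y) e \<le> (n + 17) * len r)" for y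
  have good: "good y" if "y \<in> code w F k" for y k
    using that
  proof (induction k arbitrary: y)
    case 0
    then have y: "y \<in> F" by simp
    have "gp (w \<otimes> y) e \<le> (n + 17) * len r" if "e \<in> E" for e
      using b[OF that FE(1)[OF y]] lenr delta_ge_1 by (simp add: algebra_simps)
    then show ?case
      using a2[OF FE(1)[OF y]] Ec(1)[OF FE(1)[OF y]] lenr delta_ge_1 by (simp add: good_def gp_commute)
  next
    case (Suc k)
    then obtain e' y' where e': "e' \<in> F" "y' \<in> code w F k" and y: "y = e' \<otimes> (w \<otimes> y')" by auto
    note g = Suc.IH[OF e'(2)]
    have [simp]: "y' \<in> carrier G" "e' \<in> carrier G" using g Ec(1)[OF FE(1)[OF e'(1)]] by (auto simp: good_def)
    have [simp]: "y \<in> carrier G" by (simp add: y)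
    have "gp e' y = len e' - gp (inv e') (w \<otimes> y')" unfolding y by (rule gp_mult_right) auto
    moreover have "gp (inv e') (w \<otimes> y') \<le> (n + 17) * len r"
      using g Ec(4)[OF FE(1)[OF e'(1)]] gp_commute[of "inv e'" "w \<otimes> y'"] by (simp add: good_def)
    moreover have "(2 * n + 50) * len r - (n + 17) * len r = (n + 33) * len r" by (simp add: algebra_simps)
    ultimately have 1: "(n + 33) * len r \<le> gp e' y" using FE(2)[OF e'(1)] by linarith
    have 2: "33 * len r \<le> (n + 33) * len r" using n0 by (simp add: algebra_simps)
    have "gp y (inv w) \<le> len r + \<delta>"
      using gp_hyp_small[of e' y "inv w" "len r"] a2[OF FE(1)[OF e'(1)]] 1 2 lenr delta_ge_1 by simp
    then have 3: "gp (inv w) y \<le> 2 * len r" using lenr delta_ge_1 by (simp add: gp_commute)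
    have 4: "gp (inv w) e' \<le> len r" using a2[OF FE(1)[OF e'(1)]] by (simp add: gp_commute)
    have 5: "(n + 30) * len r \<le> gp (w \<otimes> e') (w \<otimes> y)"
    proof -
      have "(n + 30) * len r = (n + 33) * len r - 3 * len r" by (simp add: algebra_simps)
      then show ?thesis using gp_translate[of e' y w, OF _ _ w(1)] 1 3 4 len_nonneg[OF w(1)] by (simp del: len_nonneg)
    qed
    have "gp (w \<otimes> y) e \<le> (n + 17) * len r" if e: "e \<in> E" for e
    proof -
      have "(n + 17) * len r = (n + 16) * len r + len r" "(n + 30) * len r = (n + 16) * len r + 14 * len r"
        by (simp_all add: algebra_simps)
      then show ?thesis
        using gp_hyp_small[of "w \<otimes> e'" "w \<otimes> y" e "(n + 16) * len r"] b[OF e FE(1)[OF e'(1)]] 5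
          Ec(1)[OF e] lenr delta_ge_1 by simp
    qed
    then show ?case using 3 by (simp add: good_def)
  qed
  show ?thesis
  proof (rule code_card[OF F(1) Fc w(1)])
    fix k x
    let ?A = "{e \<in> F. \<exists>y\<in>code w F k. x = e \<otimes> (w \<otimes> y)}"
    show "card ?A \<le> coset_const"
    proof (cases "?A = {}")
      case False
      then obtain e1 y1 where e1: "e1 \<in> F" and y1: "y1 \<in> code w F k" "x = e1 \<otimes> (w \<otimes> y1)" by auto
      note [simp] = Ec(1)[OF FE(1)[OF e1]]
      \<comment> \<open>Two possible first letters differ by \<open>q\<close> with
        \<open>w \<otimes> y1 = q \<otimes> (w \<otimes> y2)\<close>. These products leave the axis
        soon after the start and soon after the end of \<open>q\<close> respectively, so
        \<open>q\<close> is short and can be counted.\<close>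
      let ?B = "(\<lambda>e. inv e1 \<otimes> e) ` ?A"
      have "card ?B = card ?A"
        by (rule card_image, rule inj_on_inv_mult) (use Fc in auto)
      moreover have "card ?B \<le> count_const coset_length"
      proof (rule commensurator_count[OF r])
        show "finite ?B" using F by auto
        show "?B \<subseteq> commensurator r"
          using F(2) e1 by (auto intro!: commensurator_mult commensurator_inv)
        fix q assume "q \<in> ?B"
        then obtain e2 y2 where e2: "e2 \<in> F" "q = inv e1 \<otimes> e2" and y2: "y2 \<in> code w F k" "x = e2 \<otimes> (w \<otimes> y2)"
          by auto
        note [simp] = Ec(1)[OF FE(1)[OF e2(1)]]
        have [simp]: "q \<in> carrier G" by (simp add: e2)
        have gd: "good y1" "good y2" using good y1 y2 by auto
        then have [simp]: "y1 \<in> carrier G" "y2 \<in> carrier G" by (auto simp: good_def)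
        have qE: "q \<in> commensurator r"
          using F(2) e1 e2 by (auto intro!: commensurator_mult commensurator_inv)
        show "len q \<le> real coset_length * len r"
        proof (cases "len r \<le> len q")
          case True
          then have q: "q \<in> E" using qE by (simp add: E_def)
          have "w \<otimes> y1 = inv e1 \<otimes> (e1 \<otimes> (w \<otimes> y1))" by (simp add: inv_mult_cancel)
          also have "\<dots> = q \<otimes> (w \<otimes> y2)" using y1(2) y2(2) by (simp add: e2 m_assoc)
          finally have e: "w \<otimes> y1 = q \<otimes> (w \<otimes> y2)" .
          have "gp q (w \<otimes> y1) = len q - gp (inv q) (w \<otimes> y2)" unfolding e by (rule gp_mult_right) auto
          moreover have "gp (w \<otimes> y1) q \<le> (n + 17) * len r" "gp (w \<otimes> y2) (inv q) \<le> (n + 17) * len r"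
            using gd q Ec(4)[OF q] by (auto simp: good_def)
          ultimately have "len q \<le> 2 * ((n + 17) * len r)"
            using gp_commute[of "inv q" "w \<otimes> y2"] gp_commute[of q "w \<otimes> y1"] by simp
          also have "\<dots> \<le> real coset_length * len r" unfolding T using lenr delta_ge_1 by (simp add: algebra_simps)
          finally show ?thesis .
        next
          case False
          moreover have "real coset_length * len r = 2 * (n * len r) + 50 * len r"
            by (simp add: T algebra_simps)
          ultimately show ?thesis using n0(1) lenr delta_ge_1 by linarith
        qed
      qed
      ultimately show ?thesis by (simp add: coset_const_def)
    next
      case True
      then show ?thesis by (simp only: card.empty)
    qed
  qed
qed

text \<open>The separator is replaced by a shortest element of its double coset, the letters being
  translated accordingly. The subtraction accounts for letters that are then too short.\<close>

lemma commensurator_code_growth: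
  assumes p: "axial (1000 * \<delta>) p" and E: "finite F" "F \<subseteq> commensurator p"
    and w: "w \<in> carrier G" "w \<notin> commensurator p"
  shows "(card F - coset_const) ^ Suc k \<le> coset_const ^ k * card (code w F k)"
proof -
  obtain r where r: "shortest_axial r" "commensurator r = commensurator p"
    using shortest_axial_exists[OF p] by blast
  let ?E = "commensurator r"
  note ax = shortest_axial_axial[OF r(1)]
  note [simp] = axial_carrier[OF ax] axial_carrier[OF p] w(1)
  \<comment> \<open>The bound by \<open>len w\<close> makes this part of the double coset finite and
    keeps its shortest elements.\<close>
  let ?D = "{e \<otimes> w \<otimes> e' |e e'. e \<in> ?E \<and> e' \<in> ?E \<and> len (e \<otimes> w \<otimes> e') \<le> len w}"
  have "finite ?D"
    by (rule finite_subset[OF _ finite_ball[of "len w"]]) (auto simp: commensurator_carrier)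
  moreover have "w \<in> ?D" using commensurator_one[of r] by (auto intro!: exI[of _ \<one>])
  ultimately obtain w0 where w0: "w0 \<in> ?D" "\<And>y. y \<in> ?D \<Longrightarrow> len w0 \<le> len y"
    using obtains_min[of ?D len] by blast
  then obtain e e' where e: "e \<in> ?E" "e' \<in> ?E" "w0 = e \<otimes> w \<otimes> e'" by auto
  have [simp]: "e \<in> carrier G" "e' \<in> carrier G" using e commensurator_carrier by auto
  have [simp]: "w0 \<in> carrier G" by (simp add: e)
  define a b where "a = inv e" and "b = inv e'"
  have ab: "a \<in> ?E" "b \<in> ?E" using e by (auto simp: a_def b_def intro!: commensurator_inv)
  have [simp]: "a \<in> carrier G" "b \<in> carrier G" by (auto simp: a_def b_def)
  have ww: "w = a \<otimes> w0 \<otimes> b" by (simp add: a_def b_def e m_assoc inv_mult_cancel)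
  have w0E: "w0 \<notin> ?E"
    using w(2) ww ab commensurator_mult[of r] r(2) by (metis axial_carrier[OF ax])
  have min: "len w0 \<le> len (c \<otimes> w0 \<otimes> c')" if c: "c \<in> ?E" "c' \<in> ?E" for c c'
  proof (cases "len (c \<otimes> w0 \<otimes> c') \<le> len w")
    case True
    have [simp]: "c \<in> carrier G" "c' \<in> carrier G" using c commensurator_carrier by auto
    have "c \<otimes> w0 \<otimes> c' = (c \<otimes> e) \<otimes> w \<otimes> (e' \<otimes> c')" by (simp add: e m_assoc)
    moreover have "c \<otimes> e \<in> ?E" "e' \<otimes> c' \<in> ?E" using c e by (auto intro!: commensurator_mult)
    ultimately have "c \<otimes> w0 \<otimes> c' \<in> ?D" using True by force
    then show ?thesis by (rule w0(2))
  next
    case False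
    then show ?thesis using w0(1) by auto
  qed
  have Fc: "F \<subseteq> carrier G" using E commensurator_carrier by auto
  let ?g = "\<lambda>x. b \<otimes> x \<otimes> a"
  define F1 where "F1 = ?g ` F"
  have F1: "finite F1" "F1 \<subseteq> ?E"
    using E r ab by (auto simp: F1_def intro!: commensurator_mult)
  have cF1: "card F1 = card F"
    unfolding F1_def
  proof (rule card_image, rule inj_onI)
    fix x y assume xy: "x \<in> F" "y \<in> F" "?g x = ?g y"
    then have [simp]: "x \<in> carrier G" "y \<in> carrier G" using Fc by auto
    show "x = y" using xy(3) by (simp add: m_assoc)
  qed
  define F2 where "F2 = {f \<in> F1. real coset_length * len r \<le> len f}"
  have "card {f \<in> F1. len f \<le> real coset_length * len r} \<le> coset_const"
    unfolding coset_const_def by (rule commensurator_count[OF r(1)]) (use F1 in auto)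
  moreover have "card F1 \<le> card (F2 \<union> {f \<in> F1. len f \<le> real coset_length * len r})"
    using F1 by (intro card_mono) (auto simp: F2_def)
  moreover have "\<dots> \<le> card F2 + card {f \<in> F1. len f \<le> real coset_length * len r}" by (rule card_Un_le)
  ultimately have "card F - coset_const \<le> card F2" using cF1 by linarith
  then have "(card F - coset_const) ^ Suc k \<le> card F2 ^ Suc k" by (rule power_mono) simp
  also have "\<dots> \<le> coset_const ^ k * card (code w0 F2 k)"
    by (rule coset_code_growth[OF r(1)]) (use F1 w0E min in \<open>auto simp: F2_def\<close>)
  also have "card (code w0 F2 k) \<le> card (code w0 F1 k)"
    using code_finite[OF F1(1)] by (intro card_mono code_mono) (auto simp: F2_def)
  also have "code w0 F1 k = ?g ` code w F k"
    unfolding ww F1_def by (rule code_conj[symmetric]) (use Fc in auto)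
  also have "card (?g ` code w F k) \<le> card (code w F k)"
    by (rule card_image_le[OF code_finite[OF E(1)]])
  finally show ?thesis by (simp add: mult_le_mono2)
qed

subsection \<open>Displacement energy and reduced pairs\<close>

lemma direction_exists:
  assumes "u \<in> carrier G" "1000 * \<delta> \<le> len u"
  shows "\<exists>y\<in>carrier G. \<bar>len y - 1000 * \<delta>\<bar> \<le> \<delta> \<and> 998 * \<delta> \<le> gp y u"
proof -
  obtain y where "y \<in> carrier G" "\<bar>len y - 1000 * \<delta>\<bar> \<le> \<delta>" "len y + len (inv y \<otimes> u) \<le> len u + 2 * \<delta>"
    using coarse_geodesic[OF assms(1), of "1000 * \<delta>"] assms(2) delta_ge_1 by auto
  then show ?thesis unfolding gp_def by (intro bexI[of _ y]) auto
qed

lemma len_conj_upper: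
  assumes [simp]: "a \<in> carrier G" "u \<in> carrier G"
  shows "len (inv a \<otimes> u \<otimes> a) \<le> len u + 2 * len a"
  using len_mult[of "inv a \<otimes> u" a] len_mult[of "inv a" u] by simp

text \<open>Conjugation costs twice \<open>len a\<close>, at most 2002 multiples of \<delta>, and
  cancellation at the two ends saves at least \<open>2 * 897 + 2 * 896\<close> of them.\<close>

lemma len_conj_decrease:
  assumes [simp]: "a \<in> carrier G" "u \<in> carrier G"
    and a: "len a \<le> 1001 * \<delta>" and u: "5000 * \<delta> \<le> len u"
    and g: "897 * \<delta> \<le> gp u a" "897 * \<delta> \<le> gp (inv u) a"
  shows "len (inv a \<otimes> u \<otimes> a) \<le> len u - 1500 * \<delta>"
proof -
  have 1: "len (u \<otimes> a) = len u + len a - 2 * gp (inv u) a" by (rule len_mult_gp) auto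
  have 2: "gp u (u \<otimes> a) = len u - gp (inv u) a" by (rule gp_mult_right) auto
  have 3: "gp (inv u) a \<le> len a" by (rule gp_le2) auto
  have "897 * \<delta> - \<delta> \<le> gp a (u \<otimes> a)"
    by (rule gp_hyp[of _ u]) (use 2 3 a u g delta_ge_1 in \<open>auto simp: gp_commute\<close>)
  moreover have "len (inv a \<otimes> u \<otimes> a) = len a + len (u \<otimes> a) - 2 * gp a (u \<otimes> a)"
    using len_inv_mult_gp[of a "u \<otimes> a"] by (simp add: m_assoc)
  ultimately show ?thesis using 1 a g delta_ge_1 by simp
qed

text \<open>A point at height about \<open>1000 * \<delta>\<close> on the way to \<open>u\<close>.
  The choice is arbitrary, but all values lie in one finite ball, so initial directions have a
  finite coding.\<close>

definition direction :: "'a \<Rightarrow> 'a" where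
  "direction u = (SOME y. y \<in> carrier G \<and> \<bar>len y - 1000 * \<delta>\<bar> \<le> \<delta> \<and> 998 * \<delta> \<le> gp y u)"

lemma directionD:
  assumes "u \<in> carrier G" "1000 * \<delta> \<le> len u"
  shows "direction u \<in> carrier G" "len (direction u) \<le> 1001 * \<delta>" "998 * \<delta> \<le> gp (direction u) u"
proof -
  have "direction u \<in> carrier G \<and> \<bar>len (direction u) - 1000 * \<delta>\<bar> \<le> \<delta> \<and> 998 * \<delta> \<le> gp (direction u) u"
    unfolding direction_def by (rule someI_ex) (use direction_exists[OF assms] in blast)
  then show "direction u \<in> carrier G" "len (direction u) \<le> 1001 * \<delta>" "998 * \<delta> \<le> gp (direction u) u"
    by linarith+
qed

lemma separated_directions:
  assumes u: "u \<in> carrier G" "1000 * \<delta> \<le> len u" and v: "v \<in> carrier G" "1000 * \<delta> \<le> len v"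
    and n: "gp (direction u) (direction v) < 900 * \<delta>"
  shows "gp u v \<le> 902 * \<delta>"
proof (rule ccontr)
  assume neg: "\<not> ?thesis"
  note du = directionD[OF u] and dv = directionD[OF v]
  have "902 * \<delta> - \<delta> \<le> gp (direction u) v"
    by (rule gp_hyp[of _ u]) (use du neg u v delta_ge_1 in auto)
  then have "901 * \<delta> - \<delta> \<le> gp (direction u) (direction v)"
    using du dv v delta_ge_1 by - (rule gp_hyp[of _ v], auto simp: gp_commute)
  then show False using n by simp
qed

text \<open>Twenty times a bound for the number of pairs of directions, so that all unpopular pairs
  together account for at most a twentieth of \<open>U\<close>.\<close>

definition types_const :: nat where
  "types_const = 20 * (ball_size (1001 * \<delta>) * ball_size (1001 * \<delta>))"

text \<open>There are boundedly many initial directions. If no two popular pairs (direction of \<open>u\<close>, direction of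
  \<open>inv u\<close>) were compatible, almost all elements would start and end in a common direction \<open>a\<close>, and
  conjugation by \<open>a\<close> would decrease the total length.\<close>

lemma reduced_pairs:
  assumes U: "finite U" "U \<subseteq> carrier G" "U \<noteq> {}" and L: "5000 * \<delta> \<le> L" and big: "20 * ball_size L \<le> card U"
    and min: "\<And>g. g \<in> carrier G \<Longrightarrow> (\<Sum>u\<in>U. len u) \<le> (\<Sum>u\<in>U. len (inv g \<otimes> u \<otimes> g)) + 1"
  shows "\<exists>A B. A \<subseteq> U \<and> B \<subseteq> U \<and> card U \<le> types_const * card A \<and> card U \<le> types_const * card B \<and>
    (\<forall>u\<in>A. \<forall>v\<in>B. L \<le> len u \<and> L \<le> len v \<and> gp (inv u) v \<le> 902 * \<delta> \<and> gp (inv v) u \<le> 902 * \<delta>)"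
proof (rule ccontr)
  assume neg: "\<not> ?thesis"
  define U1 where "U1 = {u \<in> U. L < len u}"
  have U1: "u \<in> carrier G" "L < len u" "5000 * \<delta> \<le> len u" "1000 * \<delta> \<le> len u" "u \<in> U" if "u \<in> U1" for u
    using that U L delta_ge_1 by (auto simp: U1_def)
  define Y where "Y = {g \<in> carrier G. len g \<le> 1001 * \<delta>}"
  have Y: "finite Y" "card Y = ball_size (1001 * \<delta>)"
    by (auto simp: Y_def ball_size_def finite_ball)
  define \<tau> where "\<tau> u = (direction u, direction (inv u))" for u
  define fib where "fib c = {u \<in> U1. \<tau> u = c}" for c
  define popular where "popular c \<longleftrightarrow> card U \<le> types_const * card (fib c)" for c
  define P where "P = {u \<in> U1. popular (\<tau> u)}"
  have \<tau>Y: "\<tau> u \<in> Y \<times> Y" if "u \<in> U1" for u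
    using directionD[of u] directionD[of "inv u"] U1[OF that] by (auto simp: \<tau>_def Y_def)
  have finU1: "finite U1" using U by (simp add: U1_def)
  \<comment> \<open>Otherwise the elements of the two types would form the sets \<open>A\<close> and
    \<open>B\<close> that were assumed not to exist. The two types may coincide.\<close>
  have clash: "900 * \<delta> \<le> gp t s' \<or> 900 * \<delta> \<le> gp t' s"
    if pop: "popular (s, t)" "popular (s', t')" for s t s' t'
  proof (rule ccontr)
    assume far: "\<not> ?thesis"
    have *: "L \<le> len u \<and> L \<le> len v \<and> gp (inv u) v \<le> 902 * \<delta> \<and> gp (inv v) u \<le> 902 * \<delta>"
      if u: "u \<in> fib (s, t)" and v: "v \<in> fib (s', t')" for u v
    proof -
      have "u \<in> U1" "v \<in> U1" and d: "direction u = s" "direction (inv u) = t" "direction v = s'" "direction (inv v) = t'"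
        using u v by (auto simp: fib_def \<tau>_def)
      note u1 = U1[OF \<open>u \<in> U1\<close>] and v1 = U1[OF \<open>v \<in> U1\<close>]
      have "gp (inv u) v \<le> 902 * \<delta>" "gp (inv v) u \<le> 902 * \<delta>"
        using separated_directions[of "inv u" v] separated_directions[of "inv v" u] u1 v1 far d by auto
      then show ?thesis using u1 v1 by simp
    qed
    then have all: "\<forall>u\<in>fib (s, t). \<forall>v\<in>fib (s', t').
        L \<le> len u \<and> L \<le> len v \<and> gp (inv u) v \<le> 902 * \<delta> \<and> gp (inv v) u \<le> 902 * \<delta>"
      by (intro ballI)
    have sub: "fib (s, t) \<subseteq> U" "fib (s', t') \<subseteq> U" by (auto simp: fib_def U1_def)
    show False
      by (rule notE[OF neg], rule exI[of _ "fib (s, t)"], rule exI[of _ "fib (s', t')"],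
          intro conjI sub pop[unfolded popular_def] all)
  qed
  have unpop: "20 * card (U1 - P) \<le> card U"
  proof -
    let ?m = "ball_size (1001 * \<delta>) * ball_size (1001 * \<delta>)"
    have mpos: "0 < ?m" using ball_size_pos[of "1001 * \<delta>"] delta_ge_1 by simp
    have "card (U1 - P) \<le> (card U div (20 * ?m)) * card (Y \<times> Y)"
    proof (rule card_le_fibers[where h = \<tau>])
      show "\<tau> ` (U1 - P) \<subseteq> Y \<times> Y" using \<tau>Y by blast
      fix c
      show "card {u \<in> U1 - P. \<tau> u = c} \<le> card U div (20 * ?m)"
      proof (cases "popular c")
        case True
        then have "{u \<in> U1 - P. \<tau> u = c} = {}" by (auto simp: P_def)
        then show ?thesis by (simp only: card.empty)
      next
        case False
        have "card {u \<in> U1 - P. \<tau> u = c} \<le> card (fib c)"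
          using finU1 by (intro card_mono) (auto simp: fib_def)
        also have "card (fib c) \<le> card U div (20 * ?m)"
          using False mpos by (simp add: popular_def types_const_def less_eq_div_iff_mult_less_eq mult.commute)
        finally show ?thesis .
      qed
    qed (use finU1 Y \<tau>Y in auto)
    then have "20 * card (U1 - P) \<le> card U div (20 * ?m) * (20 * ?m)"
      using Y by (simp add: card_cartesian_product)
    also have "\<dots> \<le> card U" by (rule div_times_less_eq_dividend)
    finally show ?thesis .
  qed
  have "card (U - U1) \<le> ball_size L"
    unfolding ball_size_def by (intro card_mono finite_ball) (use U in \<open>auto simp: U1_def\<close>)
  then have short: "20 * card (U - U1) \<le> card U" using big by linarith
  have PU: "P \<subseteq> U" "finite P" using U by (auto simp: P_def U1_def)
  have "card (U - P) \<le> card ((U - U1) \<union> (U1 - P))"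
    using U finU1 by (intro card_mono) auto
  also have "\<dots> \<le> card (U - U1) + card (U1 - P)" by (rule card_Un_le)
  finally have rest: "10 * card (U - P) \<le> card U" using short unpop by linarith
  have cU: "card U = card P + card (U - P)"
    using PU U by (metis card_Diff_subset card_mono le_add_diff_inverse)
  have cpos: "0 < card U" using U by (simp add: card_gt_0_iff)
  then have "0 < card P" using rest cU by linarith
  then have "P \<noteq> {}" by auto
  then obtain u0 where u0: "u0 \<in> P" by blast
  define a b where "a = direction u0" and "b = direction (inv u0)"
  have pop0: "popular (a, b)" using u0 by (auto simp: P_def \<tau>_def a_def b_def)
  have aY: "a \<in> Y" "b \<in> Y" using \<tau>Y[of u0] u0 by (auto simp: P_def \<tau>_def a_def b_def)
  then have [simp]: "a \<in> carrier G" "b \<in> carrier G" and la: "len a \<le> 1001 * \<delta>" by (auto simp: Y_def)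
  have ab: "900 * \<delta> \<le> gp a b" using clash[OF pop0 pop0] by (simp add: gp_commute)
  have dec: "len (inv a \<otimes> u \<otimes> a) \<le> len u - 1500 * \<delta>" if u: "u \<in> P" for u
  proof -
    have uU1: "u \<in> U1" using u by (simp add: P_def)
    note u1 = U1[OF uU1]
    define s t where "s = direction u" and "t = direction (inv u)"
    have pop: "popular (s, t)" using u by (simp add: P_def \<tau>_def s_def t_def)
    have [simp]: "s \<in> carrier G" "t \<in> carrier G" using \<tau>Y[OF uU1] by (auto simp: \<tau>_def Y_def s_def t_def)
    have st: "900 * \<delta> \<le> gp s t" using clash[OF pop pop] by (simp add: gp_commute)
    note [simp] = u1(1)
    have chain: "898 * \<delta> \<le> gp a s \<and> 898 * \<delta> \<le> gp a t"
    proof (rule disjE[OF clash[OF pop0 pop]])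
      assume h: "900 * \<delta> \<le> gp b s"
      have 1: "900 * \<delta> - \<delta> \<le> gp a s" by (rule gp_hyp[of _ b]) (use ab h in auto)
      have "900 * \<delta> - \<delta> - \<delta> \<le> gp a t" by (rule gp_hyp[of _ s]) (use 1 st delta_ge_1 in auto)
      then show ?thesis using 1 delta_ge_1 by simp
    next
      assume h: "900 * \<delta> \<le> gp t a"
      have "900 * \<delta> - \<delta> \<le> gp a s" by (rule gp_hyp[of _ t]) (use st h in \<open>auto simp: gp_commute\<close>)
      then show ?thesis using h delta_ge_1 by (simp add: gp_commute)
    qed
    have "898 * \<delta> - \<delta> \<le> gp u a"
      by (rule gp_hyp[of _ s]) (use chain directionD(3)[of u, folded s_def] u1 delta_ge_1 in \<open>auto simp: gp_commute\<close>)
    moreover have "898 * \<delta> - \<delta> \<le> gp (inv u) a"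
      by (rule gp_hyp[of _ t]) (use chain directionD(3)[of "inv u", folded t_def] u1 delta_ge_1 in \<open>auto simp: gp_commute\<close>)
    ultimately show ?thesis
      by (intro len_conj_decrease) (use la u1 in auto)
  qed
  have split: "sum f U = sum f P + sum f (U - P)" for f :: "'a \<Rightarrow> real"
    using sum.subset_diff[OF PU(1) U(1), of f] by simp
  \<comment> \<open>At least nine tenths of \<open>U\<close> gain \<open>1500 * \<delta>\<close>
    each, the others lose at most \<open>2002 * \<delta>\<close> each. As \<open>9 * 1500\<close>
    far exceeds \<open>2002\<close>, the total gain is also larger than the tolerance 1 of near
    minimality.\<close>
  have "(\<Sum>u\<in>U. len (inv a \<otimes> u \<otimes> a)) = (\<Sum>u\<in>P. len (inv a \<otimes> u \<otimes> a)) + (\<Sum>u\<in>U - P. len (inv a \<otimes> u \<otimes> a))"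
    by (rule split)
  also have "\<dots> \<le> (\<Sum>u\<in>P. len u - 1500 * \<delta>) + (\<Sum>u\<in>U - P. len u + 2002 * \<delta>)"
  proof (intro add_mono sum_mono)
    fix u assume "u \<in> U - P"
    then have "u \<in> carrier G" using U by auto
    then show "len (inv a \<otimes> u \<otimes> a) \<le> len u + 2002 * \<delta>"
      using len_conj_upper[of a u] la by simp
  qed (rule dec)
  also have "\<dots> = (\<Sum>u\<in>P. len u) + (\<Sum>u\<in>U - P. len u) - 1500 * \<delta> * real (card P) + 2002 * \<delta> * real (card (U - P))"
    by (simp add: sum_subtractf sum.distrib)
  also have "(\<Sum>u\<in>P. len u) + (\<Sum>u\<in>U - P. len u) = (\<Sum>u\<in>U. len u)"
    by (rule split[symmetric])
  finally have "(\<Sum>u\<in>U. len (inv a \<otimes> u \<otimes> a))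
    \<le> (\<Sum>u\<in>U. len u) - 1500 * \<delta> * real (card P) + 2002 * \<delta> * real (card (U - P))" .
  then have "1500 * \<delta> * real (card P) \<le> 2002 * \<delta> * real (card (U - P)) + 1"
    using min[of a] by simp
  moreover have "9 * card (U - P) \<le> card P" "1 \<le> card P"
    using rest cU cpos by linarith+
  then have "9 * real (card (U - P)) \<le> real (card P)" "1 \<le> real (card P)"
    by linarith+
  then have "9 * (\<delta> * real (card (U - P))) \<le> \<delta> * real (card P)" "1 \<le> \<delta> * real (card P)"
    using delta_ge_1 mult_left_mono[of "9 * real (card (U - P))" "real (card P)" \<delta>]
      mult_mono[of 1 \<delta> 1 "real (card P)"] by auto
  ultimately show False by linarith
qed

subsection \<open>Growth of product sets\<close>

definition base_length :: real where
  "base_length = 1000000 * (real shift_const * \<delta>)"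

definition growth_const :: nat where
  "growth_const = 2 * types_const * class_const + 4 * types_const"

definition multiplicity_const :: nat where
  "multiplicity_const = window_const + coset_const"

lemma growth_of_coset:
  assumes p: "axial (1000 * \<delta>) p" and U: "finite U" "U \<subseteq> carrier G" "\<not> U \<subseteq> commensurator p"
    and V: "V \<subseteq> U" and v1: "v1 \<in> V" and coset: "\<And>v. v \<in> V \<Longrightarrow> v \<otimes> inv v1 \<in> commensurator p"
  shows "(card V - coset_const) ^ Suc k \<le> coset_const ^ k * card (set_power G U (2 * k + 1))"
proof -
  have pc: "p \<in> carrier G" by (rule axial_carrier[OF p])
  have finV: "finite V" and Vc: "V \<subseteq> carrier G" and v1c: "v1 \<in> carrier G"
    using finite_subset[OF V U(1)] V U v1 by auto
  have Une: "U \<noteq> {}" using v1 V by auto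
  show ?thesis
  proof (cases "v1 \<in> commensurator p")
    case True
    have VE: "V \<subseteq> commensurator p"
    proof
      fix v assume v: "v \<in> V"
      have "(v \<otimes> inv v1) \<otimes> v1 \<in> commensurator p"
        by (rule commensurator_mult[OF pc coset[OF v] True])
      moreover have "(v \<otimes> inv v1) \<otimes> v1 = v" using v Vc v1c by (auto simp: m_assoc)
      ultimately show "v \<in> commensurator p" by simp
    qed
    obtain w where w: "w \<in> U" "w \<notin> commensurator p" using U by blast
    have "(card V - coset_const) ^ Suc k \<le> coset_const ^ k * card (code w V k)"
      using w U by (intro commensurator_code_growth[OF p finV VE]) auto
    also have "card (code w V k) \<le> card (set_power G U (2 * k + 1))"
      using code_subset_set_power[OF V w(1) U(2)] set_power_finite[OF U(1)] by (intro card_mono)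
    finally show ?thesis by (simp add: mult_le_mono2)
  next
    case False
    define F where "F = (\<lambda>v. v \<otimes> inv v1) ` V"
    have F: "finite F" "F \<subseteq> commensurator p" using finV coset by (auto simp: F_def)
    have Fc: "F \<subseteq> carrier G" using F commensurator_carrier by auto
    have cF: "card F = card V"
      unfolding F_def
      by (intro card_image inj_on_subset[OF inj_on_mult_right Vc]) (use v1c in auto)
    have Q: "code v1 F k \<subseteq> carrier G" for k by (rule code_carrier[OF Fc v1c])
    \<comment> \<open>The factor \<open>inv v1\<close> of each letter cancels the separator behind
      it. After multiplication by \<open>v1\<close> the product collapses to one of only
      \<open>Suc k\<close> elements of \<open>V\<close>.\<close>
    have sub: "(\<lambda>x. x \<otimes> v1) ` code v1 F k \<subseteq> set_power G U (Suc k)" for k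
    proof (induction k)
      case 0
      have "(v \<otimes> inv v1) \<otimes> v1 \<in> set_power G U (Suc 0)" if "v \<in> V" for v
        using set_power_SucI[of v U \<one> 0] that V Vc v1c by (auto simp: m_assoc subset_eq simp del: set_power.simps(2))
      then show ?case by (auto simp: F_def simp del: set_power.simps)
    next
      case (Suc k)
      have "(e \<otimes> (v1 \<otimes> y)) \<otimes> v1 \<in> set_power G U (Suc (Suc k))" if e: "e \<in> F" and y: "y \<in> code v1 F k" for e y
      proof -
        obtain v where v: "v \<in> V" "e = v \<otimes> inv v1" using e by (auto simp: F_def)
        have "v \<in> carrier G" "y \<in> carrier G" using v y Vc Q by auto
        then have "(e \<otimes> (v1 \<otimes> y)) \<otimes> v1 = v \<otimes> (y \<otimes> v1)"
          using v1c by (simp add: v m_assoc inv_mult_cancel)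
        then show ?thesis using set_power_SucI[of v U "y \<otimes> v1" "Suc k"] v V Suc y by auto
      qed
      then show ?case by (auto simp del: set_power.simps)
    qed
    have "(card V - coset_const) ^ Suc k \<le> coset_const ^ k * card (code v1 F k)"
      using commensurator_code_growth[OF p F v1c False, of k] cF by simp
    also have "card (code v1 F k) = card ((\<lambda>x. x \<otimes> v1) ` code v1 F k)"
      by (intro card_image[symmetric] inj_on_subset[OF inj_on_mult_right Q]) (rule v1c)
    also have "\<dots> \<le> card (set_power G U (Suc k))"
      using sub set_power_finite[OF U(1)] by (intro card_mono)
    also have "\<dots> \<le> card (set_power G U (2 * k + 1))"
      by (rule card_set_power_mono[OF U(1,2) Une]) simp
    finally show ?thesis by (simp add: mult_le_mono2)
  qed
qed

lemma growth_odd_minimal: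
  assumes U: "finite U" "U \<subseteq> carrier G" "U \<noteq> {}"
    and nv: "\<And>p. axial (1000 * \<delta>) p \<Longrightarrow> \<not> U \<subseteq> commensurator p"
    and big: "20 * ball_size base_length \<le> card U" "4 * types_const * coset_const \<le> card U"
    and min: "\<And>g. g \<in> carrier G \<Longrightarrow> (\<Sum>u\<in>U. len u) \<le> (\<Sum>u\<in>U. len (inv g \<otimes> u \<otimes> g)) + 1"
  shows "\<exists>x. card U \<le> growth_const * x \<and>
    x ^ Suc k \<le> multiplicity_const ^ k * card (set_power G U (2 * k + 1))"
proof -
  have up: "multiplicity_const ^ k * n \<ge> m ^ k * n'" if "m \<le> multiplicity_const" "n' \<le> n" for m n n' k
    using that by (intro mult_le_mono power_mono) auto
  have "200 * \<delta> \<le> real shift_const * \<delta>"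
    by (rule mult_right_mono) (use shift_const_ge delta_ge_1 in auto)
  then have L: "5000 * \<delta> \<le> base_length" using delta_ge_1 by (simp add: base_length_def)
  obtain A B where A: "A \<subseteq> U" "card U \<le> types_const * card A" and B: "B \<subseteq> U" "card U \<le> types_const * card B"
    and AB: "\<And>u v. u \<in> A \<Longrightarrow> v \<in> B \<Longrightarrow> base_length \<le> len u \<and> base_length \<le> len v
      \<and> gp (inv u) v \<le> 902 * \<delta> \<and> gp (inv v) u \<le> 902 * \<delta>"
    using reduced_pairs[OF U L big(1) min] by blast
  have cpos: "0 < card U" using U by (simp add: card_gt_0_iff)
  have fin: "finite A" "finite B" using A B U finite_subset by auto
  have ne: "A \<noteq> {}" "B \<noteq> {}" using A B cpos by auto
  obtain W V where split: "(W \<subseteq> A \<and> V \<subseteq> B \<and> card A \<le> 2 * card W \<and> card B \<le> 2 * card V \<or>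
      W \<subseteq> B \<and> V \<subseteq> A \<and> card B \<le> 2 * card W \<and> card A \<le> 2 * card V) \<and> (\<forall>w\<in>W. \<forall>v\<in>V. len w \<le> len v)"
    using median_split[OF fin(1) ne(1) fin(2), of len] by (elim exE)
  note WV = conjunct1[OF split] and le = conjunct2[OF split, rule_format]
  have WU: "W \<subseteq> U" "V \<subseteq> U" using WV A B by auto
  have cW: "card U \<le> 2 * types_const * card W" and cV: "card U \<le> 2 * types_const * card V"
  proof -
    have *: "card U \<le> 2 * types_const * y" if "card U \<le> types_const * n" "n \<le> 2 * y" for n y
    proof -
      have "types_const * n \<le> types_const * (2 * y)" using that(2) by (rule mult_le_mono2)
      also have "\<dots> = 2 * types_const * y" by simp
      finally show ?thesis using that(1) by linarith
    qed
    show "card U \<le> 2 * types_const * card W" "card U \<le> 2 * types_const * card V"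
      using WV *[OF A(2)] *[OF B(2)] by blast+
  qed
  have T: "transverse v W" if v: "v \<in> V" for v
    unfolding transverse_def
  proof (intro conjI ballI)
    show "finite W" "v \<in> carrier G" "W \<subseteq> carrier G" using WU U v finite_subset[OF WU(1) U(1)] by auto
    fix w assume w: "w \<in> W"
    have "base_length \<le> len w \<and> gp (inv w) v \<le> 902 * \<delta> \<and> gp (inv v) w \<le> 902 * \<delta>"
      using WV AB[of w v] AB[of v w] v w by blast
    then show "1000000 * (real shift_const * \<delta>) \<le> len w" "gp (inv w) v \<le> 902 * \<delta>" "gp (inv v) w \<le> 902 * \<delta>"
      by (auto simp: base_length_def)
    show "len w \<le> len v" by (rule le[OF w v])
  qed
  have Wc: "finite W" "W \<subseteq> carrier G" using WU U finite_subset[OF WU(1) U(1)] by auto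
  have Wne: "W \<noteq> {}" and Vne: "V \<noteq> {}" using cW cV cpos by auto
  have ci: "card ((\<lambda>w. inv w) ` W) = card W"
    using Wc by (intro card_image inj_on_subset[OF inv_inj]) auto
  have growth: ?thesis
    if x: "card W \<le> class_const * x" "x ^ Suc k \<le> window_const ^ k * n" "n \<le> card (set_power G U (2 * k + 1))" for x n
  proof (intro exI[of _ x] conjI)
    have "2 * types_const * card W \<le> 2 * types_const * (class_const * x)" using x(1) by (rule mult_le_mono2)
    then have "card U \<le> 2 * types_const * class_const * x" using cW unfolding mult.assoc by (rule order_trans[rotated])
    also have "\<dots> \<le> growth_const * x" unfolding growth_const_def by (intro mult_le_mono1) simp
    finally show "card U \<le> growth_const * x" .
    show "x ^ Suc k \<le> multiplicity_const ^ k * card (set_power G U (2 * k + 1))"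
      by (rule order_trans[OF x(2) up[OF _ x(3)]]) (simp add: multiplicity_const_def)
  qed
  show ?thesis
  proof (cases "\<exists>v\<in>V. \<exists>W'\<subseteq>W. card W \<le> class_const * card W'
      \<and> (\<forall>k. card W' ^ Suc k \<le> window_const ^ k * card (code v W' k))")
    case True
    then obtain v W' where v: "v \<in> V" and W': "W' \<subseteq> W" "card W \<le> class_const * card W'"
      "card W' ^ Suc k \<le> window_const ^ k * card (code v W' k)" by blast
    have "code v W' k \<subseteq> set_power G U (2 * k + 1)"
      by (rule code_subset_set_power) (use v W' WU U in auto)
    then show ?thesis
      by (intro growth[OF W'(2,3)] card_mono set_power_finite[OF U(1)])
  next
    case F1: False
    show ?thesis
    proof (cases "\<exists>v\<in>V. \<exists>W'\<subseteq>(\<lambda>w. inv w) ` W. card W \<le> class_const * card W'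
        \<and> (\<forall>k. card W' ^ Suc k \<le> window_const ^ k * card (code (inv v) W' k))")
      case True
      then obtain v W' where v: "v \<in> V" and W': "W' \<subseteq> (\<lambda>w. inv w) ` W" "card W \<le> class_const * card W'"
        "card W' ^ Suc k \<le> window_const ^ k * card (code (inv v) W' k)" by blast
      have "code (inv v) W' k \<subseteq> set_power G ((\<lambda>u. inv u) ` U) (2 * k + 1)"
        by (rule code_subset_set_power) (use v W' WU U in auto)
      then have "card (code (inv v) W' k) \<le> card (set_power G ((\<lambda>u. inv u) ` U) (2 * k + 1))"
        using U by (intro card_mono set_power_finite) auto
      then show ?thesis
        unfolding card_inv_set_power[OF U(2)] by (rule growth[OF W'(2,3)])
    next
      case F2: False
      have per: "\<exists>p. shift p v \<and> class_const * card (lclass (commensurator p) ` W) < card W" if "v \<in> V" for v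
        using transverse_dichotomy[OF T[OF that] Wne] F1 that by blast
      have per': "\<exists>p. shift p (inv v) \<and> class_const * card (lclass (commensurator p) ` (\<lambda>w. inv w) ` W) < card W"
        if "v \<in> V" for v
        using transverse_dichotomy[OF transverse_inv[OF T[OF that]]] F2 that Wne unfolding ci by blast
      obtain v1 where v1: "v1 \<in> V" using Vne by blast
      obtain p1 where p1: "shift p1 v1" "class_const * card (lclass (commensurator p1) ` W) < card W"
        using per[OF v1] by blast
      obtain q1 where q1: "shift q1 (inv v1)" "class_const * card (lclass (commensurator q1) ` (\<lambda>w. inv w) ` W) < card W"
        using per'[OF v1] by blast
      have ax: "axial (1000 * \<delta>) p1" using p1 by (simp add: shift_def)
      have "v \<otimes> inv v1 \<in> commensurator p1" if v: "v \<in> V" for v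
      proof -
        obtain p where p: "shift p v" "class_const * card (lclass (commensurator p) ` W) < card W"
          using per[OF v] by blast
        obtain q where q: "shift q (inv v)" "class_const * card (lclass (commensurator q) ` (\<lambda>w. inv w) ` W) < card W"
          using per'[OF v] by blast
        show ?thesis by (rule periodic_coset[OF T[OF v1] T[OF v] Wne p1 p q1 q])
      qed
      then have g: "(card V - coset_const) ^ Suc k \<le> coset_const ^ k * card (set_power G U (2 * k + 1))"
        by (intro growth_of_coset[OF ax U(1,2) nv[OF ax] WU(2) v1])
      show ?thesis
      proof (intro exI[of _ "card V - coset_const"] conjI)
        have tpos: "0 < types_const" using cW cpos by (cases types_const) auto
        \<comment> \<open>The size assumption on \<open>U\<close> makes the subtraction of
          \<open>coset_const\<close> cost at most a factor 2.\<close>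
        have "2 * types_const * (2 * coset_const) = 4 * types_const * coset_const" by simp
        then have "2 * types_const * (2 * coset_const) \<le> 2 * types_const * card V" using big(2) cV by linarith
        then have "2 * coset_const \<le> card V" using tpos by simp
        then have "card V \<le> 2 * (card V - coset_const)" by simp
        then have "2 * types_const * card V \<le> 2 * types_const * (2 * (card V - coset_const))" by (rule mult_le_mono2)
        also have "\<dots> = 4 * types_const * (card V - coset_const)" by simp
        finally have "card U \<le> 4 * types_const * (card V - coset_const)" using cV by linarith
        also have "\<dots> \<le> growth_const * (card V - coset_const)" by (simp add: growth_const_def)
        finally show "card U \<le> growth_const * (card V - coset_const)" .
        show "(card V - coset_const) ^ Suc k \<le> multiplicity_const ^ k * card (set_power G U (2 * k + 1))"
          by (rule order_trans[OF g up]) (simp_all add: multiplicity_const_def)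
      qed
    qed
  qed
qed

text \<open>Coming within 1 of the infimum is enough, because the decrease produced in
  \<open>reduced_pairs\<close> is larger than 1.\<close>

lemma energy_minimizer:
  assumes U: "finite U" "U \<subseteq> carrier G"
  shows "\<exists>g\<in>carrier G. \<forall>h\<in>carrier G. (\<Sum>u\<in>U. len (inv g \<otimes> u \<otimes> g)) \<le> (\<Sum>u\<in>U. len (inv h \<otimes> u \<otimes> h)) + 1"
proof -
  define f where "f g = (\<Sum>u\<in>U. len (inv g \<otimes> u \<otimes> g))" for g
  have pos: "0 \<le> f g" if "g \<in> carrier G" for g
    unfolding f_def using that U by (intro sum_nonneg) auto
  have bdd: "bdd_below (f ` carrier G)" using pos by (intro bdd_belowI2)
  have ne: "f ` carrier G \<noteq> {}" by auto
  have "Inf (f ` carrier G) < Inf (f ` carrier G) + 1" by simp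
  then obtain y where "y \<in> f ` carrier G" "y < Inf (f ` carrier G) + 1"
    using cInf_lessD[OF ne] by blast
  then obtain g where g: "g \<in> carrier G" "f g < Inf (f ` carrier G) + 1" by auto
  have "f g \<le> f h + 1" if "h \<in> carrier G" for h
    using g(2) cInf_lower[OF _ bdd, of "f h"] that by auto
  then show ?thesis using g unfolding f_def by blast
qed

lemma growth_odd:
  assumes U: "finite U" "U \<subseteq> carrier G" "U \<noteq> {}"
    and nv: "\<not> (\<exists>H. virtually_cyclic_subgroup G H \<and> U \<subseteq> H)"
    and big: "20 * ball_size base_length \<le> card U" "4 * types_const * coset_const \<le> card U"
  shows "\<exists>x. card U \<le> growth_const * x \<and>
    x ^ Suc k \<le> multiplicity_const ^ k * card (set_power G U (2 * k + 1))"
proof -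
  obtain g where g: "g \<in> carrier G"
    and min: "\<And>h. h \<in> carrier G \<Longrightarrow> (\<Sum>u\<in>U. len (inv g \<otimes> u \<otimes> g)) \<le> (\<Sum>u\<in>U. len (inv h \<otimes> u \<otimes> h)) + 1"
    using energy_minimizer[OF U(1,2)] by blast
  note [simp] = g
  let ?c = "\<lambda>x. inv g \<otimes> x \<otimes> inv (inv g)"
  define U' where "U' = ?c ` U"
  have inj: "inj_on ?c (carrier G)" by (rule inj_on_conj) simp
  have injU: "inj_on ?c U" by (rule inj_on_subset[OF inj U(2)])
  have U': "finite U'" "U' \<subseteq> carrier G" "U' \<noteq> {}" using U by (auto simp: U'_def)
  have cU: "card U' = card U" unfolding U'_def by (rule card_image[OF injU])
  have cP: "card (set_power G U' n) = card (set_power G U n)" for n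
    unfolding U'_def conj_set_power[OF U(2) inv_closed[OF g], symmetric]
    by (rule card_image, rule inj_on_subset[OF inj set_power_carrier[OF U(2)]])
  have "\<exists>x. card U' \<le> growth_const * x \<and>
    x ^ Suc k \<le> multiplicity_const ^ k * card (set_power G U' (2 * k + 1))"
  proof (rule growth_odd_minimal[OF U'])
    fix p assume p: "axial (1000 * \<delta>) p"
    show "\<not> U' \<subseteq> commensurator p"
    proof
      assume s: "U' \<subseteq> commensurator p"
      have "u \<in> (\<lambda>x. g \<otimes> x \<otimes> inv g) ` commensurator p" if "u \<in> U" for u
      proof (rule image_eqI)
        have "u \<in> carrier G" using that U by auto
        then show "u = g \<otimes> ?c u \<otimes> inv g" by (simp add: m_assoc mult_inv_cancel)
        show "?c u \<in> commensurator p" using s that by (auto simp: U'_def)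
      qed
      then show False
        using nv conj_virtually_cyclic[OF commensurator_virtually_cyclic[OF p] g] by blast
    qed
  next
    fix h assume h: "h \<in> carrier G"
    have "(\<Sum>u\<in>U'. len u) = (\<Sum>u\<in>U. len (inv g \<otimes> u \<otimes> g))"
      unfolding U'_def by (subst sum.reindex[OF injU]) simp
    also have "\<dots> \<le> (\<Sum>u\<in>U. len (inv (g \<otimes> h) \<otimes> u \<otimes> (g \<otimes> h))) + 1"
      using h by (intro min) simp
    also have "(\<Sum>u\<in>U. len (inv (g \<otimes> h) \<otimes> u \<otimes> (g \<otimes> h))) = (\<Sum>u\<in>U'. len (inv h \<otimes> u \<otimes> h))"
      unfolding U'_def
      by (subst sum.reindex[OF injU], rule sum.cong)
        (use U h in \<open>auto simp: inv_mult_group m_assoc subset_eq\<close>)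
    finally show "(\<Sum>u\<in>U'. len u) \<le> (\<Sum>u\<in>U'. len (inv h \<otimes> u \<otimes> h)) + 1" .
  qed (use big cU in auto)
  then show ?thesis unfolding cU cP .
qed

theorem product_set_growth:
  "\<exists>\<alpha>::real. \<alpha> > 0 \<and>
    (\<forall>U. finite U \<and> U \<subseteq> carrier G \<and> \<not> (\<exists>H. virtually_cyclic_subgroup G H \<and> U \<subseteq> H) \<longrightarrow>
       (\<forall>n::nat. n \<ge> 1 \<longrightarrow>
          real (card (set_power G U n)) \<ge> (\<alpha> * real (card U)) ^ ((n + 1) div 2)))"
proof -
  \<comment> \<open>The last summands are the size thresholds: below them the base of the power is
    at most 1 and the claim is trivial.\<close>
  define D where "D = growth_const * multiplicity_const + 20 * ball_size base_length + 4 * types_const * coset_const + 1"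
  have "0 < D" by (simp add: D_def)
  then have D: "0 < real D" by simp
  have "(1 / real D * real (card U)) ^ ((n + 1) div 2) \<le> real (card (set_power G U n))"
    if U: "finite U" "U \<subseteq> carrier G" and nv: "\<not> (\<exists>H. virtually_cyclic_subgroup G H \<and> U \<subseteq> H)" and n: "1 \<le> n" for U n
  proof -
    \<comment> \<open>This excludes the empty set, for which product sets would not grow
      monotonically.\<close>
    have "virtually_cyclic_subgroup G {\<one>}"
      unfolding virtually_cyclic_subgroup_def
      by (intro conjI bexI[of _ \<one>] exI[of _ "{\<one>}"]) (auto simp: l_coset_def triv_subgroup)
    then have Une: "U \<noteq> {}" using nv by blast
    \<comment> \<open>\<open>2 * k + 1\<close> is the largest odd number up to \<open>n\<close>; an
      even \<open>n\<close> follows by monotonicity.\<close>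
    define k where "k = (n - 1) div 2"
    have k: "(n + 1) div 2 = Suc k" "2 * k + 1 \<le> n" using n by (auto simp: k_def)
    have "card (set_power G U (2 * k + 1)) \<le> card (set_power G U n)"
      by (rule card_set_power_mono[OF U Une k(2)])
    moreover have "(1 / real D * real (card U)) ^ Suc k \<le> real (card (set_power G U (2 * k + 1)))"
    proof (cases "20 * ball_size base_length \<le> card U \<and> 4 * types_const * coset_const \<le> card U")
      case True
      then obtain x where x: "card U \<le> growth_const * x"
        "x ^ Suc k \<le> multiplicity_const ^ k * card (set_power G U (2 * k + 1))"
        using growth_odd[OF U Une nv] by blast
      have mpos: "1 \<le> multiplicity_const"
        using ball_size_pos[of "100000 * \<delta>"] delta_ge_1 by (simp add: multiplicity_const_def window_const_def)
      have "card U ^ Suc k \<le> (growth_const * x) ^ Suc k" using x(1) by (rule power_mono) simp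
      also have "\<dots> = growth_const ^ Suc k * x ^ Suc k" by (rule power_mult_distrib)
      also have "\<dots> \<le> growth_const ^ Suc k * (multiplicity_const ^ k * card (set_power G U (2 * k + 1)))"
        using x(2) by (rule mult_le_mono2)
      also have "\<dots> \<le> growth_const ^ Suc k * (multiplicity_const ^ Suc k * card (set_power G U (2 * k + 1)))"
        using mpos by (intro mult_le_mono2 mult_le_mono1 power_increasing) auto
      also have "\<dots> = (growth_const * multiplicity_const) ^ Suc k * card (set_power G U (2 * k + 1))"
        by (simp only: power_mult_distrib mult.assoc)
      also have "\<dots> \<le> D ^ Suc k * card (set_power G U (2 * k + 1))"
        by (intro mult_le_mono1 power_mono) (auto simp: D_def)
      finally have "real (card U ^ Suc k) \<le> real (D ^ Suc k * card (set_power G U (2 * k + 1)))"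
        by (rule of_nat_mono)
      then have "real (card U) ^ Suc k \<le> real D ^ Suc k * real (card (set_power G U (2 * k + 1)))"
        by (simp only: of_nat_power of_nat_mult)
      then show ?thesis
        using D by (simp add: power_divide pos_divide_le_eq mult.commute del: power_Suc set_power.simps)
    next
      case False
      then have "card U \<le> D" by (auto simp: D_def)
      then have "1 / real D * real (card U) \<le> 1" using D by simp
      then have "(1 / real D * real (card U)) ^ Suc k \<le> 1" by (intro power_le_one) auto
      moreover have "card (set_power G U 0) \<le> card (set_power G U (2 * k + 1))"
        by (rule card_set_power_mono[OF U Une]) simp
      ultimately show ?thesis by simp
    qed
    ultimately show ?thesis unfolding k(1) by linarith
  qed
  then show ?thesis using D by (intro exI[of _ "1 / real D"]) auto
qed

end

section \<open>Orbit maps of proper cocompact actions\<close>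

theorem theorem1p1:
  fixes G :: "('a, 'c) monoid_scheme"
    and \<phi> :: "'a \<Rightarrow> 'b::metric_space \<Rightarrow> 'b"
    and \<delta> :: real
  assumes "group G"
    and "proper_space TYPE('b)"
    and "geodesic_space TYPE('b)"
    and "\<delta> \<ge> 0"
    and "delta_hyperbolic TYPE('b) \<delta>"
    and "isometric_action G \<phi>"
    and "proper_action G \<phi>"
    and "cocompact_action G \<phi>"
  shows "\<exists>\<alpha>::real. \<alpha> > 0 \<and>
    (\<forall>U. finite U \<and> U \<subseteq> carrier G \<and>
         \<not> (\<exists>H. virtually_cyclic_subgroup G H \<and> U \<subseteq> H) \<longrightarrow>
       (\<forall>n::nat. n \<ge> 1 \<longrightarrow>
          real (card (set_power G U n)) \<ge> (\<alpha> * real (card U)) ^ ((n + 1) div 2)))"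
proof -
  interpret group G by (rule assms(1))
  note proper = assms(2)[unfolded proper_space_def] and geod = assms(3)[unfolded geodesic_space_def]
    and hyp = assms(5)[unfolded delta_hyperbolic_def gromov_product_def]
  have act: "\<phi> \<one>\<^bsub>G\<^esub> x = x" "g \<in> carrier G \<Longrightarrow> h \<in> carrier G \<Longrightarrow> \<phi> (g \<otimes>\<^bsub>G\<^esub> h) x = \<phi> g (\<phi> h x)"
    "g \<in> carrier G \<Longrightarrow> dist (\<phi> g x) (\<phi> g y) = dist x y" for g h x y
    using assms(6) by (auto simp: isometric_action_def)
  \<comment> \<open>Any base point will do; \<open>undefined\<close> merely names one.\<close>
  define pt :: 'b where "pt = undefined"
  obtain K where K: "compact K" "(\<Union>g\<in>carrier G. \<phi> g ` K) = UNIV"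
    using assms(8) by (auto simp: cocompact_action_def)
  obtain D where D: "\<And>k. k \<in> K \<Longrightarrow> dist pt k \<le> D"
    using compact_imp_bounded[OF K(1)] by (auto simp: bounded_any_center[where a = pt])
  have cover: "\<exists>g\<in>carrier G. dist x (\<phi> g pt) \<le> D" for x
  proof -
    obtain g k where g: "g \<in> carrier G" "k \<in> K" "x = \<phi> g k" using K(2) by blast
    then have "dist x (\<phi> g pt) \<le> D" using D[of k] act(3) by (simp add: dist_commute)
    then show ?thesis using g by blast
  qed
  have D0: "0 \<le> D" using cover[of pt] zero_le_dist order_trans by blast
  define len where "len g = dist pt (\<phi> g pt)" for g
  have len_diff: "len (inv\<^bsub>G\<^esub> a \<otimes>\<^bsub>G\<^esub> b) = dist (\<phi> a pt) (\<phi> b pt)" if "a \<in> carrier G" "b \<in> carrier G" for a b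
  proof -
    have "dist (\<phi> a pt) (\<phi> b pt) = dist (\<phi> (inv\<^bsub>G\<^esub> a) (\<phi> a pt)) (\<phi> (inv\<^bsub>G\<^esub> a) (\<phi> b pt))"
      using that by (simp add: act(3))
    then show ?thesis using that by (simp add: act(2)[symmetric] act(1) len_def)
  qed
  \<comment> \<open>\<open>D\<close> is the distance within which the orbit meets every point of a
    geodesic, and 1 ensures the normalization of the constant.\<close>
  interpret hyperbolic_length G len "\<delta> + D + 1"
  proof unfold_locales
    show "len \<one>\<^bsub>G\<^esub> = 0" by (simp add: len_def act(1))
    show "1 \<le> \<delta> + D + 1" using assms(4) D0 by simp
  next
    fix g assume "g \<in> carrier G"
    then show "len (inv\<^bsub>G\<^esub> g) = len g"
      using len_diff[of g "\<one>\<^bsub>G\<^esub>"] by (simp add: act(1) len_def dist_commute)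
  next
    fix g h assume "g \<in> carrier G" "h \<in> carrier G"
    then show "len (g \<otimes>\<^bsub>G\<^esub> h) \<le> len g + len h"
      using dist_triangle[of pt "\<phi> g (\<phi> h pt)" "\<phi> g pt"] by (simp add: len_def act)
  next
    fix r
    have "compact (cball pt r)" using proper by blast
    then have "finite {g \<in> carrier G. \<phi> g ` cball pt r \<inter> cball pt r \<noteq> {}}"
      using assms(7) by (simp add: proper_action_def)
    moreover have "{g \<in> carrier G. len g \<le> r} \<subseteq> {g \<in> carrier G. \<phi> g ` cball pt r \<inter> cball pt r \<noteq> {}}"
    proof clarsimp
      fix g assume r: "len g \<le> r" and e: "\<phi> g ` cball pt r \<inter> cball pt r = {}"
      have "0 \<le> len g" by (simp add: len_def)
      then have "0 \<le> r" using r by simp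
      then have "pt \<in> cball pt r" "\<phi> g pt \<in> cball pt r" using r by (simp_all add: len_def)
      then have "\<phi> g pt \<in> \<phi> g ` cball pt r \<inter> cball pt r" by blast
      then show False using e by simp
    qed
    ultimately show "finite {g \<in> carrier G. len g \<le> r}" by (rule finite_subset[rotated])
  next
    fix a b c assume abc: "a \<in> carrier G" "b \<in> carrier G" "c \<in> carrier G"
    have halves: "min (x / 2) (y / 2) - \<delta> \<le> z / 2 \<Longrightarrow> min x y - 2 * (\<delta> + D + 1) \<le> z" for x y z
      using D0 by (auto simp: min_def split: if_splits)
    show "min (len a + len c - len (inv\<^bsub>G\<^esub> a \<otimes>\<^bsub>G\<^esub> c)) (len c + len b - len (inv\<^bsub>G\<^esub> c \<otimes>\<^bsub>G\<^esub> b)) - 2 * (\<delta> + D + 1)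
      \<le> len a + len b - len (inv\<^bsub>G\<^esub> a \<otimes>\<^bsub>G\<^esub> b)"
      unfolding len_diff[OF abc(1,2)] len_diff[OF abc(1,3)] len_diff[OF abc(3,2)]
        add.commute[of "len c" "len b"] dist_commute[of "\<phi> c pt" "\<phi> b pt"]
      unfolding len_def by (rule halves, rule hyp[rule_format])
  next
    fix g t assume g: "g \<in> carrier G" and t: "0 \<le> t" "t \<le> len g"
    obtain \<gamma> :: "real \<Rightarrow> 'b" where \<gamma>: "\<gamma> 0 = pt" "\<gamma> (len g) = \<phi> g pt"
      "\<And>s s'. s \<in> {0..len g} \<Longrightarrow> s' \<in> {0..len g} \<Longrightarrow> dist (\<gamma> s) (\<gamma> s') = \<bar>s - s'\<bar>"
      using geod[rule_format, of pt "\<phi> g pt"] unfolding len_def by auto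
    obtain y where y: "y \<in> carrier G" "dist (\<gamma> t) (\<phi> y pt) \<le> D" using cover by blast
    have 1: "dist pt (\<gamma> t) = t" "dist (\<gamma> t) (\<phi> g pt) = len g - t"
      using \<gamma>(3)[of 0 t] \<gamma>(3)[of t "len g"] \<gamma>(1,2) t by auto
    have "\<bar>len y - t\<bar> \<le> D"
      using 1 y(2) dist_triangle[of pt "\<phi> y pt" "\<gamma> t"] dist_triangle[of pt "\<gamma> t" "\<phi> y pt"]
      by (simp add: len_def dist_commute abs_le_iff)
    moreover have "len (inv\<^bsub>G\<^esub> y \<otimes>\<^bsub>G\<^esub> g) \<le> D + (len g - t)"
      unfolding len_diff[OF y(1) g] using 1 y(2) dist_triangle[of "\<phi> y pt" "\<phi> g pt" "\<gamma> t"]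
      by (simp add: dist_commute)
    ultimately show "\<exists>y\<in>carrier G. \<bar>len y - t\<bar> \<le> \<delta> + D + 1 \<and> len y + len (inv\<^bsub>G\<^esub> y \<otimes>\<^bsub>G\<^esub> g) \<le> len g + 2 * (\<delta> + D + 1)"
      using y(1) assms(4) by (intro bexI[of _ y]) auto
  qed
  show ?thesis by (rule product_set_growth)
qed

end
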